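(* Let $\mathbf{k}$ be a commutative ring, $\delta\in\mathbf{k}$, and $B=B^{\mathbf{k},\delta}$ the Brauer category. The pairing $b$ of $B$ admits a copairing $d$ and we have isomorphisms of $\mathbf{k}$-linear categories $$B\xrightarrow[\cong]{F_d}pB\xrightarrow[\cong]{K_{b,b'}}mB\xrightarrow[\cong]{F_{d'}^{-1}}qB$$ if and only if $\delta$ is non-singular.
   Context: **Brauer diagrams and category.** For $p,q\ge0$, a $(p,q)$-Brauer diagram is a partition of $[p]^+\sqcup[q]^-=\{1^+,\dots,p^+\}\sqcup\{1^-,\dots,q^-\}$ into unordered pairs ($i^+$ top points, $i^-$ bottom points); $\mathbb{B}(p,q)$ is their set. Upward: no pair of two top points; downward: no pair of two bottom points; level: both; monotone: $(i-k)(j-l)>0$ for any two distinct pairs $\{i^+,j^-\},\{k^+,l^-\}$. $\mathbb{B}^+,\mathbb{B}^-,\mathbb{B}^0$: upward, downward, level; $\mathbb{B}^{\pm,m}$: monotone ones in $\mathbb{B}^\pm$. $\overline f$: exchange $i^\pm\leftrightarrow i^\mp$. $p\preceq q$ iff $p\le q$ and $q-p$ even. $B$ has objects the non-negative integers, $B(p,q)$ free on $\mathbb{B}(p,q)$, $f\circ g=\delta^{l(f,g)}f\hat\circ g$ where $g$ is placed above $f$, $l(f,g)$ is the number of closed loops, $f\hat\circ g$ the diagram after deleting loops. $B^\pm$: wide subcategories spanned by $\mathbb{B}^\pm$, with compositions $\mu^\pm$; $\mathbb{S}$: wide subcategory spanned by level diagrams, $\mathbb{S}_p=\mathbb{S}(p,p)=\mathbf{k}[\mathfrak{S}_p]$.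 With $(M\otimes_{\mathbb{S}}N)(p,q)=\bigoplus_sM(s,q)\otimes_{\mathbb{S}_s}N(p,s)$ for $\mathbb{S}$-bimodules, composition identifies $B^+\otimes_{\mathbb{S}}B^-=B$ as $\mathbb{S}$-bimodules. Each diagram is uniquely $f=f^+f^0f^-$ with $f^\pm$ monotone upward/downward and $f^0$ level. **Pairings.** $b:B^-\otimes_{\mathbb{S}}B^+\to\mathbb{S}$ sends $g\otimes f$ (diagrams) to $g\circ f$ if $g\hat\circ f$ is level and to $0$ otherwise. A copairing of $b$ is an $\mathbb{S}$-bimodule map $d:\mathbb{S}\to B^+\otimes_{\mathbb{S}}B^-$ with $(\mathrm{id}_{B^+}\otimes b)(d\otimes\mathrm{id}_{B^+})=\mathrm{id}_{B^+}$ and $(b\otimes\mathrm{id}_{B^-})(\mathrm{id}_{B^-}\otimes d)=\mathrm{id}_{B^-}$; it is unique if it exists. $b':B^-\otimes_{\mathbb{S}}B^+\to\mathbb{S}$ sends $u\otimes w$ ($u\in\mathbb{B}^-(q,s)$, $w\in\mathbb{B}^+(p,q)$) to $\sigma$ if $s=p$ and $u=\sigma\overline w$, $\sigma\in\mathfrak{S}_p$, and to $0$ otherwise; it has copairing $d'(1_p)=\sum_{s\preceq p}\sum_{f\in\mathbb{B}^{+,m}(s,p)}f\otimes\overline f$. **The variants of $B$.** All have the same objects and hom-modules $B(p,q)=(B^+\otimes_{\mathbb{S}}B^-)(p,q)$. - $pB$ (pseudo-Brauer): composition $\mathrm{id}_{B^+}\otimes b\otimes\mathrm{id}_{B^-}$,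 i.e. $fg=f\circ g$ (composite in $B$) if $f^-\hat\circ g^+$ is level and $0$ otherwise; identities $d(1_p)$ (so $pB$ requires the copairing $d$). - $mB$ (matrix Brauer): composition $\mathrm{id}_{B^+}\otimes b'\otimes\mathrm{id}_{B^-}$, i.e. $(f^+f^0f^-)(g^+g^0g^-)=f^+(f^0g^0)g^-$ if $\overline{f^-}=g^+$ and $0$ otherwise; identities $d'(1_p)$. - $qB$ (quasi-Brauer): for $g\in\mathbb{B}(p,q)$, $f\in\mathbb{B}(q,r)$ the composite is $0$ if there are distinct $i,j,k\in[q]$ with $\{i^-,j^-\}\in g$ and $\{j^+,k^+\}\in f$, and $f\hat\circ g$ otherwise; identities as in $B$. **The functors** (identity on objects). $F_d=(\mu^+\otimes\mu^-)(\mathrm{id}_{B^+}\otimes d\otimes\mathrm{id}_{B^-})$; $K_{b,b'}=K^+_{b,b'}\otimes\mathrm{id}_{B^-}$ with $K^+_{b,b'}=(\mathrm{id}_{B^+}\otimes b)(d'\otimes\mathrm{id}_{B^+})$; $F_{d'}=(\mu^+\otimes\mu^-)(\mathrm{id}_{B^+}\otimes d'\otimes\mathrm{id}_{B^-}):qB\to mB$, which is an isomorphism of linear categories. **Non-singularity.** For $p\preceq q$, over $\mathbb{Z}[x]$ with parameter $x$ let $A_{p,q}=(b(\overline f\otimes g))_{f,g\in\mathbb{B}^{+,m}(p,q)}\in M_n(\mathbb{Z}[x][\mathfrak{S}_p])$, $\iota:M_n(\mathbb{Z}[x][\mathfrak{S}_p])\hookrightarrow M_{n\,p!}(\mathbb{Z}[x])$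 induced by the left regular representation, $f_{p,q}(x)=\det\iota(A_{p,q})$. $\delta$ is non-singular if $f_{p,q}(\delta)$ is invertible in $\mathbf{k}$ for all $p\preceq q$. *)

theory Defs
  imports
    "HOL-Library.Poly_Mapping"
    "HOL-Library.Disjoint_Sets"
    "HOL-Library.Countable_Set"
    "Jordan_Normal_Form.Determinant"
begin

text \<open>The free module over a commutative ring on a set \<open>X\<close> of basis elements is the set of
  finitely supported functions with support in \<open>X\<close>.\<close>

definition smul :: "'k::comm_ring_1 \<Rightarrow> ('a \<Rightarrow>\<^sub>0 'k) \<Rightarrow> ('a \<Rightarrow>\<^sub>0 'k)" where
  "smul c v = Poly_Mapping.map ((*) c) v"

lemma lookup_smul [simp]: "Poly_Mapping.lookup (smul c v) a = c * Poly_Mapping.lookup v a"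
  by (simp add: smul_def Poly_Mapping.map.rep_eq when_def)

lemma module_smul: "Modules.module smul"
  by unfold_locales (auto intro!: poly_mapping_eqI simp: lookup_add algebra_simps)

definition free_on :: "'a set \<Rightarrow> ('a \<Rightarrow>\<^sub>0 'k::comm_ring_1) set" where
  "free_on X = {v. Poly_Mapping.keys v \<subseteq> X}"

definition basis :: "'a \<Rightarrow> ('a \<Rightarrow>\<^sub>0 'k::comm_ring_1)" where
  "basis a = Poly_Mapping.single a 1"

definition lin_ext :: "('a \<Rightarrow> ('b \<Rightarrow>\<^sub>0 'k::comm_ring_1)) \<Rightarrow> ('a \<Rightarrow>\<^sub>0 'k) \<Rightarrow> ('b \<Rightarrow>\<^sub>0 'k)" where
  "lin_ext \<phi> v = (\<Sum>a\<in>Poly_Mapping.keys v. smul (Poly_Mapping.lookup v a) (\<phi> a))"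

definition bilin_ext ::
  "('a \<Rightarrow> 'b \<Rightarrow> ('c \<Rightarrow>\<^sub>0 'k::comm_ring_1)) \<Rightarrow> ('a \<Rightarrow>\<^sub>0 'k) \<Rightarrow> ('b \<Rightarrow>\<^sub>0 'k) \<Rightarrow> ('c \<Rightarrow>\<^sub>0 'k)" where
  "bilin_ext \<phi> v w = lin_ext (\<lambda>a. lin_ext (\<phi> a) w) v"

text \<open>Composition is written without indices for the three objects involved. Hom-modules are not
  required to be disjoint (all of them contain the same zero).\<close>

record ('o, 'm) lin_cat =
  Hom :: "'o \<Rightarrow> 'o \<Rightarrow> 'm set"
  Comp :: "'m \<Rightarrow> 'm \<Rightarrow> 'm"
  Ident :: "'o \<Rightarrow> 'm"

locale linear_category =
  fixes C :: "('o, 'a \<Rightarrow>\<^sub>0 'k::comm_ring_1) lin_cat"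
  assumes Hom_submodule: "Modules.module.subspace smul (Hom C p q)"
    and Comp_closed: "g \<in> Hom C p q \<Longrightarrow> f \<in> Hom C q r \<Longrightarrow> Comp C f g \<in> Hom C p r"
    and Comp_add_left: "g \<in> Hom C p q \<Longrightarrow> f \<in> Hom C q r \<Longrightarrow> f' \<in> Hom C q r \<Longrightarrow>
      Comp C (f + f') g = Comp C f g + Comp C f' g"
    and Comp_add_right: "g \<in> Hom C p q \<Longrightarrow> g' \<in> Hom C p q \<Longrightarrow> f \<in> Hom C q r \<Longrightarrow>
      Comp C f (g + g') = Comp C f g + Comp C f g'"
    and Comp_smul_left: "g \<in> Hom C p q \<Longrightarrow> f \<in> Hom C q r \<Longrightarrow>
      Comp C (smul c f) g = smul c (Comp C f g)"
    and Comp_smul_right: "g \<in> Hom C p q \<Longrightarrow> f \<in> Hom C q r \<Longrightarrow>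
      Comp C f (smul c g) = smul c (Comp C f g)"
    and Comp_assoc: "h \<in> Hom C p q \<Longrightarrow> g \<in> Hom C q r \<Longrightarrow> f \<in> Hom C r s \<Longrightarrow>
      Comp C (Comp C f g) h = Comp C f (Comp C g h)"
    and Ident_closed: "Ident C p \<in> Hom C p p"
    and Ident_left: "f \<in> Hom C p q \<Longrightarrow> Comp C (Ident C q) f = f"
    and Ident_right: "f \<in> Hom C p q \<Longrightarrow> Comp C f (Ident C p) = f"

text \<open>Functors that are the identity on objects; \<open>F p q\<close> is the map on morphisms \<open>p \<rightarrow> q\<close>.\<close>

locale linear_category_iso =
  source: linear_category C + target: linear_category D
  for C D :: "('o, 'a \<Rightarrow>\<^sub>0 'k::comm_ring_1) lin_cat" +
  fixes F :: "'o \<Rightarrow> 'o \<Rightarrow> ('a \<Rightarrow>\<^sub>0 'k) \<Rightarrow> ('a \<Rightarrow>\<^sub>0 'k)"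
  assumes F_bij: "bij_betw (F p q) (Hom C p q) (Hom D p q)"
    and F_add: "f \<in> Hom C p q \<Longrightarrow> g \<in> Hom C p q \<Longrightarrow> F p q (f + g) = F p q f + F p q g"
    and F_smul: "f \<in> Hom C p q \<Longrightarrow> F p q (smul c f) = smul c (F p q f)"
    and F_Comp: "g \<in> Hom C p q \<Longrightarrow> f \<in> Hom C q r \<Longrightarrow>
      F p r (Comp C f g) = Comp D (F q r f) (F p q g)"
    and F_Ident: "F p p (Ident C p) = Ident D p"

definition inv_functor ::
  "('o, 'a \<Rightarrow>\<^sub>0 'k::comm_ring_1) lin_cat \<Rightarrow> ('o \<Rightarrow> 'o \<Rightarrow> ('a \<Rightarrow>\<^sub>0 'k) \<Rightarrow> ('a \<Rightarrow>\<^sub>0 'k)) \<Rightarrow>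
    'o \<Rightarrow> 'o \<Rightarrow> ('a \<Rightarrow>\<^sub>0 'k) \<Rightarrow> ('a \<Rightarrow>\<^sub>0 'k)" where
  "inv_functor C F = (\<lambda>p q. inv_into (Hom C p q) (F p q))"

datatype point = Top nat | Bot nat

type_synonym diagram = "point set set"

definition diagrams :: "nat \<Rightarrow> nat \<Rightarrow> diagram set" where
  "diagrams p q = {f. partition_on (Top ` {1..p} \<union> Bot ` {1..q}) f \<and> (\<forall>e\<in>f. card e = 2)}"

definition upward :: "diagram \<Rightarrow> bool" where
  "upward f \<longleftrightarrow> (\<forall>i j. {Top i, Top j} \<notin> f)"

definition downward :: "diagram \<Rightarrow> bool" where
  "downward f \<longleftrightarrow> (\<forall>i j. {Bot i, Bot j} \<notin> f)"

definition level :: "diagram \<Rightarrow> bool" where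
  "level f \<longleftrightarrow> upward f \<and> downward f"

definition monotone_diagram :: "diagram \<Rightarrow> bool" where
  "monotone_diagram f \<longleftrightarrow>
    (\<forall>i j k l. {Top i, Bot j} \<in> f \<longrightarrow> {Top k, Bot l} \<in> f \<longrightarrow> {Top i, Bot j} \<noteq> {Top k, Bot l} \<longrightarrow>
      (int i - int k) * (int j - int l) > 0)"

definition up_diagrams :: "nat \<Rightarrow> nat \<Rightarrow> diagram set" where
  "up_diagrams p q = {f \<in> diagrams p q. upward f}"

definition down_diagrams :: "nat \<Rightarrow> nat \<Rightarrow> diagram set" where
  "down_diagrams p q = {f \<in> diagrams p q. downward f}"

definition level_diagrams :: "nat \<Rightarrow> nat \<Rightarrow> diagram set" where
  "level_diagrams p q = {f \<in> diagrams p q. level f}"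

definition mono_up_diagrams :: "nat \<Rightarrow> nat \<Rightarrow> diagram set" where
  "mono_up_diagrams p q = {f \<in> up_diagrams p q. monotone_diagram f}"

definition mono_down_diagrams :: "nat \<Rightarrow> nat \<Rightarrow> diagram set" where
  "mono_down_diagrams p q = {f \<in> down_diagrams p q. monotone_diagram f}"

fun flip :: "point \<Rightarrow> point" where
  "flip (Top i) = Bot i"
| "flip (Bot i) = Top i"

definition bar :: "diagram \<Rightarrow> diagram" where
  "bar f = (\<lambda>e. flip ` e) ` f"

definition prec :: "nat \<Rightarrow> nat \<Rightarrow> bool" where
  "prec p q \<longleftrightarrow> p \<le> q \<and> even (q - p)"

definition id_diagram :: "nat \<Rightarrow> diagram" where
  "id_diagram p = (\<lambda>i. {Top i, Bot i}) ` {1..p}"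

text \<open>To compose \<open>f\<close> with \<open>g\<close>, place \<open>g\<close> above \<open>f\<close> and identify the bottom points of \<open>g\<close> with the
  top points of \<open>f\<close>. The result is a graph on upper, middle and lower points. If \<open>f\<close> and \<open>g\<close> share
  a pair of middle points, the double edge is represented by a single one, which does not affect
  the connected components.\<close>

datatype stack_point = Upper nat | Middle nat | Lower nat

fun place_above :: "point \<Rightarrow> stack_point" where
  "place_above (Top i) = Upper i"
| "place_above (Bot i) = Middle i"

fun place_below :: "point \<Rightarrow> stack_point" where
  "place_below (Top i) = Middle i"
| "place_below (Bot i) = Lower i"

fun outer :: "point \<Rightarrow> stack_point" where
  "outer (Top i) = Upper i"
| "outer (Bot i) = Lower i"

definition stack :: "diagram \<Rightarrow> diagram \<Rightarrow> stack_point set set" where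
  "stack f g = (\<lambda>e. place_above ` e) ` g \<union> (\<lambda>e. place_below ` e) ` f"

definition connected_in :: "stack_point set set \<Rightarrow> (stack_point \<times> stack_point) set" where
  "connected_in E = {(x, y). {x, y} \<in> E}\<^sup>*"

definition hat_comp :: "diagram \<Rightarrow> diagram \<Rightarrow> diagram" where
  "hat_comp f g = {{x, y} | x y. x \<noteq> y \<and> outer x \<in> \<Union>(stack f g) \<and> outer y \<in> \<Union>(stack f g) \<and>
     (outer x, outer y) \<in> connected_in (stack f g)}"

definition loops :: "diagram \<Rightarrow> diagram \<Rightarrow> nat" where
  "loops f g = card {c \<in> \<Union>(stack f g) // connected_in (stack f g). c \<subseteq> range Middle}"

text \<open>The unique factorisation \<open>f = f\<^sup>+ f\<^sup>0 f\<^sup>-\<close>, together with the object \<open>s\<close> through which it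
  passes.\<close>

definition factorisation :: "diagram \<Rightarrow> nat \<times> diagram \<times> diagram \<times> diagram" where
  "factorisation f = (THE (s, a, \<sigma>, c). \<exists>p q. f \<in> diagrams p q \<and>
     a \<in> mono_up_diagrams s q \<and> \<sigma> \<in> level_diagrams s s \<and> c \<in> mono_down_diagrams p s \<and>
     f = hat_comp a (hat_comp \<sigma> c))"

definition through :: "diagram \<Rightarrow> nat" where
  "through f = (case factorisation f of (s, a, \<sigma>, c) \<Rightarrow> s)"

definition plus_part :: "diagram \<Rightarrow> diagram" where
  "plus_part f = (case factorisation f of (s, a, \<sigma>, c) \<Rightarrow> a)"

definition zero_part :: "diagram \<Rightarrow> diagram" where
  "zero_part f = (case factorisation f of (s, a, \<sigma>, c) \<Rightarrow> \<sigma>)"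

definition minus_part :: "diagram \<Rightarrow> diagram" where
  "minus_part f = (case factorisation f of (s, a, \<sigma>, c) \<Rightarrow> c)"

type_synonym 'k mor = "diagram \<Rightarrow>\<^sub>0 'k"

definition comp_diagrams :: "'k::comm_ring_1 \<Rightarrow> diagram \<Rightarrow> diagram \<Rightarrow> 'k mor" where
  "comp_diagrams \<delta> f g = smul (\<delta> ^ loops f g) (basis (hat_comp f g))"

definition bcomp :: "'k::comm_ring_1 \<Rightarrow> 'k mor \<Rightarrow> 'k mor \<Rightarrow> 'k mor" where
  "bcomp \<delta> = bilin_ext (comp_diagrams \<delta>)"

definition one :: "nat \<Rightarrow> 'k::comm_ring_1 mor" where
  "one p = basis (id_diagram p)"

definition B_hom :: "nat \<Rightarrow> nat \<Rightarrow> 'k::comm_ring_1 mor set" where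
  "B_hom p q = free_on (diagrams p q)"

definition Bplus :: "nat \<Rightarrow> nat \<Rightarrow> 'k::comm_ring_1 mor set" where
  "Bplus p q = free_on (up_diagrams p q)"

definition Bminus :: "nat \<Rightarrow> nat \<Rightarrow> 'k::comm_ring_1 mor set" where
  "Bminus p q = free_on (down_diagrams p q)"

definition S_hom :: "nat \<Rightarrow> nat \<Rightarrow> 'k::comm_ring_1 mor set" where
  "S_hom p q = free_on (level_diagrams p q)"

definition Brauer :: "'k::comm_ring_1 \<Rightarrow> (nat, 'k mor) lin_cat" where
  "Brauer \<delta> = \<lparr>Hom = B_hom, Comp = bcomp \<delta>, Ident = one\<rparr>"

text \<open>For sub-bimodules \<open>M\<close>, \<open>N\<close> of the Brauer category, an element of
  \<open>(M \<otimes> N)(p, q) = \<Oplus>\<^sub>s M(s, q) \<otimes> N(p, s)\<close>, the inner tensor products being taken over the level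
  endomorphisms of \<open>s\<close>, is represented by a formal linear combination of triples \<open>(s, u, v)\<close>
  with \<open>u \<in> M(s, q)\<close> and \<open>v \<in> N(p, s)\<close>. Two representatives denote the same element iff they
  satisfy \<open>tensor_eq\<close>.\<close>

type_synonym 'k tens = "(nat \<times> 'k mor \<times> 'k mor) \<Rightarrow>\<^sub>0 'k"

definition tensors ::
  "(nat \<Rightarrow> nat \<Rightarrow> 'k::comm_ring_1 mor set) \<Rightarrow> (nat \<Rightarrow> nat \<Rightarrow> 'k mor set) \<Rightarrow> nat \<Rightarrow> nat \<Rightarrow> 'k tens set"
where
  "tensors M N p q = free_on {(s, u, v). u \<in> M s q \<and> v \<in> N p s}"

definition tensor_relations ::
  "'k::comm_ring_1 \<Rightarrow> (nat \<Rightarrow> nat \<Rightarrow> 'k mor set) \<Rightarrow> (nat \<Rightarrow> nat \<Rightarrow> 'k mor set) \<Rightarrow>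
    nat \<Rightarrow> nat \<Rightarrow> 'k tens set"
where
  "tensor_relations \<delta> M N p q =
     {basis (s, u + u', v) - basis (s, u, v) - basis (s, u', v) | s u u' v.
        u \<in> M s q \<and> u' \<in> M s q \<and> v \<in> N p s} \<union>
     {basis (s, u, v + v') - basis (s, u, v) - basis (s, u, v') | s u v v'.
        u \<in> M s q \<and> v \<in> N p s \<and> v' \<in> N p s} \<union>
     {basis (s, smul c u, v) - smul c (basis (s, u, v)) | s c u v. u \<in> M s q \<and> v \<in> N p s} \<union>
     {basis (s, u, smul c v) - smul c (basis (s, u, v)) | s c u v. u \<in> M s q \<and> v \<in> N p s} \<union>
     {basis (s, bcomp \<delta> u x, v) - basis (s, u, bcomp \<delta> x v) | s u x v.
        u \<in> M s q \<and> x \<in> S_hom s s \<and> v \<in> N p s}"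

definition tensor_eq ::
  "'k::comm_ring_1 \<Rightarrow> (nat \<Rightarrow> nat \<Rightarrow> 'k mor set) \<Rightarrow> (nat \<Rightarrow> nat \<Rightarrow> 'k mor set) \<Rightarrow>
    nat \<Rightarrow> nat \<Rightarrow> 'k tens \<Rightarrow> 'k tens \<Rightarrow> bool"
where
  "tensor_eq \<delta> M N p q t t' \<longleftrightarrow> t - t' \<in> Modules.module.span smul (tensor_relations \<delta> M N p q)"

definition act_left :: "'k::comm_ring_1 \<Rightarrow> 'k mor \<Rightarrow> 'k tens \<Rightarrow> 'k tens" where
  "act_left \<delta> x = lin_ext (\<lambda>(s, u, v). basis (s, bcomp \<delta> x u, v))"

definition act_right :: "'k::comm_ring_1 \<Rightarrow> 'k tens \<Rightarrow> 'k mor \<Rightarrow> 'k tens" where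
  "act_right \<delta> t x = lin_ext (\<lambda>(s, u, v). basis (s, u, bcomp \<delta> v x)) t"

text \<open>The identification of the tensor product of \<open>Bplus\<close> and \<open>Bminus\<close> with \<open>B\<close> by composition.
  No loops arise here, so the result does not depend on \<open>\<delta>\<close>.\<close>

definition tensor_comp :: "'k::comm_ring_1 \<Rightarrow> 'k tens \<Rightarrow> 'k mor" where
  "tensor_comp \<delta> = lin_ext (\<lambda>(s, u, v). bcomp \<delta> u v)"

text \<open>A pairing, a bimodule map on the tensor product of \<open>Bminus\<close> and \<open>Bplus\<close>, is given as the
  corresponding balanced bilinear map.\<close>

definition pair_b :: "'k::comm_ring_1 \<Rightarrow> 'k mor \<Rightarrow> 'k mor \<Rightarrow> 'k mor" where
  "pair_b \<delta> = bilin_ext (\<lambda>g f. if level (hat_comp g f) then comp_diagrams \<delta> g f else 0)"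

definition b'_factor :: "diagram \<Rightarrow> diagram \<Rightarrow> diagram \<Rightarrow> bool" where
  "b'_factor u w \<sigma> \<longleftrightarrow>
    (\<exists>p q. w \<in> up_diagrams p q \<and> \<sigma> \<in> level_diagrams p p \<and> u = hat_comp \<sigma> (bar w))"

definition pair_b' :: "'k::comm_ring_1 mor \<Rightarrow> 'k mor \<Rightarrow> 'k mor" where
  "pair_b' = bilin_ext (\<lambda>u w. if \<exists>\<sigma>. b'_factor u w \<sigma> then basis (THE \<sigma>. b'_factor u w \<sigma>) else 0)"

text \<open>\<open>d p q\<close> is the component of \<open>d\<close> on \<open>S(p, q)\<close>, with values in representatives of tensors.
  Under the identifications of \<open>S \<otimes> Bplus\<close> and \<open>Bplus \<otimes> S\<close> with \<open>Bplus\<close>, the composite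
  \<open>(id \<otimes> b) (d \<otimes> id)\<close> sends \<open>f : p \<rightarrow> q\<close> to the sum of all \<open>u b(v \<otimes> f)\<close>, where \<open>d(1\<^sub>q)\<close> is the sum
  of the \<open>u \<otimes> v\<close>; similarly for \<open>(b \<otimes> id) (id \<otimes> d)\<close>.\<close>

locale copairing =
  fixes \<delta> :: "'k::comm_ring_1" and d :: "nat \<Rightarrow> nat \<Rightarrow> 'k mor \<Rightarrow> 'k tens"
  assumes d_closed: "x \<in> S_hom p q \<Longrightarrow> d p q x \<in> tensors Bplus Bminus p q"
    and d_add: "x \<in> S_hom p q \<Longrightarrow> y \<in> S_hom p q \<Longrightarrow>
      tensor_eq \<delta> Bplus Bminus p q (d p q (x + y)) (d p q x + d p q y)"
    and d_smul: "x \<in> S_hom p q \<Longrightarrow>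
      tensor_eq \<delta> Bplus Bminus p q (d p q (smul c x)) (smul c (d p q x))"
    and d_left: "x \<in> S_hom p q \<Longrightarrow> y \<in> S_hom q r \<Longrightarrow>
      tensor_eq \<delta> Bplus Bminus p r (d p r (bcomp \<delta> y x)) (act_left \<delta> y (d p q x))"
    and d_right: "x \<in> S_hom p q \<Longrightarrow> y \<in> S_hom r p \<Longrightarrow>
      tensor_eq \<delta> Bplus Bminus r q (d r q (bcomp \<delta> x y)) (act_right \<delta> (d p q x) y)"
    and zigzag_plus: "f \<in> Bplus p q \<Longrightarrow>
      lin_ext (\<lambda>(s, u, v). bcomp \<delta> u (pair_b \<delta> v f)) (d q q (one q)) = f"
    and zigzag_minus: "g \<in> Bminus p q \<Longrightarrow>
      lin_ext (\<lambda>(s, u, v). bcomp \<delta> (pair_b \<delta> g u) v) (d p p (one p)) = g"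

definition d'_one :: "nat \<Rightarrow> 'k::comm_ring_1 tens" where
  "d'_one p = (\<Sum>s\<in>{s. prec s p}. \<Sum>f\<in>mono_up_diagrams s p. basis (s, basis f, basis (bar f)))"

text \<open>The composition \<open>id \<otimes> \<beta> \<otimes> id\<close> for a pairing \<open>\<beta>\<close>, a diagram \<open>f\<close> corresponding to the tensor
  \<open>f\<^sup>+ f\<^sup>0 \<otimes> f\<^sup>- = f\<^sup>+ \<otimes> f\<^sup>0 f\<^sup>-\<close>.\<close>

definition pairing_comp ::
  "'k::comm_ring_1 \<Rightarrow> ('k mor \<Rightarrow> 'k mor \<Rightarrow> 'k mor) \<Rightarrow> 'k mor \<Rightarrow> 'k mor \<Rightarrow> 'k mor" where
  "pairing_comp \<delta> \<beta> = bilin_ext (\<lambda>f g.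
     bcomp \<delta>
       (bcomp \<delta> (bcomp \<delta> (basis (plus_part f)) (basis (zero_part f)))
          (\<beta> (basis (minus_part f)) (basis (plus_part g))))
       (bcomp \<delta> (basis (zero_part g)) (basis (minus_part g))))"

definition pBrauer ::
  "'k::comm_ring_1 \<Rightarrow> (nat \<Rightarrow> nat \<Rightarrow> 'k mor \<Rightarrow> 'k tens) \<Rightarrow> (nat, 'k mor) lin_cat" where
  "pBrauer \<delta> d = \<lparr>Hom = B_hom, Comp = pairing_comp \<delta> (pair_b \<delta>),
     Ident = (\<lambda>p. tensor_comp \<delta> (d p p (one p)))\<rparr>"

definition mBrauer :: "'k::comm_ring_1 \<Rightarrow> (nat, 'k mor) lin_cat" where
  "mBrauer \<delta> = \<lparr>Hom = B_hom, Comp = pairing_comp \<delta> pair_b',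
     Ident = (\<lambda>p. tensor_comp \<delta> (d'_one p))\<rparr>"

definition qcomp :: "'k::comm_ring_1 mor \<Rightarrow> 'k mor \<Rightarrow> 'k mor" where
  "qcomp = bilin_ext (\<lambda>f g.
     if \<exists>i j k. i \<noteq> j \<and> j \<noteq> k \<and> i \<noteq> k \<and> {Bot i, Bot j} \<in> g \<and> {Top j, Top k} \<in> f then 0
     else basis (hat_comp f g))"

definition qBrauer :: "(nat, 'k::comm_ring_1 mor) lin_cat" where
  "qBrauer = \<lparr>Hom = B_hom, Comp = qcomp, Ident = one\<rparr>"

text \<open>\<open>(\<mu>\<^sup>+ \<otimes> \<mu>\<^sup>-) (id \<otimes> d \<otimes> id)\<close>, where \<open>D s\<close> represents \<open>d(1\<^sub>s)\<close>;
  the compositions \<open>\<mu>\<^sup>+\<close>, \<open>\<mu>\<^sup>-\<close> of upward and downward diagrams produce no loops.\<close>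

definition F_functor ::
  "'k::comm_ring_1 \<Rightarrow> (nat \<Rightarrow> 'k tens) \<Rightarrow> nat \<Rightarrow> nat \<Rightarrow> 'k mor \<Rightarrow> 'k mor" where
  "F_functor \<delta> D p q = lin_ext (\<lambda>f. tensor_comp \<delta> (lin_ext (\<lambda>(t, u, v).
       basis (t, bcomp \<delta> (basis (plus_part f)) u,
                 bcomp \<delta> v (bcomp \<delta> (basis (zero_part f)) (basis (minus_part f)))))
     (D (through f))))"

definition F_d ::
  "'k::comm_ring_1 \<Rightarrow> (nat \<Rightarrow> nat \<Rightarrow> 'k mor \<Rightarrow> 'k tens) \<Rightarrow> nat \<Rightarrow> nat \<Rightarrow> 'k mor \<Rightarrow> 'k mor" where
  "F_d \<delta> d = F_functor \<delta> (\<lambda>s. d s s (one s))"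

definition F_d' :: "'k::comm_ring_1 \<Rightarrow> nat \<Rightarrow> nat \<Rightarrow> 'k mor \<Rightarrow> 'k mor" where
  "F_d' \<delta> = F_functor \<delta> d'_one"

definition K_plus :: "'k::comm_ring_1 \<Rightarrow> nat \<Rightarrow> nat \<Rightarrow> 'k mor \<Rightarrow> 'k mor" where
  "K_plus \<delta> p q w = lin_ext (\<lambda>(s, u, v). bcomp \<delta> u (pair_b \<delta> v w)) (d'_one q)"

definition K_functor :: "'k::comm_ring_1 \<Rightarrow> nat \<Rightarrow> nat \<Rightarrow> 'k mor \<Rightarrow> 'k mor" where
  "K_functor \<delta> p q = lin_ext (\<lambda>f.
     bcomp \<delta> (K_plus \<delta> (through f) q (basis (plus_part f)))
             (bcomp \<delta> (basis (zero_part f)) (basis (minus_part f))))"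

text \<open>Entry of the image under \<open>\<iota>\<close> of the matrix \<open>A\<^sub>p\<^sub>,\<^sub>q\<close> over \<open>\<int>[x]\<close>: the rows and columns are indexed
  by pairs of a monotone upward diagram and a permutation, and the coefficient of \<open>\<sigma>\<close> in
  \<open>b(bar f \<otimes> g) \<tau>\<close> is an entry of the matrix of left multiplication by \<open>b(bar f \<otimes> g)\<close>.\<close>

definition gram_entry :: "diagram \<times> diagram \<Rightarrow> diagram \<times> diagram \<Rightarrow> int poly" where
  "gram_entry = (\<lambda>(f, \<sigma>) (g, \<tau>). Poly_Mapping.lookup
     (bcomp [:0, 1:] (pair_b [:0, 1:] (basis (bar f)) (basis g)) (basis \<tau>)) \<sigma>)"

definition gram_index :: "nat \<Rightarrow> nat \<Rightarrow> (diagram \<times> diagram) set" where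
  "gram_index p q = mono_up_diagrams p q \<times> level_diagrams p p"

text \<open>The index set is enumerated by \<open>from_nat_into\<close>; the determinant does not depend on the enumeration.\<close>

definition gram_poly :: "nat \<Rightarrow> nat \<Rightarrow> int poly" where
  "gram_poly p q = (let I = gram_index p q; e = from_nat_into I; N = card I in
     Determinant.det (mat N N (\<lambda>(i, j). gram_entry (e i) (e j))))"

definition nonsingular :: "'k::comm_ring_1 \<Rightarrow> bool" where
  "nonsingular \<delta> \<longleftrightarrow>
    (\<forall>p q. prec p q \<longrightarrow> poly (map_poly of_int (gram_poly p q)) \<delta> dvd 1)"

end

theory Submission
  imports
    Defs
    "HOL-Library.Infinite_Set"
    "Jordan_Normal_Form.Char_Poly"
begin

text \<open>All four categories act on the right modules \<open>\<Oplus>\<^sub>s Bplus(s, p)\<close> over the level diagrams. For a pairing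
  \<open>\<beta>\<close> the tensor \<open>u \<otimes> c\<close> sends \<open>w\<close> to \<open>u \<beta>(c, w)\<close>, and this is multiplicative for the composition
  \<open>id \<otimes> \<beta> \<otimes> id\<close>; in \<open>B\<close> a diagram \<open>f\<close> sends \<open>w\<close> to the upward part of \<open>f \<circ> w\<close>. For \<open>b'\<close> the action is
  faithful, since \<open>x\<close> is the sum of all \<open>(x \<cdot> h) bar h\<close> over monotone upward \<open>h\<close>, so identities between
  morphisms may be checked on the action. The map \<open>K_plus\<close> satisfies \<open>b'(c, K_plus w) = b(c, w)\<close>, hence
  intertwines the actions of \<open>pB\<close> and \<open>mB\<close>, and in the basis of upward diagrams its matrix is the Gram
  matrix of \<open>b\<close>. So \<open>\<delta>\<close> is non-singular iff \<open>K_plus\<close> is invertible; then the sum of all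
  \<open>K_plus\<^sup>-\<^sup>1 h \<otimes> bar h\<close> is the copairing. Conversely \<open>K_functor\<close> commutes with the projection to upward
  diagrams, so its invertibility forces that of \<open>K_plus\<close>. The functors \<open>F_d\<close> and \<open>F_d'\<close> are unitriangular
  for the number of through strands.\<close>

section \<open>Components of stacked diagrams\<close>

text \<open>An element of a tensor product over the permutations has no canonical representative,
  and arguing with representatives would mean tracking permutations everywhere. The pair
  \<open>plus_part f\<close>, \<open>rest_part f\<close> supplies a normal form, and
  \<open>balanced_ext\<close> shows once and for all that a balanced map may be computed on any
  factorisation \<open>u\<close>, \<open>c\<close> of a diagram. Only the laws of
  \<open>mBrauer\<close> are verified directly; those of the other three categories are pulled back
  along bijections compatible with composition (\<open>B_hom_category_iso\<close>).

  The vanishing rule of \<open>qcomp\<close> originates in the action of \<open>F_d'\<close>: the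
  image of \<open>f\<close> kills \<open>w\<close> unless every pair of top points of
  \<open>f\<close> is also a pair of bottom points of \<open>w\<close>, and otherwise it sends
  \<open>w\<close> to \<open>hat_comp f w\<close>. Comparing this condition for \<open>f\<close>,
  \<open>g\<close> and their composite leads to the forbidden configuration, a middle point with two
  different partners.

  Everything rests on stacking being associative with a loop count that is a cocycle. This concerns
  connected components only: part of a stack may be replaced by its composite because the rest meets
  it in boundary points.\<close>

definition edge_rel :: "'a set set \<Rightarrow> ('a \<times> 'a) set" where
  "edge_rel E = {(x, y). {x, y} \<in> E}"

lemma connected_in_eq: "connected_in E = (edge_rel E)\<^sup>*"
  by (simp add: connected_in_def edge_rel_def)

lemma sym_edge_rel: "sym (edge_rel E)"
  by (auto simp: sym_def edge_rel_def insert_commute)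

lemma edge_rel_Un: "edge_rel (A \<union> B) = edge_rel A \<union> edge_rel B"
  by (auto simp: edge_rel_def)

lemma edge_rel_Field: "(x, y) \<in> edge_rel E \<Longrightarrow> x \<in> \<Union>E \<and> y \<in> \<Union>E"
  by (auto simp: edge_rel_def)

lemma sym_edge_conn: "(x, y) \<in> (edge_rel E)\<^sup>* \<Longrightarrow> (y, x) \<in> (edge_rel E)\<^sup>*"
  by (meson sym_edge_rel sym_rtrancl symD)

lemma edge_rel_image:
  assumes "inj m"
  shows "edge_rel ((`) m ` E) = {(m x, m y) | x y. (x, y) \<in> edge_rel E}"
proof -
  have "\<exists>x y. a = m x \<and> b = m y \<and> {x, y} \<in> E" if "{a, b} \<in> (`) m ` E" for a b
  proof -
  from that
  obtain e where e: "e \<in> E" "{a, b} = m ` e" by auto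
  then obtain x y where xy: "a = m x" "b = m y" "x \<in> e" "y \<in> e" by (metis imageE insertI1 insertI2)
  then have "m ` e = m ` {x, y}" using e by simp
  then have "e = {x, y}" using assms by (metis inj_image_eq_iff)
  then show ?thesis using e xy by blast
  qed
  moreover have "{m x, m y} \<in> (`) m ` E" if "{x, y} \<in> E" for x y
    using that by (metis image_eqI image_empty image_insert)
  ultimately show ?thesis by (auto simp: edge_rel_def)
qed

text \<open>A path in the image relation that starts at a value of \<open>m\<close> never leaves the
  values, and injectivity makes the preimages at consecutive steps agree, so the path lifts.\<close>

lemma rtrancl_image:
  assumes "inj m"
  shows "(m x, m y) \<in> {(m x, m y) | x y. (x, y) \<in> R}\<^sup>* \<longleftrightarrow> (x, y) \<in> R\<^sup>*"
proof
  assume "(m x, m y) \<in> {(m x, m y) | x y. (x, y) \<in> R}\<^sup>*"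
  then have "\<exists>z. m y = m z \<and> (x, z) \<in> R\<^sup>*"
  proof (induction rule: rtrancl_induct)
    case (step u v)
    then show ?case using assms by (smt (verit) CollectD Pair_inject case_prodD injD rtrancl.rtrancl_into_rtrancl)
  qed auto
  then show "(x, y) \<in> R\<^sup>*" using assms by (auto dest: injD)
next
  assume "(x, y) \<in> R\<^sup>*"
  then show "(m x, m y) \<in> {(m x, m y) | x y. (x, y) \<in> R}\<^sup>*"
    by (induction rule: rtrancl_induct) (auto intro: rtrancl_into_rtrancl)
qed

lemma edge_conn_image:
  "inj m \<Longrightarrow> (m x, m y) \<in> (edge_rel ((`) m ` E))\<^sup>* \<longleftrightarrow> (x, y) \<in> (edge_rel E)\<^sup>*"
  by (simp add: edge_rel_image rtrancl_image)

text \<open>The vertex set is not recorded but recovered as the union of the blocks, so that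
  deleting an edge again leaves a matching.\<close>

definition matching :: "'a set set \<Rightarrow> bool" where
  "matching E \<longleftrightarrow> disjoint E \<and> (\<forall>e\<in>E. card e = 2)"

lemma matching_irrefl: "matching E \<Longrightarrow> {x, y} \<in> E \<Longrightarrow> x \<noteq> y"
  by (auto simp: matching_def)

lemma matching_unique: "matching E \<Longrightarrow> {x, y} \<in> E \<Longrightarrow> {x, z} \<in> E \<Longrightarrow> y = z"
  unfolding matching_def disjoint_def
  by (metis disjoint_iff doubleton_eq_iff insertI1)

lemma matchingI:
  assumes "\<And>e. e \<in> E \<Longrightarrow> \<exists>x y. e = {x, y} \<and> x \<noteq> y"
    and "\<And>x y z. {x, y} \<in> E \<Longrightarrow> {x, z} \<in> E \<Longrightarrow> y = z"
  shows "matching E"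
  unfolding matching_def disjoint_def
proof (intro conjI ballI impI)
  fix a b assume ab: "a \<in> E" "b \<in> E" "a \<noteq> b"
  show "a \<inter> b = {}"
  proof (rule ccontr)
    assume "a \<inter> b \<noteq> {}"
    then obtain x where x: "x \<in> a" "x \<in> b" by auto
    then obtain y where "a = {x, y}" using assms(1)[OF ab(1)] by auto
    moreover obtain z where "b = {x, z}" using assms(1)[OF ab(2)] x by auto
    ultimately show False using assms(2) ab by blast
  qed
next
  fix e assume "e \<in> E" then show "card e = 2" using assms(1) by fastforce
qed

lemma matching_image:
  assumes "inj m" "matching E" shows "matching ((`) m ` E)"
  unfolding matching_def
proof
  show "\<forall>e\<in>(`) m ` E. card e = 2" using assms
    by (auto simp: matching_def card_image inj_on_subset)
  show "disjoint ((`) m ` E)"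
    unfolding disjoint_def
  proof (clarify)
    fix x y assume xy: "x \<in> E" "y \<in> E" "m ` x \<noteq> m ` y"
    then have "x \<inter> y = {}" using assms(2) unfolding matching_def disjoint_def by blast
    then show "m ` x \<inter> m ` y = {}" using image_Int[OF assms(1), of x y] by simp
  qed
qed

lemma matching_obtain:
  assumes "matching E" "x \<in> \<Union>E"
  obtains y where "{x, y} \<in> E" "x \<noteq> y"
proof -
  obtain e where e: "e \<in> E" "x \<in> e" using assms by auto
  then have "card e = 2" using assms by (simp add: matching_def)
  then obtain a b where "e = {a, b}" "a \<noteq> b" by (auto simp: card_2_iff)
  then show ?thesis using that e by (metis insertE insert_commute singletonD)
qed

text \<open>In the union of two matchings all degrees are at most two, so every component with an end is
  a path; the induction peels off the edge at the given end.\<close>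

lemma path_end:
  assumes "finite E1" "finite E2" "matching E1" "matching E2" "x \<in> \<Union>E1" "x \<notin> \<Union>E2"
  shows "\<exists>!z. z \<noteq> x \<and> (x, z) \<in> (edge_rel (E1 \<union> E2))\<^sup>* \<and> (z \<in> \<Union>E1) \<noteq> (z \<in> \<Union>E2)"
  using assms
proof (induction "card E1 + card E2" arbitrary: E1 E2 x rule: less_induct)
  case less
  obtain y where y: "{x, y} \<in> E1" "x \<noteq> y" using matching_obtain less.prems by metis
  define E1' where "E1' = E1 - {{x, y}}"
  have m': "matching E1'" using less.prems(3) by (auto simp: matching_def E1'_def disjoint_def)
  have U: "\<Union>E1' = \<Union>E1 - {x, y}"
  proof -
    have "e \<inter> {x, y} = {}" if "e \<in> E1'" for e
    proof -
      have "e \<in> E1" "e \<noteq> {x, y}" using that by (auto simp: E1'_def)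
      then show ?thesis using less.prems(3) y(1) unfolding matching_def disjoint_def by metis
    qed
    then have "\<Union>E1' \<inter> {x, y} = {}" by blast
    moreover have "\<Union>E1 = {x, y} \<union> \<Union>E1'" using y by (auto simp: E1'_def)
    ultimately show ?thesis by auto
  qed
  let ?R = "edge_rel (E1 \<union> E2)" and ?R' = "edge_rel (E1' \<union> E2)"
  have "x \<notin> \<Union>(E1' \<union> E2)" using U less.prems(6) by simp
  then have noR': "(x, w) \<notin> ?R'" "(w, x) \<notin> ?R'" for w
    using edge_rel_Field[of x w "E1' \<union> E2"] edge_rel_Field[of w x "E1' \<union> E2"] by metis+
  have nx: "(y, z) \<in> ?R'\<^sup>* \<Longrightarrow> z \<noteq> x" for z
    using y noR' by (metis rtranclE)
  \<comment> \<open>\<open>{x, y}\<close> is the only edge at \<open>x\<close>, so a path from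
    \<open>x\<close> is trivial or continues, after its last visit to \<open>x\<close>, from
    \<open>y\<close> through the remaining edges.\<close>
  have key: "(x, z) \<in> ?R\<^sup>* \<longleftrightarrow> z = x \<or> (y, z) \<in> ?R'\<^sup>*" for z
  proof
    assume "(x, z) \<in> ?R\<^sup>*"
    then show "z = x \<or> (y, z) \<in> ?R'\<^sup>*"
    proof (induction rule: rtrancl_induct)
      case (step u v)
      have "{u, v} = {x, y} \<or> (u, v) \<in> ?R'" using step(2) by (auto simp: edge_rel_def E1'_def)
      then show ?case
      proof
        assume "{u, v} = {x, y}" then show ?thesis by (auto simp: doubleton_eq_iff)
      next
        assume *: "(u, v) \<in> ?R'"
        then have "u \<noteq> x" using noR' by auto
        then show ?thesis using * step(3) by (auto intro: rtrancl_into_rtrancl)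
      qed
    qed simp
  next
    assume z: "z = x \<or> (y, z) \<in> ?R'\<^sup>*"
    have "?R' \<subseteq> ?R" by (auto simp: edge_rel_def E1'_def)
    then have "?R'\<^sup>* \<subseteq> ?R\<^sup>*" by (rule rtrancl_mono)
    moreover have "(x, y) \<in> ?R" using y by (simp add: edge_rel_def)
    ultimately show "(x, z) \<in> ?R\<^sup>*" using z by (auto intro: converse_rtrancl_into_rtrancl)
  qed
  have yE1: "y \<in> \<Union>E1" using y by auto
  show ?case
  proof (cases "y \<in> \<Union>E2")
    case False
    \<comment> \<open>Deleting the edge has isolated \<open>y\<close>, so the path ends
      there.\<close>
    have "y \<notin> \<Union>(E1' \<union> E2)" using U False by simp
    then have "(y, w) \<notin> ?R'" for w
      using edge_rel_Field[of y w "E1' \<union> E2"] by metis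
    then have "(y, z) \<in> ?R'\<^sup>* \<longleftrightarrow> z = y" for z by (metis converse_rtranclE rtrancl.rtrancl_refl)
    then show ?thesis using key y False yE1 by (intro ex1I[of _ y]) auto
  next
    case True
    \<comment> \<open>The two matchings exchange roles: once the edge is deleted, \<open>y\<close>
      is an end covered by \<open>E2\<close> only.\<close>
    have "\<exists>!z. z \<noteq> y \<and> (y, z) \<in> (edge_rel (E2 \<union> E1'))\<^sup>* \<and> (z \<in> \<Union>E2) \<noteq> (z \<in> \<Union>E1')"
    proof (rule less.hyps)
      show "card E2 + card E1' < card E1 + card E2"
        unfolding E1'_def using card_Diff1_less[OF less.prems(1) y(1)] by linarith
      show "finite E1'" using less.prems(1) by (simp add: E1'_def)
      show "y \<notin> \<Union>E1'" using U by simp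
    qed (use less.prems m' True in auto)
    moreover have "z \<noteq> y \<and> (y, z) \<in> (edge_rel (E2 \<union> E1'))\<^sup>* \<and> (z \<in> \<Union>E2) \<noteq> (z \<in> \<Union>E1') \<longleftrightarrow>
      z \<noteq> x \<and> (x, z) \<in> ?R\<^sup>* \<and> (z \<in> \<Union>E1) \<noteq> (z \<in> \<Union>E2)" for z
    proof -
      have "z = y \<Longrightarrow> z \<in> \<Union>E1 \<and> z \<in> \<Union>E2" using yE1 True by simp
      moreover have "z \<noteq> y \<Longrightarrow> z \<noteq> x \<Longrightarrow> z \<in> \<Union>E1' \<longleftrightarrow> z \<in> \<Union>E1" using U by simp
      ultimately show ?thesis using key[of z] nx[of z] by (metis sup_commute)
    qed
    ultimately show ?thesis by simp
  qed
qed

section \<open>Brauer diagrams as perfect matchings\<close>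

definition points :: "nat \<Rightarrow> nat \<Rightarrow> point set" where
  "points p q = Top ` {1..p} \<union> Bot ` {1..q}"

lemma points_simps [simp]:
  "Top i \<in> points p q \<longleftrightarrow> 1 \<le> i \<and> i \<le> p" "Bot i \<in> points p q \<longleftrightarrow> 1 \<le> i \<and> i \<le> q"
  by (auto simp: points_def)

lemma finite_points [simp]: "finite (points p q)"
  by (simp add: points_def)

lemma diagrams_iff: "f \<in> diagrams p q \<longleftrightarrow> matching f \<and> \<Union>f = points p q"
  unfolding diagrams_def partition_on_def matching_def points_def by force

lemma finite_diagrams [simp]: "finite (diagrams p q)"
proof (rule finite_subset)
  show "diagrams p q \<subseteq> Pow (Pow (points p q))" using diagrams_iff by blast
qed simp

lemma diagrams_finite: "f \<in> diagrams p q \<Longrightarrow> finite f"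
  by (metis diagrams_iff finite_UnionD finite_points)

text \<open>Both sides match the same points perfectly, so an additional pair in \<open>g\<close>
  would give one of its points a second partner. Equalities of diagrams can therefore be proved by a
  single inclusion.\<close>

lemma diagrams_subset_eq:
  assumes "f \<in> diagrams p q" "g \<in> diagrams p q" "f \<subseteq> g" shows "f = g"
proof
  show "g \<subseteq> f"
  proof
    fix e assume e: "e \<in> g"
    then have "card e = 2" using assms by (auto simp: diagrams_iff matching_def)
    then obtain x y where xy: "e = {x, y}" by (auto simp: card_2_iff)
    then have "x \<in> \<Union>f" using e assms(1,2) by (auto simp: diagrams_iff)
    then obtain z where "{x, z} \<in> f" using assms(1) by (metis diagrams_iff matching_obtain)
    then show "e \<in> f" using assms xy e by (metis diagrams_iff matching_unique subsetD)
  qed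
qed (fact assms(3))

lemma inj_place [simp]: "inj place_above" "inj place_below" "inj outer" "inj flip"
  by (auto simp: inj_def split: point.splits elim!: place_above.elims place_below.elims outer.elims flip.elims)

lemma stack_Union:
  assumes "f \<in> diagrams q r" "g \<in> diagrams p q"
  shows "\<Union>((`) place_above ` g) = Upper ` {1..p} \<union> Middle ` {1..q}"
    "\<Union>((`) place_below ` f) = Middle ` {1..q} \<union> Lower ` {1..r}"
proof -
  have "\<Union>((`) place_above ` g) = place_above ` \<Union>g" "\<Union>((`) place_below ` f) = place_below ` \<Union>f" by auto
  then show "\<Union>((`) place_above ` g) = Upper ` {1..p} \<union> Middle ` {1..q}"
    "\<Union>((`) place_below ` f) = Middle ` {1..q} \<union> Lower ` {1..r}"
    using assms by (simp_all add: diagrams_iff points_def image_Un image_image)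
qed

lemma outer_mem:
  assumes "f \<in> diagrams q r" "g \<in> diagrams p q"
  shows "outer x \<in> \<Union>(stack f g) \<longleftrightarrow> x \<in> points p r"
  using stack_Union[OF assms] by (cases x) (auto simp: stack_def)

lemma hat_comp_iff:
  assumes "f \<in> diagrams q r" "g \<in> diagrams p q"
  shows "{x, y} \<in> hat_comp f g \<longleftrightarrow>
    x \<noteq> y \<and> x \<in> points p r \<and> y \<in> points p r \<and> (outer x, outer y) \<in> (edge_rel (stack f g))\<^sup>*"
  using outer_mem[OF assms] unfolding hat_comp_def connected_in_eq
  by (auto simp: doubleton_eq_iff sym_edge_conn)

text \<open>An outer point is covered by only one of the two matchings, so it is an end of a path,
  and the other end is the only other outer point of its component. This is what makes
  \<open>hat_comp\<close> a diagram.\<close>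

lemma outer_connected_unique:
  assumes "f \<in> diagrams q r" "g \<in> diagrams p q" "x \<in> points p r"
  shows "\<exists>!y. y \<noteq> x \<and> y \<in> points p r \<and> (outer x, outer y) \<in> (edge_rel (stack f g))\<^sup>*"
proof -
  let ?E1 = "(`) place_above ` g" and ?E2 = "(`) place_below ` f"
  have m: "matching ?E1" "matching ?E2" using assms by (auto intro!: matching_image simp: diagrams_iff)
  have fin: "finite ?E1" "finite ?E2" using assms by (auto dest: diagrams_finite)
  note U = stack_Union[OF assms(1,2)]
  have "\<exists>!z. z \<noteq> outer x \<and> (outer x, z) \<in> (edge_rel (stack f g))\<^sup>* \<and> (z \<in> \<Union>?E1) \<noteq> (z \<in> \<Union>?E2)"
  proof (cases x)
    case (Top i)
    then have "outer x \<in> \<Union>?E1" "outer x \<notin> \<Union>?E2" unfolding U using assms(3) by auto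
    from path_end[OF fin m this] show ?thesis by (simp add: stack_def)
  next
    case (Bot i)
    then have "outer x \<in> \<Union>?E2" "outer x \<notin> \<Union>?E1" unfolding U using assms(3) by auto
    from path_end[OF fin(2,1) m(2,1) this] show ?thesis by (simp add: stack_def Un_commute conj_commute eq_commute)
  qed
  \<comment> \<open>Middle points are covered by both matchings, so the points covered exactly once
    are the outer ones.\<close>
  moreover have "(z \<in> \<Union>?E1) \<noteq> (z \<in> \<Union>?E2) \<longleftrightarrow> (\<exists>y\<in>points p r. z = outer y)" for z
    unfolding U points_def bex_Un ball_simps bex_simps by (cases z) auto
  ultimately have *: "\<exists>!z. z \<noteq> outer x \<and> (outer x, z) \<in> (edge_rel (stack f g))\<^sup>* \<and> (\<exists>y\<in>points p r. z = outer y)"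
    by simp
  then obtain y where y: "y \<in> points p r" "outer y \<noteq> outer x" "(outer x, outer y) \<in> (edge_rel (stack f g))\<^sup>*" by blast
  show ?thesis
  proof (rule ex1I[of _ y])
    fix y' assume "y' \<noteq> x \<and> y' \<in> points p r \<and> (outer x, outer y') \<in> (edge_rel (stack f g))\<^sup>*"
    then have "outer y' = outer y" using * y inj_place(3) by (metis injD)
    then show "y' = y" using inj_place(3) by (metis injD)
  qed (use y in auto)
qed

lemma hat_comp_closed [intro]:
  assumes "f \<in> diagrams q r" "g \<in> diagrams p q"
  shows "hat_comp f g \<in> diagrams p r"
proof -
  note i = hat_comp_iff[OF assms]
  have "matching (hat_comp f g)"
  proof (rule matchingI)
    fix e assume "e \<in> hat_comp f g" then show "\<exists>x y. e = {x, y} \<and> x \<noteq> y" by (auto simp: hat_comp_def)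
  next
    fix x y z assume "{x, y} \<in> hat_comp f g" "{x, z} \<in> hat_comp f g"
    then show "y = z" unfolding i using outer_connected_unique[OF assms] by metis
  qed
  moreover have "\<Union>(hat_comp f g) = points p r"
  proof (intro subset_antisym subsetI)
    fix x assume "x \<in> \<Union>(hat_comp f g)"
    then show "x \<in> points p r" using outer_mem[OF assms] by (auto simp: hat_comp_def)
  next
    fix x assume x: "x \<in> points p r"
    then obtain y where "{x, y} \<in> hat_comp f g" unfolding i using outer_connected_unique[OF assms x] by metis
    then show "x \<in> \<Union>(hat_comp f g)" by blast
  qed
  ultimately show ?thesis by (simp add: diagrams_iff)
qed

lemma partner_exists:
  assumes "f \<in> diagrams p q" "x \<in> points p q" obtains y where "{x, y} \<in> f" "x \<noteq> y" "y \<in> points p q"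
proof -
  obtain y where "{x, y} \<in> f" "x \<noteq> y" using assms by (metis diagrams_iff matching_obtain)
  then show ?thesis using that assms by (auto simp: diagrams_iff)
qed

lemma partner_unique: "f \<in> diagrams p q \<Longrightarrow> {x, y} \<in> f \<Longrightarrow> {x, z} \<in> f \<Longrightarrow> y = z"
  by (meson diagrams_iff matching_unique)

lemma edge_points: "f \<in> diagrams p q \<Longrightarrow> {x, y} \<in> f \<Longrightarrow> x \<in> points p q \<and> y \<in> points p q \<and> x \<noteq> y"
  by (auto simp: diagrams_iff dest: matching_irrefl)

lemma diagram_subsetI:
  assumes "f \<in> diagrams p q"
    and "\<And>i j. {Top i, Top j} \<in> f \<Longrightarrow> {Top i, Top j} \<in> g"
    and "\<And>i j. {Top i, Bot j} \<in> f \<Longrightarrow> {Top i, Bot j} \<in> g"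
    and "\<And>i j. {Bot i, Bot j} \<in> f \<Longrightarrow> {Bot i, Bot j} \<in> g"
  shows "f \<subseteq> g"
proof
  fix e assume e: "e \<in> f"
  then have "card e = 2" using assms by (auto simp: diagrams_iff matching_def)
  then obtain x y where "e = {x, y}" by (auto simp: card_2_iff)
  then show "e \<in> g" using e assms(2-) by (cases x; cases y) (auto simp: insert_commute)
qed

lemma stack_above: "{x, y} \<in> g \<Longrightarrow> (place_above x, place_above y) \<in> edge_rel (stack f g)"
  by (auto simp: edge_rel_def stack_def intro!: image_eqI[of _ _ "{x, y}"])

lemma stack_below: "{x, y} \<in> f \<Longrightarrow> (place_below x, place_below y) \<in> edge_rel (stack f g)"
  by (auto simp: edge_rel_def stack_def intro!: image_eqI[of _ _ "{x, y}"])

lemma edge_bounds: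
  assumes "f \<in> diagrams p q"
  shows "{Top i, x} \<in> f \<Longrightarrow> 1 \<le> i \<and> i \<le> p" "{x, Top i} \<in> f \<Longrightarrow> 1 \<le> i \<and> i \<le> p"
    "{Bot i, x} \<in> f \<Longrightarrow> 1 \<le> i \<and> i \<le> q" "{x, Bot i} \<in> f \<Longrightarrow> 1 \<le> i \<and> i \<le> q"
  using edge_points[OF assms] points_simps by blast+

section \<open>Pairs of a composite that come from short paths in the stack\<close>

context
  fixes f g p q r
  assumes fg: "f \<in> diagrams q r" "g \<in> diagrams p q"
begin

lemma hat_compI:
  "x \<noteq> y \<Longrightarrow> x \<in> points p r \<Longrightarrow> y \<in> points p r \<Longrightarrow>
    (outer x, outer y) \<in> (edge_rel (stack f g))\<^sup>* \<Longrightarrow> {x, y} \<in> hat_comp f g"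
  by (simp add: hat_comp_iff[OF fg])

lemma hat_comp_top: "{Top i, Top j} \<in> g \<Longrightarrow> {Top i, Top j} \<in> hat_comp f g"
  using stack_above[of "Top i" "Top j" g f] edge_points[OF fg(2), of "Top i" "Top j"]
  by (intro hat_compI) auto

lemma hat_comp_bot: "{Bot i, Bot j} \<in> f \<Longrightarrow> {Bot i, Bot j} \<in> hat_comp f g"
  using stack_below[of "Bot i" "Bot j" f g] edge_points[OF fg(1), of "Bot i" "Bot j"]
  by (intro hat_compI) auto

lemma hat_comp_strand:
  assumes "{Top i, Bot j} \<in> g" "{Top j, Bot k} \<in> f"
  shows "{Top i, Bot k} \<in> hat_comp f g"
proof (rule hat_compI)
  show "(outer (Top i), outer (Bot k)) \<in> (edge_rel (stack f g))\<^sup>*"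
    using stack_above[OF assms(1), of f] stack_below[OF assms(2), of g] by simp
qed (use edge_bounds(1)[OF fg(2) assms(1)] edge_bounds(4)[OF fg(1) assms(2)] in auto)

lemma hat_comp_cap:
  assumes "{Top i, Bot j} \<in> g" "{Top j, Top k} \<in> f" "{Top l, Bot k} \<in> g"
  shows "{Top i, Top l} \<in> hat_comp f g"
proof (rule hat_compI)
  \<comment> \<open>With a common upper end the two strands of \<open>g\<close> would coincide, and
    then \<open>j = k\<close>.\<close>
  show "Top i \<noteq> Top l"
    using assms edge_points[OF fg(1) assms(2)] partner_unique[OF fg(2), of "Top i"] by blast
  have "{Bot k, Top l} \<in> g" using assms(3) by (simp add: insert_commute)
  then show "(outer (Top i), outer (Top l)) \<in> (edge_rel (stack f g))\<^sup>*"
    using stack_above[OF assms(1), of f] stack_below[OF assms(2), of g] stack_above[of "Bot k" "Top l" g f]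
    by (auto intro: rtrancl_into_rtrancl)
qed (use edge_bounds(1)[OF fg(2) assms(1)] edge_bounds(1)[OF fg(2) assms(3)] in auto)

lemma hat_comp_cup:
  assumes "{Top j, Bot i} \<in> f" "{Bot j, Bot k} \<in> g" "{Top k, Bot l} \<in> f"
  shows "{Bot i, Bot l} \<in> hat_comp f g"
proof (rule hat_compI)
  have ij: "{Bot i, Top j} \<in> f" and kl: "{Bot l, Top k} \<in> f" using assms by (simp_all add: insert_commute)
  show "Bot i \<noteq> Bot l"
    using ij kl edge_points[OF fg(2) assms(2)] partner_unique[OF fg(1), of "Bot i"] by blast
  show "(outer (Bot i), outer (Bot l)) \<in> (edge_rel (stack f g))\<^sup>*"
    using stack_below[OF ij, of g] stack_above[OF assms(2), of f] stack_below[OF assms(3), of g]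
    by (auto intro: rtrancl_into_rtrancl)
qed (use edge_bounds(4)[OF fg(1) assms(1)] edge_bounds(4)[OF fg(1) assms(3)] in auto)

end

section \<open>Associativity of stacking and the loop cocycle\<close>

lemma diagram_eqI:
  assumes "f \<in> diagrams p q" "g \<in> diagrams p q" "\<And>x y. {x, y} \<in> f \<Longrightarrow> {x, y} \<in> g"
  shows "f = g"
proof (rule diagrams_subset_eq[OF assms(1,2)])
  show "f \<subseteq> g"
    by (rule diagram_subsetI[OF assms(1)]) (use assms(3) in auto)
qed

lemma flip_flip [simp]: "flip (flip x) = x"
  by (cases x) auto

lemma flip_points: "flip x \<in> points p q \<longleftrightarrow> x \<in> points q p"
  by (cases x) auto

lemma bar_iff: "{x, y} \<in> bar f \<longleftrightarrow> {flip x, flip y} \<in> f"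
proof
  assume "{x, y} \<in> bar f"
  then obtain e where e: "e \<in> f" "{x, y} = flip ` e" by (auto simp: bar_def)
  have "{flip x, flip y} = flip ` {x, y}" by simp
  also have "\<dots> = e" by (simp add: e(2) image_image)
  finally show "{flip x, flip y} \<in> f" using e by simp
next
  assume "{flip x, flip y} \<in> f"
  then show "{x, y} \<in> bar f" unfolding bar_def by (intro image_eqI[of _ _ "{flip x, flip y}"]) auto
qed

lemma bar_bar [simp]: "bar (bar f) = f"
  by (simp add: bar_def image_image)

lemma bar_closed [intro]: assumes "f \<in> diagrams p q" shows "bar f \<in> diagrams q p"
proof -
  have "matching (bar f)" unfolding bar_def using assms by (auto intro!: matching_image simp: diagrams_iff)
  moreover have "\<Union>(bar f) = flip ` \<Union>f" by (auto simp: bar_def)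
  moreover have "flip ` points p q = points q p" by (simp add: points_def image_Un image_image Un_commute)
  ultimately show ?thesis using assms by (simp add: diagrams_iff)
qed

fun mirror :: "stack_point \<Rightarrow> stack_point" where
  "mirror (Upper i) = Lower i"
| "mirror (Middle i) = Middle i"
| "mirror (Lower i) = Upper i"

lemma inj_mirror: "inj mirror"
  by (auto simp: inj_def elim!: mirror.elims)

lemma stack_bar: "stack (bar g) (bar f) = (`) mirror ` stack f g"
proof -
  have 1: "place_above (flip x) = mirror (place_below x)" for x by (cases x) auto
  have 2: "place_below (flip x) = mirror (place_above x)" for x by (cases x) auto
  show ?thesis
    unfolding stack_def bar_def by (simp add: image_Un image_image 1 2 Un_commute)
qed

text \<open>Reflecting the stack in its middle layer exchanges the two diagrams and preserves
  connectedness. Statements on downward diagrams are reduced to upward ones through this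
  identity.\<close>

lemma hat_comp_bar:
  assumes "f \<in> diagrams q r" "g \<in> diagrams p q"
  shows "bar (hat_comp f g) = hat_comp (bar g) (bar f)"
proof (rule diagram_eqI)
  show "bar (hat_comp f g) \<in> diagrams r p" "hat_comp (bar g) (bar f) \<in> diagrams r p" using assms by blast+
  fix x y assume "{x, y} \<in> bar (hat_comp f g)"
  then have xy: "flip x \<noteq> flip y" "flip x \<in> points p r" "flip y \<in> points p r"
    "(outer (flip x), outer (flip y)) \<in> (edge_rel (stack f g))\<^sup>*"
    unfolding bar_iff hat_comp_iff[OF assms] by auto
  have o: "mirror (outer (flip z)) = outer z" for z by (cases z) auto
  have "(outer x, outer y) \<in> (edge_rel (stack (bar g) (bar f)))\<^sup>*"
    using xy(4) edge_conn_image[OF inj_mirror, of "outer (flip x)" "outer (flip y)" "stack f g"]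
    by (simp only: stack_bar o)
  then show "{x, y} \<in> hat_comp (bar g) (bar f)"
    using xy by (subst hat_comp_iff[OF bar_closed[OF assms(2)] bar_closed[OF assms(1)]]) (auto simp: flip_points)
qed

section \<open>Contraction of a part of a graph\<close>

lemma rtrancl_Field: "(x, y) \<in> R\<^sup>* \<Longrightarrow> x = y \<or> x \<in> Field R \<and> y \<in> Field R"
  by (metis FieldI1 FieldI2 converse_rtranclE rtranclE)

text \<open>\<open>R1\<close> lives on \<open>W\<close> and meets the remaining edges
  \<open>R2\<close> only in the boundary \<open>Bd\<close>. For a walker outside the interior
  \<open>W - Bd\<close> only the connections that \<open>R1\<close> makes between boundary points
  matter, so \<open>R1\<close> can be traded for \<open>S\<close>. Later \<open>R1\<close> is a
  stack of two diagrams and \<open>S\<close> their composite.\<close>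

lemma contract_conn:
  assumes "Field R1 \<subseteq> W" "W \<inter> Field R2 \<subseteq> Bd" "Field S \<subseteq> Bd"
    and eq: "\<And>x y. x \<in> Bd \<Longrightarrow> y \<in> Bd \<Longrightarrow> (x, y) \<in> R1\<^sup>* \<longleftrightarrow> (x, y) \<in> S\<^sup>*"
    and x: "x \<notin> W - Bd" and y: "y \<notin> W - Bd"
  shows "(x, y) \<in> (R1 \<union> R2)\<^sup>* \<longleftrightarrow> (x, y) \<in> (S \<union> R2)\<^sup>*"
proof
  have *: "(z, u) \<in> (S \<union> R2)\<^sup>*" if "z \<notin> W - Bd" "u \<notin> W - Bd" "(z, u) \<in> R1\<^sup>*" for z u
  proof (cases "z = u")
    case False
    then have "z \<in> Bd" "u \<in> Bd" using rtrancl_Field[OF that(3)] that assms(1) by auto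
    then have "(z, u) \<in> S\<^sup>*" using eq that by simp
    then show ?thesis using rtrancl_mono[of S "S \<union> R2"] by auto
  qed simp
  assume "(x, y) \<in> (R1 \<union> R2)\<^sup>*"
  \<comment> \<open>The path is cut at a point \<open>z\<close> outside the interior: the piece
    before \<open>z\<close> is already translated, the piece after it runs inside
    \<open>R1\<close>.\<close>
  then have "\<exists>z. z \<notin> W - Bd \<and> (x, z) \<in> (S \<union> R2)\<^sup>* \<and> (z, y) \<in> R1\<^sup>*"
  proof (induction rule: rtrancl_induct)
    case base show ?case using x by blast
  next
    case (step u v)
    then obtain z where z: "z \<notin> W - Bd" "(x, z) \<in> (S \<union> R2)\<^sup>*" "(z, u) \<in> R1\<^sup>*" by blast
    show ?case
    proof (cases "(u, v) \<in> R1")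
      case True then show ?thesis using z by (meson rtrancl_into_rtrancl)
    next
      case False
      then have uv: "(u, v) \<in> R2" using step by auto
      then have "u \<in> Field R2" "v \<in> Field R2" by (auto simp: Field_def)
      then have "u \<notin> W - Bd" and v: "v \<notin> W - Bd" using assms(2) by auto
      then have "(z, u) \<in> (S \<union> R2)\<^sup>*" using * z by blast
      then have "(x, v) \<in> (S \<union> R2)\<^sup>*" using z uv by (meson UnI2 rtrancl.rtrancl_into_rtrancl rtrancl_trans)
      then show ?thesis using v by blast
    qed
  qed
  then show "(x, y) \<in> (S \<union> R2)\<^sup>*" using * y by (meson rtrancl_trans)
next
  have "(u, v) \<in> R1\<^sup>*" if "(u, v) \<in> S" for u v
    using that assms(3) eq[of u v] by (auto simp: Field_def)
  then have "S \<union> R2 \<subseteq> (R1 \<union> R2)\<^sup>*" using rtrancl_mono[of R1 "R1 \<union> R2"] by auto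
  then have "(S \<union> R2)\<^sup>* \<subseteq> (R1 \<union> R2)\<^sup>*" by (rule rtrancl_subset_rtrancl)
  then show "(x, y) \<in> (S \<union> R2)\<^sup>* \<Longrightarrow> (x, y) \<in> (R1 \<union> R2)\<^sup>*" by blast
qed

text \<open>For \<open>M\<close> a set of middle points these are the closed loops. Unlike in
  \<open>loops\<close>, points may carry any names and several middle layers may be treated at
  once.\<close>

definition comps :: "('a \<times> 'a) set \<Rightarrow> 'a set \<Rightarrow> 'a set set" where
  "comps R M = (\<lambda>x. R\<^sup>* `` {x}) ` {x \<in> M. R\<^sup>* `` {x} \<subseteq> M}"

lemma sym_class_eq:
  assumes "sym R" shows "R\<^sup>* `` {x} = R\<^sup>* `` {y} \<longleftrightarrow> (x, y) \<in> R\<^sup>*"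
proof -
  have s: "(a, b) \<in> R\<^sup>* \<Longrightarrow> (b, a) \<in> R\<^sup>*" for a b using assms sym_rtrancl symD by metis
  show ?thesis
  proof
    assume "R\<^sup>* `` {x} = R\<^sup>* `` {y}"
    then have "y \<in> R\<^sup>* `` {x}" by auto
    then show "(x, y) \<in> R\<^sup>*" by simp
  next
    assume "(x, y) \<in> R\<^sup>*"
    then show "R\<^sup>* `` {x} = R\<^sup>* `` {y}" using s by (auto intro: rtrancl_trans)
  qed
qed

text \<open>Both images are quotients of \<open>A\<close> by the same equivalence relation;
  \<open>H\<close> sends the class of a representative under \<open>F\<close> to its class under
  \<open>G\<close>.\<close>

lemma card_image_cong:
  assumes "\<And>x y. x \<in> A \<Longrightarrow> y \<in> A \<Longrightarrow> F x = F y \<longleftrightarrow> G x = G y"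
  shows "card (F ` A) = card (G ` A)"
proof -
  define H where "H = (\<lambda>c. G (SOME x. x \<in> A \<and> F x = c))"
  have H: "H (F x) = G x" if "x \<in> A" for x
  proof -
    have "(SOME y. y \<in> A \<and> F y = F x) \<in> A \<and> F (SOME y. y \<in> A \<and> F y = F x) = F x"
      by (rule someI[of "\<lambda>y. y \<in> A \<and> F y = F x" x]) (use that in simp)
    then have "G (SOME y. y \<in> A \<and> F y = F x) = G x" using assms that by blast
    then show ?thesis by (simp only: H_def)
  qed
  have "inj_on H (F ` A)" using assms by (auto simp: inj_on_def H)
  moreover have "H ` F ` A = G ` A" using H by (auto simp: image_image)
  ultimately show ?thesis by (metis card_image)
qed

text \<open>A component inside \<open>M1 \<union> M2\<close> either avoids \<open>M2\<close>, and
  then it is a component of \<open>R1\<close> alone, or it meets \<open>M2\<close>, and then it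
  survives the contraction as a component of \<open>S \<union> R2\<close>. The two kinds are counted
  separately.\<close>

lemma comps_contract:
  assumes W: "Field R1 \<subseteq> W" "W \<inter> Field R2 \<subseteq> Bd" "Field S \<subseteq> Bd"
    and eq: "\<And>x y. x \<in> Bd \<Longrightarrow> y \<in> Bd \<Longrightarrow> (x, y) \<in> R1\<^sup>* \<longleftrightarrow> (x, y) \<in> S\<^sup>*"
    and sym: "sym R1" "sym R2" "sym S"
    and M: "M1 \<subseteq> W - Bd" "M2 \<inter> W \<subseteq> Bd" "Field R1 - Bd \<subseteq> M1" "finite M1" "finite M2"
  shows "card (comps (R1 \<union> R2) (M1 \<union> M2)) = card (comps R1 M1) + card (comps (S \<union> R2) M2)"
proof -
  let ?R = "R1 \<union> R2" and ?Q = "S \<union> R2"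
  have symR: "sym ?R" and symQ: "sym ?Q" using sym by (auto intro: sym_Un)
  have M12: "M1 \<inter> M2 = {}" using M by auto
  define B where "B = {x \<in> M2. ?R\<^sup>* `` {x} \<subseteq> M1 \<union> M2}"
  have R1R: "R1\<^sup>* `` {x} \<subseteq> ?R\<^sup>* `` {x}" for x using rtrancl_mono[of R1 ?R] by auto
  \<comment> \<open>No edge of \<open>R2\<close> touches the interior, so a class of
    \<open>R1\<close> that stays in the interior is complete.\<close>
  have A: "?R\<^sup>* `` {x} = R1\<^sup>* `` {x}" if "x \<in> M1" "R1\<^sup>* `` {x} \<subseteq> M1" for x
  proof
    show "?R\<^sup>* `` {x} \<subseteq> R1\<^sup>* `` {x}"
    proof
      fix y assume "y \<in> ?R\<^sup>* `` {x}"
      then have "(x, y) \<in> ?R\<^sup>*" by simp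
      then show "y \<in> R1\<^sup>* `` {x}"
      proof (induction rule: rtrancl_induct)
        case (step u v)
        then have "u \<in> M1" using that by auto
        then have "u \<notin> Field R2" using W(2) M(1) by auto
        then have "(u, v) \<in> R1" using step by (auto simp: Field_def)
        then show ?case using step by (auto intro: rtrancl_into_rtrancl)
      qed simp
    qed
  qed (rule R1R)
  have "comps ?R (M1 \<union> M2) = comps R1 M1 \<union> (\<lambda>x. ?R\<^sup>* `` {x}) ` B"
  proof (intro subset_antisym subsetI)
    fix c assume "c \<in> comps ?R (M1 \<union> M2)"
    then obtain x where x: "x \<in> M1 \<union> M2" "c = ?R\<^sup>* `` {x}" "c \<subseteq> M1 \<union> M2" by (auto simp: comps_def)
    show "c \<in> comps R1 M1 \<union> (\<lambda>x. ?R\<^sup>* `` {x}) ` B"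
    proof (cases "c \<inter> M2 = {}")
      case True
      then have c: "c \<subseteq> M1" using x by auto
      moreover have "x \<in> c" using x by simp
      ultimately have "x \<in> M1" "R1\<^sup>* `` {x} \<subseteq> M1" using R1R[of x] x by auto
      then show ?thesis using A[of x] x by (auto simp: comps_def)
    next
      case False
      then obtain y where y: "y \<in> c" "y \<in> M2" by auto
      then have "c = ?R\<^sup>* `` {y}" using x sym_class_eq[OF symR, of x y] by simp
      then show ?thesis using y x by (auto simp: B_def)
    qed
  next
    fix c assume "c \<in> comps R1 M1 \<union> (\<lambda>x. ?R\<^sup>* `` {x}) ` B"
    then consider x where "x \<in> M1" "R1\<^sup>* `` {x} \<subseteq> M1" "c = R1\<^sup>* `` {x}" | x where "x \<in> B" "c = ?R\<^sup>* `` {x}"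
      by (auto simp: comps_def)
    then show "c \<in> comps ?R (M1 \<union> M2)"
    proof cases
      case 1
      then have "c = ?R\<^sup>* `` {x}" "c \<subseteq> M1 \<union> M2" using A[of x] by auto
      then show ?thesis using 1 unfolding comps_def by blast
    next
      case 2
      then show ?thesis unfolding comps_def B_def by blast
    qed
  qed
  moreover have "comps R1 M1 \<inter> (\<lambda>x. ?R\<^sup>* `` {x}) ` B = {}"
  proof (rule ccontr)
    assume "comps R1 M1 \<inter> (\<lambda>x. ?R\<^sup>* `` {x}) ` B \<noteq> {}"
    then obtain x where "x \<in> B" "?R\<^sup>* `` {x} \<in> comps R1 M1" by blast
    then have "x \<in> M2" "?R\<^sup>* `` {x} \<subseteq> M1" by (auto simp: B_def comps_def)
    moreover have "x \<in> ?R\<^sup>* `` {x}" by simp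
    ultimately show False using M12 by blast
  qed
  moreover have "finite (comps R1 M1)" "finite B" using M by (auto simp: comps_def B_def)
  ultimately have "card (comps ?R (M1 \<union> M2)) = card (comps R1 M1) + card ((\<lambda>x. ?R\<^sup>* `` {x}) ` B)"
    by (simp add: card_Un_disjoint)
  moreover have nW: "x \<notin> W - Bd" if "x \<in> M2" for x using that M by auto
  \<comment> \<open>The remaining classes are indexed by points of \<open>M2\<close>, which lie
    outside the interior, so contraction does not change which of them are connected; interior
    points met on the way belong to \<open>M1\<close>.\<close>
  note key = contract_conn[OF W eq]
  have "?R\<^sup>* `` {x} \<subseteq> M1 \<union> M2 \<longleftrightarrow> ?Q\<^sup>* `` {x} \<subseteq> M2" if x: "x \<in> M2" for x
  proof
    assume *: "?R\<^sup>* `` {x} \<subseteq> M1 \<union> M2"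
    show "?Q\<^sup>* `` {x} \<subseteq> M2"
    proof
      fix y assume "y \<in> ?Q\<^sup>* `` {x}"
      then have xy: "(x, y) \<in> ?Q\<^sup>*" by simp
      have "y \<notin> W - Bd" using rtrancl_Field[OF xy] nW[OF x] W by (auto simp: Field_Un)
      then have "(x, y) \<in> ?R\<^sup>*" using key nW[OF x] xy by blast
      then have "y \<in> M1 \<union> M2" using * by auto
      then show "y \<in> M2" using \<open>y \<notin> W - Bd\<close> M by auto
    qed
  next
    assume *: "?Q\<^sup>* `` {x} \<subseteq> M2"
    show "?R\<^sup>* `` {x} \<subseteq> M1 \<union> M2"
    proof
      fix y assume "y \<in> ?R\<^sup>* `` {x}"
      then have xy: "(x, y) \<in> ?R\<^sup>*" by simp
      show "y \<in> M1 \<union> M2"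
      proof (cases "y \<in> W - Bd")
        case True
        then have "y \<in> Field ?R" using rtrancl_Field[OF xy] nW[OF x] by auto
        then have "y \<in> Field R1" using True W by (auto simp: Field_Un)
        then show ?thesis using True M by auto
      next
        case False
        then have "(x, y) \<in> ?Q\<^sup>*" using key nW[OF x] xy by blast
        then show ?thesis using * by auto
      qed
    qed
  qed
  then have "comps ?Q M2 = (\<lambda>x. ?Q\<^sup>* `` {x}) ` B" unfolding comps_def B_def
    by (intro image_cong) auto
  moreover have "card ((\<lambda>x. ?R\<^sup>* `` {x}) ` B) = card ((\<lambda>x. ?Q\<^sup>* `` {x}) ` B)"
  proof (rule card_image_cong)
    fix x y assume "x \<in> B" "y \<in> B"
    then have "x \<notin> W - Bd" "y \<notin> W - Bd" using nW by (auto simp: B_def)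
    then show "?R\<^sup>* `` {x} = ?R\<^sup>* `` {y} \<longleftrightarrow> ?Q\<^sup>* `` {x} = ?Q\<^sup>* `` {y}"
      unfolding sym_class_eq[OF symR] sym_class_eq[OF symQ] using key by blast
  qed
  ultimately show ?thesis by simp
qed

lemma matching_rtrancl:
  assumes "matching E" shows "(x, y) \<in> (edge_rel E)\<^sup>* \<longleftrightarrow> x = y \<or> {x, y} \<in> E"
proof
  assume "(x, y) \<in> (edge_rel E)\<^sup>*"
  then show "x = y \<or> {x, y} \<in> E"
  proof (induction rule: rtrancl_induct)
    case (step u v)
    then have uv: "{u, v} \<in> E" by (simp add: edge_rel_def)
    show ?case
    proof (cases "x = u")
      case False
      then have "{u, x} \<in> E" using step by (simp add: insert_commute)
      then show ?thesis using matching_unique[OF assms uv] by simp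
    qed (use uv in simp)
  qed simp
qed (auto simp: edge_rel_def)

text \<open>Associativity compares paths in diagrams stacked three storeys high; the point of index \<open>i\<close>
  on layer \<open>a\<close> is the pair \<open>(a, i)\<close>.\<close>

fun layered :: "nat \<Rightarrow> nat \<Rightarrow> point \<Rightarrow> nat \<times> nat" where
  "layered a b (Top i) = (a, i)"
| "layered a b (Bot i) = (b, i)"

fun layered3 :: "nat \<Rightarrow> nat \<Rightarrow> nat \<Rightarrow> stack_point \<Rightarrow> nat \<times> nat" where
  "layered3 a b c (Upper i) = (a, i)"
| "layered3 a b c (Middle i) = (b, i)"
| "layered3 a b c (Lower i) = (c, i)"

definition layer_edges :: "nat \<Rightarrow> nat \<Rightarrow> diagram \<Rightarrow> (nat \<times> nat) set set" where
  "layer_edges a b f = (`) (layered a b) ` f"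

abbreviation layer_rel :: "nat \<Rightarrow> nat \<Rightarrow> diagram \<Rightarrow> ((nat \<times> nat) \<times> (nat \<times> nat)) set" where
  "layer_rel a b f \<equiv> edge_rel (layer_edges a b f)"

lemma inj_layered: "a \<noteq> b \<Longrightarrow> inj (layered a b)"
  by (auto simp: inj_def elim!: layered.elims)

lemma inj_layered3: "distinct [a, b, c] \<Longrightarrow> inj (layered3 a b c)"
  by (auto simp: inj_def elim!: layered3.elims)

lemma layered3_stack:
  "(`) (layered3 a b c) ` stack f g = layer_edges a b g \<union> layer_edges b c f"
proof -
  have "layered3 a b c (place_above x) = layered a b x" "layered3 a b c (place_below x) = layered b c x" for x
    by (cases x; simp)+
  then show ?thesis by (simp add: stack_def layer_edges_def image_Un image_image)
qed

lemma layered3_outer: "layered3 a b c (outer x) = layered a c x"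
  by (cases x) auto

lemma layer_conn_hat:
  assumes d: "distinct [a, b, c]" and fg: "f \<in> diagrams q r" "g \<in> diagrams p q"
    and xy: "x \<in> points p r" "y \<in> points p r"
  shows "(layered a c x, layered a c y) \<in> (layer_rel a b g \<union> layer_rel b c f)\<^sup>* \<longleftrightarrow>
    x = y \<or> {x, y} \<in> hat_comp f g"
proof -
  have "(layered a c x, layered a c y) \<in> (layer_rel a b g \<union> layer_rel b c f)\<^sup>* \<longleftrightarrow>
    (outer x, outer y) \<in> (edge_rel (stack f g))\<^sup>*"
    using edge_conn_image[OF inj_layered3[OF d], of "outer x" "outer y" "stack f g"]
    by (simp only: layered3_outer layered3_stack edge_rel_Un)
  then show ?thesis using hat_comp_iff[OF fg] xy by auto
qed

lemma layer_conn:
  assumes "a \<noteq> c" "h \<in> diagrams p r"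
  shows "(layered a c x, layered a c y) \<in> (layer_rel a c h)\<^sup>* \<longleftrightarrow> x = y \<or> {x, y} \<in> h"
  using edge_conn_image[OF inj_layered[OF assms(1)], of x y h] matching_rtrancl[of h x y] assms(2)
  by (simp add: layer_edges_def diagrams_iff)

lemma layered_points: "layered a b ` points p q = {a} \<times> {1..p} \<union> {b} \<times> {1..q}"
  by (auto simp: points_def image_Un image_image)

lemma layer_Field:
  assumes "f \<in> diagrams p q" shows "Field (layer_rel a b f) \<subseteq> {a} \<times> {1..p} \<union> {b} \<times> {1..q}"
proof -
  have "Field (layer_rel a b f) \<subseteq> \<Union>(layer_edges a b f)"
    using edge_rel_Field by (fastforce simp: Field_def)
  also have "\<dots> = layered a b ` points p q"
    using assms by (auto simp: layer_edges_def diagrams_iff)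
  finally show ?thesis by (simp add: layered_points)
qed

lemma comps_image:
  assumes "inj m"
  shows "comps (edge_rel ((`) m ` E)) (m ` M) = (`) m ` comps (edge_rel E) M"
proof -
  have *: "(edge_rel ((`) m ` E))\<^sup>* `` {m x} = m ` ((edge_rel E)\<^sup>* `` {x})" for x
  proof (intro subset_antisym subsetI)
    fix z assume "z \<in> (edge_rel ((`) m ` E))\<^sup>* `` {m x}"
    then have mz: "(m x, z) \<in> (edge_rel ((`) m ` E))\<^sup>*" by simp
    then have "z \<in> range m"
      by (induction rule: rtrancl_induct) (auto simp: edge_rel_image[OF assms])
    then show "z \<in> m ` ((edge_rel E)\<^sup>* `` {x})" using mz edge_conn_image[OF assms] by auto
  next
    fix z assume "z \<in> m ` ((edge_rel E)\<^sup>* `` {x})"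
    then show "z \<in> (edge_rel ((`) m ` E))\<^sup>* `` {m x}" using edge_conn_image[OF assms] by auto
  qed
  have "{z \<in> m ` M. (edge_rel ((`) m ` E))\<^sup>* `` {z} \<subseteq> m ` M} = m ` {x \<in> M. (edge_rel E)\<^sup>* `` {x} \<subseteq> M}"
  proof -
    have "(edge_rel ((`) m ` E))\<^sup>* `` {m x} \<subseteq> m ` M \<longleftrightarrow> (edge_rel E)\<^sup>* `` {x} \<subseteq> M" for x
      unfolding * by (rule inj_image_subset_iff[OF assms])
    then show ?thesis by blast
  qed
  then show ?thesis by (simp add: comps_def image_image *)
qed

text \<open>\<open>loops\<close> asks a class to consist of middle points, \<open>comps\<close> of
  middle points with index in \<open>1..q\<close>; these agree because a class never leaves the
  vertices of the stack. The relabelling makes loops between different storeys countable in one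
  graph.\<close>

lemma loops_layers:
  assumes d: "distinct [a, b, c]" and fg: "f \<in> diagrams q r" "g \<in> diagrams p q"
  shows "loops f g = card (comps (layer_rel a b g \<union> layer_rel b c f) ({b} \<times> {1..q}))"
proof -
  let ?R = "edge_rel (stack f g)"
  have V: "\<Union>(stack f g) = Upper ` {1..p} \<union> Middle ` {1..q} \<union> Lower ` {1..r}"
    using stack_Union[OF fg] by (auto simp: stack_def)
  have Fd: "y = x \<or> y \<in> \<Union>(stack f g)" if "(x, y) \<in> ?R\<^sup>*" for x y
    using that by (induction rule: rtrancl_induct) (auto dest: edge_rel_Field)
  have "{c \<in> \<Union>(stack f g) // ?R\<^sup>*. c \<subseteq> range Middle} = comps ?R (Middle ` {1..q})"
  proof (intro subset_antisym subsetI)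
    fix c assume "c \<in> {c \<in> \<Union>(stack f g) // ?R\<^sup>*. c \<subseteq> range Middle}"
    then obtain x where x: "x \<in> \<Union>(stack f g)" "c = ?R\<^sup>* `` {x}" "c \<subseteq> range Middle"
      by (auto simp: quotient_def)
    have "y \<in> Middle ` {1..q}" if "y \<in> c" for y
    proof -
      have "y \<in> \<Union>(stack f g)" using Fd[of x y] that x by auto
      moreover have "y \<in> range Middle" using that x by auto
      ultimately show ?thesis unfolding V by auto
    qed
    moreover have "x \<in> c" using x by simp
    ultimately show "c \<in> comps ?R (Middle ` {1..q})" unfolding comps_def using x by blast
  next
    fix c assume "c \<in> comps ?R (Middle ` {1..q})"
    then obtain x where x: "x \<in> Middle ` {1..q}" "c = ?R\<^sup>* `` {x}" "c \<subseteq> Middle ` {1..q}"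
      by (auto simp: comps_def)
    then have "x \<in> \<Union>(stack f g)" unfolding V by auto
    then show "c \<in> {c \<in> \<Union>(stack f g) // ?R\<^sup>*. c \<subseteq> range Middle}"
      using x by (auto simp: quotient_def)
  qed
  then have "loops f g = card (comps ?R (Middle ` {1..q}))" by (simp add: loops_def connected_in_eq)
  also have "\<dots> = card ((`) (layered3 a b c) ` comps ?R (Middle ` {1..q}))"
  proof (rule card_image[symmetric])
    show "inj_on ((`) (layered3 a b c)) (comps ?R (Middle ` {1..q}))"
      using inj_layered3[OF d] by (auto simp: inj_on_def inj_image_eq_iff)
  qed
  also have "(`) (layered3 a b c) ` comps ?R (Middle ` {1..q}) =
    comps (layer_rel a b g \<union> layer_rel b c f) (layered3 a b c ` Middle ` {1..q})"
    by (simp only: comps_image[OF inj_layered3[OF d], symmetric] layered3_stack edge_rel_Un)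
  also have "layered3 a b c ` Middle ` {1..q} = {b} \<times> {1..q}" by (auto simp: image_image)
  finally show ?thesis .
qed

text \<open>Seen from its boundary, a stack of two diagrams behaves like the composite. This is the
  assumption \<open>eq\<close> of the contraction lemmas.\<close>

lemma layer_conn_boundary:
  assumes d: "distinct [a, b, c]" and fg: "f \<in> diagrams q r" "g \<in> diagrams p q"
    and "x \<in> {a} \<times> {1..p} \<union> {c} \<times> {1..r}" "y \<in> {a} \<times> {1..p} \<union> {c} \<times> {1..r}"
  shows "(x, y) \<in> (layer_rel a b g \<union> layer_rel b c f)\<^sup>* \<longleftrightarrow> (x, y) \<in> (layer_rel a c (hat_comp f g))\<^sup>*"
proof -
  obtain x' y' where "x = layered a c x'" "y = layered a c y'" "x' \<in> points p r" "y' \<in> points p r"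
    using assms(4,5) unfolding layered_points[symmetric] by blast
  then show ?thesis
    using layer_conn_hat[OF d fg] layer_conn[of a c "hat_comp f g" p r x' y'] hat_comp_closed[OF fg] d by auto
qed

context
  fixes f g h p q r s
  assumes fgh: "f \<in> diagrams r s" "g \<in> diagrams q r" "h \<in> diagrams p q"
begin

private lemma sym_layers: "sym (layer_rel a b f' \<union> layer_rel c d g')"
  by (intro sym_Un sym_edge_rel)

private lemma gh: "hat_comp g h \<in> diagrams p r" and fg: "hat_comp f g \<in> diagrams q s"
  using fgh by blast+

text \<open>The storeys \<open>h\<close> and \<open>g\<close> occupy the layers 0 to 2 and touch
  \<open>f\<close> only along layer 2. The companion \<open>facts2\<close> treats \<open>g\<close>
  and \<open>f\<close>, which touch \<open>h\<close> along layer 1.\<close>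

private lemma facts1:
  "Field (layer_rel 0 1 h \<union> layer_rel 1 2 g) \<subseteq> {0,1,2} \<times> UNIV"
  "{0,1,2} \<times> UNIV \<inter> Field (layer_rel 2 3 f) \<subseteq> {0} \<times> {1..p} \<union> {2} \<times> {1..r}"
  "Field (layer_rel 0 2 (hat_comp g h)) \<subseteq> {0} \<times> {1..p} \<union> {2} \<times> {1..r}"
  using layer_Field[OF fgh(1), of 2 3] layer_Field[OF fgh(2), of 1 2] layer_Field[OF fgh(3), of 0 1]
    layer_Field[OF gh, of 0 2] by (auto simp: Field_Un)

private lemma facts2:
  "Field (layer_rel 1 2 g \<union> layer_rel 2 3 f) \<subseteq> {1,2,3} \<times> UNIV"
  "{1,2,3} \<times> UNIV \<inter> Field (layer_rel 0 1 h) \<subseteq> {1} \<times> {1..q} \<union> {3} \<times> {1..s}"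
  "Field (layer_rel 1 3 (hat_comp f g)) \<subseteq> {1} \<times> {1..q} \<union> {3} \<times> {1..s}"
  using layer_Field[OF fgh(1), of 2 3] layer_Field[OF fgh(2), of 1 2] layer_Field[OF fgh(3), of 0 1]
    layer_Field[OF fg, of 1 3] by (auto simp: Field_Un)

private lemma bd1:
  "x \<in> {0} \<times> {1..p} \<union> {2} \<times> {1..r} \<Longrightarrow> y \<in> {0} \<times> {1..p} \<union> {2} \<times> {1..r} \<Longrightarrow>
    (x, y) \<in> (layer_rel 0 1 h \<union> layer_rel 1 2 g)\<^sup>* \<longleftrightarrow> (x, y) \<in> (layer_rel 0 2 (hat_comp g h))\<^sup>*"
  by (rule layer_conn_boundary[OF _ fgh(2,3)]) auto

private lemma bd2:
  "x \<in> {1} \<times> {1..q} \<union> {3} \<times> {1..s} \<Longrightarrow> y \<in> {1} \<times> {1..q} \<union> {3} \<times> {1..s} \<Longrightarrow>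
    (x, y) \<in> (layer_rel 1 2 g \<union> layer_rel 2 3 f)\<^sup>* \<longleftrightarrow> (x, y) \<in> (layer_rel 1 3 (hat_comp f g))\<^sup>*"
  by (rule layer_conn_boundary[OF _ fgh(1,2)]) auto

text \<open>Both composites record the connections between the outer points of the stack of all
  three diagrams, in which either the lower or the upper two storeys have been contracted.\<close>

lemma hat_comp_assoc: "hat_comp (hat_comp f g) h = hat_comp f (hat_comp g h)"
proof (rule diagram_eqI)
  show "hat_comp (hat_comp f g) h \<in> diagrams p s" "hat_comp f (hat_comp g h) \<in> diagrams p s"
    using fgh by blast+
  fix x y assume xy: "{x, y} \<in> hat_comp (hat_comp f g) h"
  then have pts: "x \<in> points p s" "y \<in> points p s" "x \<noteq> y"
    using edge_points[OF hat_comp_closed[OF fg fgh(3)]] by auto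
  let ?x = "layered 0 3 x" and ?y = "layered 0 3 y"
  have n: "?x \<notin> {0,1,2} \<times> UNIV - ({0} \<times> {1..p} \<union> {2} \<times> {1..r})"
    "?y \<notin> {0,1,2} \<times> UNIV - ({0} \<times> {1..p} \<union> {2} \<times> {1..r})"
    "?x \<notin> {1,2,3} \<times> UNIV - ({1} \<times> {1..q} \<union> {3} \<times> {1..s})"
    "?y \<notin> {1,2,3} \<times> UNIV - ({1} \<times> {1..q} \<union> {3} \<times> {1..s})"
    using pts by (cases x; cases y; auto)+
  have "(?x, ?y) \<in> (layer_rel 0 1 h \<union> layer_rel 1 3 (hat_comp f g))\<^sup>*"
    using layer_conn_hat[OF _ fg fgh(3) pts(1,2), of 0 1 3] xy by simp
  then have "(?x, ?y) \<in> (layer_rel 1 2 g \<union> layer_rel 2 3 f \<union> layer_rel 0 1 h)\<^sup>*"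
    using contract_conn[OF facts2 bd2 n(3,4)] by (simp add: Un_commute)
  then have "(?x, ?y) \<in> (layer_rel 0 1 h \<union> layer_rel 1 2 g \<union> layer_rel 2 3 f)\<^sup>*"
    by (simp add: Un_ac)
  then have "(?x, ?y) \<in> (layer_rel 0 2 (hat_comp g h) \<union> layer_rel 2 3 f)\<^sup>*"
    using contract_conn[OF facts1 bd1 n(1,2)] by simp
  then show "{x, y} \<in> hat_comp f (hat_comp g h)"
    using layer_conn_hat[OF _ fgh(1) gh pts(1,2), of 0 2 3] pts by simp
qed

text \<open>Both sides count the loops of the three-storey stack that stay in its two middle layers.
  Contracting two storeys splits off the loops inside them and keeps the others. The identity is the
  cocycle condition behind associativity of \<open>bcomp\<close>.\<close>

lemma loops_assoc: "loops (hat_comp f g) h + loops f g = loops f (hat_comp g h) + loops g h"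
proof -
  let ?M1 = "{1} \<times> {1..q} :: (nat \<times> nat) set" and ?M2 = "{2} \<times> {1..r} :: (nat \<times> nat) set"
  have "card (comps ((layer_rel 0 1 h \<union> layer_rel 1 2 g) \<union> layer_rel 2 3 f) (?M1 \<union> ?M2)) =
    card (comps (layer_rel 0 1 h \<union> layer_rel 1 2 g) ?M1) +
    card (comps (layer_rel 0 2 (hat_comp g h) \<union> layer_rel 2 3 f) ?M2)"
    using layer_Field[OF fgh(2), of 1 2] layer_Field[OF fgh(3), of 0 1]
    by (intro comps_contract[OF facts1 bd1 sym_layers sym_edge_rel sym_edge_rel]) (auto simp: Field_Un)
  also have "\<dots> = loops g h + loops f (hat_comp g h)"
    using loops_layers[OF _ fgh(2,3), of 0 1 2] loops_layers[OF _ fgh(1) gh, of 0 2 3] by simp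
  finally have 1: "card (comps ((layer_rel 0 1 h \<union> layer_rel 1 2 g) \<union> layer_rel 2 3 f) (?M1 \<union> ?M2)) =
    loops g h + loops f (hat_comp g h)" .
  have "card (comps ((layer_rel 1 2 g \<union> layer_rel 2 3 f) \<union> layer_rel 0 1 h) (?M2 \<union> ?M1)) =
    card (comps (layer_rel 1 2 g \<union> layer_rel 2 3 f) ?M2) +
    card (comps (layer_rel 1 3 (hat_comp f g) \<union> layer_rel 0 1 h) ?M1)"
    using layer_Field[OF fgh(1), of 2 3] layer_Field[OF fgh(2), of 1 2]
    by (intro comps_contract[OF facts2 bd2 sym_layers sym_edge_rel sym_edge_rel]) (auto simp: Field_Un)
  also have "\<dots> = loops f g + loops (hat_comp f g) h"
    using loops_layers[OF _ fgh(1,2), of 1 2 3] loops_layers[OF _ fg fgh(3), of 0 1 3] by (simp add: Un_commute)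
  finally show ?thesis using 1 by (simp add: Un_ac)
qed

end

section \<open>Upward and downward diagrams\<close>

lemma diagramsI:
  assumes "\<And>e. e \<in> f \<Longrightarrow> \<exists>x y. e = {x, y}"
    and "\<And>x y. {x, y} \<in> f \<Longrightarrow> x \<noteq> y \<and> x \<in> points p q"
    and "\<And>x. x \<in> points p q \<Longrightarrow> \<exists>y. {x, y} \<in> f"
    and "\<And>x y z. {x, y} \<in> f \<Longrightarrow> {x, z} \<in> f \<Longrightarrow> y = z"
  shows "f \<in> diagrams p q"
proof -
  have "matching f"
  proof (rule matchingI)
    fix e assume "e \<in> f"
    then obtain x y where "e = {x, y}" using assms(1) by blast
    then show "\<exists>x y. e = {x, y} \<and> x \<noteq> y" using assms(2)[of x y] \<open>e \<in> f\<close> by metis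
  qed (fact assms(4))
  moreover have "\<Union>f \<subseteq> points p q"
  proof
    fix x assume "x \<in> \<Union>f"
    then obtain a b where "{a, b} \<in> f" "x \<in> {a, b}" using assms(1) by fastforce
    then show "x \<in> points p q" using assms(2)[of a b] assms(2)[of b a] by (auto simp: insert_commute)
  qed
  moreover have "points p q \<subseteq> \<Union>f" using assms(3) by blast
  ultimately show ?thesis by (auto simp: diagrams_iff)
qed

section \<open>Identity diagrams and strands\<close>

lemma id_diagram_mem: "e \<in> id_diagram p \<longleftrightarrow> (\<exists>i. 1 \<le> i \<and> i \<le> p \<and> e = {Top i, Bot i})"
  unfolding id_diagram_def image_iff by auto

lemma id_diagram_iff [simp]:
  "{Top i, Bot j} \<in> id_diagram p \<longleftrightarrow> i = j \<and> 1 \<le> i \<and> i \<le> p"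
  "{Bot j, Top i} \<in> id_diagram p \<longleftrightarrow> i = j \<and> 1 \<le> i \<and> i \<le> p"
  "{Top i, Top j} \<notin> id_diagram p" "{Bot i, Bot j} \<notin> id_diagram p"
  unfolding id_diagram_mem doubleton_eq_iff by auto

lemma id_diagram_closed [simp, intro]: "id_diagram p \<in> diagrams p p"
proof (rule diagramsI)
  fix x y assume "{x, y} \<in> id_diagram p" then show "x \<noteq> y \<and> x \<in> points p p"
    by (cases x; cases y) auto
next
  fix x assume "x \<in> points p p" then show "\<exists>y. {x, y} \<in> id_diagram p"
    by (metis id_diagram_iff(1,2) point.exhaust points_simps)
next
  fix x y z assume "{x, y} \<in> id_diagram p" "{x, z} \<in> id_diagram p" then show "y = z"
    by (cases x; cases y; cases z) auto
qed (auto simp: id_diagram_mem)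

lemma id_diagram_level [simp]: "level (id_diagram p)" "upward (id_diagram p)" "downward (id_diagram p)"
  by (auto simp: level_def upward_def downward_def)

lemma bar_id [simp]: "bar (id_diagram p) = id_diagram p"
proof (rule diagram_eqI[of _ p p])
  fix x y assume "{x, y} \<in> bar (id_diagram p)"
  then show "{x, y} \<in> id_diagram p" unfolding bar_iff by (cases x; cases y) auto
qed auto

lemma hat_comp_id_left:
  assumes f: "f \<in> diagrams p q" shows "hat_comp (id_diagram q) f = f"
proof (rule diagrams_subset_eq[OF f, symmetric])
  show "hat_comp (id_diagram q) f \<in> diagrams p q" using f by blast
  show "f \<subseteq> hat_comp (id_diagram q) f"
  proof (rule diagram_subsetI[OF f])
    fix i j
    show "{Top i, Top j} \<in> f \<Longrightarrow> {Top i, Top j} \<in> hat_comp (id_diagram q) f"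
      by (rule hat_comp_top[OF _ f]) auto
    show "{Top i, Bot j} \<in> f \<Longrightarrow> {Top i, Bot j} \<in> hat_comp (id_diagram q) f"
      by (rule hat_comp_strand[OF _ f]) (auto dest: edge_bounds[OF f])
    show "{Bot i, Bot j} \<in> f \<Longrightarrow> {Bot i, Bot j} \<in> hat_comp (id_diagram q) f"
      by (rule hat_comp_cup[OF _ f]) (auto dest: edge_bounds[OF f])
  qed
qed

lemma hat_comp_id_right:
  assumes f: "f \<in> diagrams p q" shows "hat_comp f (id_diagram p) = f"
proof -
  have "bar (hat_comp f (id_diagram p)) = hat_comp (id_diagram p) (bar f)"
    using hat_comp_bar[OF f id_diagram_closed] by simp
  also have "\<dots> = bar f" using hat_comp_id_left bar_closed[OF f] by blast
  finally show ?thesis by (metis bar_bar)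
qed

lemma top_cases:
  assumes "f \<in> diagrams p q" "1 \<le> i" "i \<le> p"
  obtains j where "{Top i, Top j} \<in> f" | j where "{Top i, Bot j} \<in> f"
proof -
  have "Top i \<in> points p q" using assms by simp
  then obtain y where "{Top i, y} \<in> f" using partner_exists[OF assms(1)] by metis
  then show ?thesis using that by (cases y) auto
qed

lemma bot_cases:
  assumes "f \<in> diagrams p q" "1 \<le> i" "i \<le> q"
  obtains j where "{Bot i, Bot j} \<in> f" | j where "{Top j, Bot i} \<in> f"
proof -
  have "Bot i \<in> points p q" using assms by simp
  then obtain y where "{Bot i, y} \<in> f" using partner_exists[OF assms(1)] by metis
  then show ?thesis using that by (cases y) (auto simp: insert_commute)
qed

lemma partner_uniqueD:
  assumes "f \<in> diagrams p q"
  shows "{Top i, Bot j} \<in> f \<Longrightarrow> {Top i, Bot k} \<in> f \<Longrightarrow> j = k"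
    "{Top j, Bot i} \<in> f \<Longrightarrow> {Top k, Bot i} \<in> f \<Longrightarrow> j = k"
    "{Top i, Top j} \<in> f \<Longrightarrow> {Top i, Top k} \<in> f \<Longrightarrow> j = k"
    "{Bot i, Bot j} \<in> f \<Longrightarrow> {Bot i, Bot k} \<in> f \<Longrightarrow> j = k"
    "{Top i, Top j} \<in> f \<Longrightarrow> {Top i, Bot k} \<in> f \<Longrightarrow> False"
    "{Bot i, Bot j} \<in> f \<Longrightarrow> {Top k, Bot i} \<in> f \<Longrightarrow> False"
proof -
  note u = partner_unique[OF assms]
  have c: "{x, y} = {y, x}" for x y :: point by auto
  show "{Top i, Bot j} \<in> f \<Longrightarrow> {Top i, Bot k} \<in> f \<Longrightarrow> j = k"
    "{Top i, Top j} \<in> f \<Longrightarrow> {Top i, Top k} \<in> f \<Longrightarrow> j = k"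
    "{Bot i, Bot j} \<in> f \<Longrightarrow> {Bot i, Bot k} \<in> f \<Longrightarrow> j = k"
    "{Top i, Top j} \<in> f \<Longrightarrow> {Top i, Bot k} \<in> f \<Longrightarrow> False"
    using u by blast+
  show "{Top j, Bot i} \<in> f \<Longrightarrow> {Top k, Bot i} \<in> f \<Longrightarrow> j = k"
    using u[of "Bot i" "Top j" "Top k"] c[of "Top j" "Bot i"] c[of "Top k" "Bot i"] by simp
  show "{Bot i, Bot j} \<in> f \<Longrightarrow> {Top k, Bot i} \<in> f \<Longrightarrow> False"
    using u[of "Bot i" "Bot j" "Top k"] c[of "Top k" "Bot i"] by simp
qed

lemma upward_bar [simp]: "upward (bar f) \<longleftrightarrow> downward f" and downward_bar [simp]: "downward (bar f) \<longleftrightarrow> upward f"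
  by (auto simp: upward_def downward_def bar_iff)

lemma bar_mem [simp]:
  "bar f \<in> diagrams p q \<longleftrightarrow> f \<in> diagrams q p"
  "bar f \<in> up_diagrams p q \<longleftrightarrow> f \<in> down_diagrams q p"
  "bar f \<in> down_diagrams p q \<longleftrightarrow> f \<in> up_diagrams q p"
  "bar f \<in> level_diagrams p q \<longleftrightarrow> f \<in> level_diagrams q p"
proof -
  show 1: "bar f \<in> diagrams p q \<longleftrightarrow> f \<in> diagrams q p" for p q by (metis bar_bar bar_closed)
  show "bar f \<in> up_diagrams p q \<longleftrightarrow> f \<in> down_diagrams q p"
    "bar f \<in> down_diagrams p q \<longleftrightarrow> f \<in> up_diagrams q p"
    "bar f \<in> level_diagrams p q \<longleftrightarrow> f \<in> level_diagrams q p"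
    by (auto simp: up_diagrams_def down_diagrams_def level_diagrams_def level_def 1)
qed

lemma up_diagramsD: "f \<in> up_diagrams p q \<Longrightarrow> f \<in> diagrams p q"
  and down_diagramsD: "f \<in> down_diagrams p q \<Longrightarrow> f \<in> diagrams p q"
  and level_diagramsD: "f \<in> level_diagrams p q \<Longrightarrow> f \<in> diagrams p q"
  and level_up: "f \<in> level_diagrams p q \<Longrightarrow> f \<in> up_diagrams p q"
  and level_down: "f \<in> level_diagrams p q \<Longrightarrow> f \<in> down_diagrams p q"
  and mono_up_up: "f \<in> mono_up_diagrams p q \<Longrightarrow> f \<in> up_diagrams p q"
  by (auto simp: up_diagrams_def down_diagrams_def level_diagrams_def level_def mono_up_diagrams_def)

lemma level_iff: "f \<in> level_diagrams p q \<longleftrightarrow> f \<in> up_diagrams p q \<and> f \<in> down_diagrams p q"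
  by (auto simp: up_diagrams_def down_diagrams_def level_diagrams_def level_def)

lemma id_level_diagram [simp]: "id_diagram p \<in> level_diagrams p p"
  "id_diagram p \<in> up_diagrams p p" "id_diagram p \<in> down_diagrams p p"
  by (auto simp: level_diagrams_def up_diagrams_def down_diagrams_def)

section \<open>Composites of upward, downward and level diagrams\<close>

lemma up_strand:
  assumes "f \<in> up_diagrams p q" "1 \<le> i" "i \<le> p" obtains j where "{Top i, Bot j} \<in> f"
  using top_cases[of f p q i] assms by (auto simp: up_diagrams_def upward_def)

lemma down_strand:
  assumes "f \<in> down_diagrams p q" "1 \<le> i" "i \<le> q" obtains j where "{Top j, Bot i} \<in> f"
  using bot_cases[of f p q i] assms by (auto simp: down_diagrams_def downward_def)

text \<open>A pair of top points of the upper diagram survives in every composite.\<close>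

lemma upward_hat_comp:
  assumes "f \<in> diagrams q r" "g \<in> diagrams p q" "upward (hat_comp f g)" shows "upward g"
  using assms hat_comp_top[OF assms(1,2)] unfolding upward_def by blast

lemma downward_hat_comp:
  assumes "f \<in> diagrams q r" "g \<in> diagrams p q" "downward (hat_comp f g)" shows "downward f"
  using assms hat_comp_bot[OF assms(1,2)] unfolding downward_def by blast

text \<open>From every top point a strand of \<open>g\<close> followed by a strand of
  \<open>f\<close> leads to the bottom.\<close>

lemma up_comp [intro]:
  assumes "f \<in> up_diagrams q r" "g \<in> up_diagrams p q" shows "hat_comp f g \<in> up_diagrams p r"
proof -
  note fg = up_diagramsD[OF assms(1)] up_diagramsD[OF assms(2)]
  have c: "hat_comp f g \<in> diagrams p r" using fg by blast
  have "{Top i, Top k} \<notin> hat_comp f g" for i k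
  proof
    assume e: "{Top i, Top k} \<in> hat_comp f g"
    then have "1 \<le> i" "i \<le> p" using edge_bounds[OF c] by blast+
    then obtain j where j: "{Top i, Bot j} \<in> g" using up_strand[OF assms(2)] by metis
    then have "1 \<le> j" "j \<le> q" using edge_bounds[OF fg(2)] by blast+
    then obtain l where "{Top j, Bot l} \<in> f" using up_strand[OF assms(1)] by metis
    then show False using hat_comp_strand[OF fg j] e partner_uniqueD(5)[OF c] by blast
  qed
  then show ?thesis using c by (simp add: up_diagrams_def upward_def)
qed

lemma down_comp [intro]:
  assumes "f \<in> down_diagrams q r" "g \<in> down_diagrams p q" shows "hat_comp f g \<in> down_diagrams p r"
proof -
  have "hat_comp (bar g) (bar f) \<in> up_diagrams r p" using assms by (intro up_comp) auto
  then show ?thesis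
    using hat_comp_bar[OF down_diagramsD[OF assms(1)] down_diagramsD[OF assms(2)]]
    by (metis bar_mem(2))
qed

lemma level_comp [intro]:
  "f \<in> level_diagrams q r \<Longrightarrow> g \<in> level_diagrams p q \<Longrightarrow> hat_comp f g \<in> level_diagrams p r"
  unfolding level_iff by blast

lemma up_comp_iff:
  assumes "f \<in> up_diagrams q r" "g \<in> diagrams p q"
  shows "upward (hat_comp f g) \<longleftrightarrow> upward g"
  using assms up_comp[OF assms(1), of g p] upward_hat_comp[OF up_diagramsD[OF assms(1)] assms(2)]
  by (auto simp: up_diagrams_def)

lemma down_comp_iff:
  assumes "f \<in> diagrams q r" "g \<in> down_diagrams p q"
  shows "downward (hat_comp f g) \<longleftrightarrow> downward f"
  using assms down_comp[of f q r g p] downward_hat_comp[OF assms(1) down_diagramsD[OF assms(2)]]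
  by (auto simp: down_diagrams_def)

text \<open>A closed loop would contain a middle point, whose edge out of the middle layer leads to
  another point of the same component.\<close>

lemma loops_zeroI:
  assumes fg: "f \<in> diagrams q r" "g \<in> diagrams p q"
    and "\<And>i. 1 \<le> i \<Longrightarrow> i \<le> q \<Longrightarrow> \<exists>x. x \<notin> range Middle \<and> (Middle i, x) \<in> edge_rel (stack f g)"
  shows "loops f g = 0"
proof -
  have "False" if c: "c \<in> \<Union>(stack f g) // connected_in (stack f g)" "c \<subseteq> range Middle" for c
  proof -
    obtain x where x: "x \<in> \<Union>(stack f g)" "c = (edge_rel (stack f g))\<^sup>* `` {x}"
      using c by (auto simp: quotient_def connected_in_eq)
    then have "x \<in> range Middle" using c by auto
    then obtain i where i: "x = Middle i" "1 \<le> i" "i \<le> q"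
      using x(1) stack_Union[OF fg] by (auto simp: stack_def)
    then obtain y where "y \<notin> range Middle" "(Middle i, y) \<in> edge_rel (stack f g)" using assms(3) by blast
    then show False using x i c(2) by auto
  qed
  then show ?thesis unfolding loops_def by (metis (no_types, lifting) card.empty empty_Collect_eq)
qed

lemma loops_up [simp]:
  assumes "f \<in> up_diagrams q r" "g \<in> diagrams p q" shows "loops f g = 0"
proof (rule loops_zeroI[OF up_diagramsD[OF assms(1)] assms(2)])
  fix i assume "1 \<le> i" "i \<le> q"
  then obtain j where "{Top i, Bot j} \<in> f" using up_strand[OF assms(1)] by metis
  then have "(Middle i, Lower j) \<in> edge_rel (stack f g)" using stack_below[of "Top i" "Bot j" f g] by simp
  then show "\<exists>x. x \<notin> range Middle \<and> (Middle i, x) \<in> edge_rel (stack f g)" by blast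
qed

lemma loops_down [simp]:
  assumes "f \<in> diagrams q r" "g \<in> down_diagrams p q" shows "loops f g = 0"
proof (rule loops_zeroI[OF assms(1) down_diagramsD[OF assms(2)]])
  fix i assume "1 \<le> i" "i \<le> q"
  then obtain j where "{Top j, Bot i} \<in> g" using down_strand[OF assms(2)] by metis
  then have "(Middle i, Upper j) \<in> edge_rel (stack f g)"
    using stack_above[of "Bot i" "Top j" g f] by (simp add: insert_commute)
  then show "\<exists>x. x \<notin> range Middle \<and> (Middle i, x) \<in> edge_rel (stack f g)" by blast
qed

text \<open>The strands inject the top points into the bottom points. For \<open>p = q\<close> this
  injection is onto and leaves no bottom points to be paired with each other.\<close>

lemma up_diagram_le:
  assumes "f \<in> up_diagrams p q" shows "p \<le> q" and "p = q \<Longrightarrow> f \<in> level_diagrams p q"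
proof -
  note f = up_diagramsD[OF assms]
  define e where "e = (\<lambda>i. SOME j. {Top i, Bot j} \<in> f)"
  have e: "{Top i, Bot (e i)} \<in> f" if "i \<in> {1..p}" for i
    unfolding e_def by (rule someI_ex) (use up_strand[OF assms] that in \<open>metis atLeastAtMost_iff\<close>)
  have inj: "inj_on e {1..p}" using e partner_uniqueD(2)[OF f] by (metis inj_onI)
  have sub: "e ` {1..p} \<subseteq> {1..q}" using e edge_bounds(4)[OF f] by fastforce
  show "p \<le> q" using card_inj_on_le[OF inj sub] by simp
  assume pq: "p = q"
  then have "e ` {1..p} = {1..q}" using inj sub
    by (metis card_image card_subset_eq finite_atLeastAtMost)
  then have "{Bot i, Bot j} \<notin> f" for i j
    using e partner_uniqueD(6)[OF f] edge_bounds(3)[OF f] by (metis atLeastAtMost_iff imageE)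
  then show "f \<in> level_diagrams p q"
    using assms by (simp add: level_diagrams_def up_diagrams_def level_def downward_def)
qed

lemma level_diagrams_eq: "f \<in> level_diagrams p q \<Longrightarrow> p = q"
  using up_diagram_le(1)[of f p q] up_diagram_le(1)[of "bar f" q p] by (auto simp: level_iff)

lemma diagrams_even:
  assumes "f \<in> diagrams p q" shows "even (p + q)"
proof -
  have "card (points p q) = card (Top ` {1..p}) + card (Bot ` {1..q})"
    unfolding points_def by (rule card_Un_disjoint) auto
  also have "\<dots> = p + q" by (simp add: card_image inj_on_def)
  finally have *: "card (points p q) = p + q" .
  have "card (points p q) = card (\<Union>f)" using assms by (simp add: diagrams_iff)
  also have "\<dots> = sum card f"
    using assms
    by (intro card_Union_disjoint)
      (auto simp: diagrams_iff matching_def disjoint_def pairwise_def disjnt_def intro: card_ge_0_finite)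
  also have "\<dots> = 2 * card f" using assms by (simp add: diagrams_iff matching_def)
  finally show ?thesis using * by simp
qed

lemma up_diagrams_prec: "f \<in> up_diagrams p q \<Longrightarrow> prec p q"
  using up_diagram_le(1)[of f p q] diagrams_even[of f p q] up_diagramsD[of f p q]
  by (auto simp: prec_def)

text \<open>Each strand of \<open>f\<close> is retraced by its reflection, and the bottom pairs of
  \<open>f\<close> close up into loops, which \<open>hat_comp\<close> deletes. Upward diagrams thus
  have left inverses.\<close>

lemma bar_comp_up:
  assumes "f \<in> up_diagrams p q" shows "hat_comp (bar f) f = id_diagram p"
proof (rule diagrams_subset_eq[of _ p p, symmetric])
  note f = up_diagramsD[OF assms]
  show c: "hat_comp (bar f) f \<in> diagrams p p" using f by blast
  show "id_diagram p \<subseteq> hat_comp (bar f) f"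
  proof
    fix e assume "e \<in> id_diagram p"
    then obtain i where i: "e = {Top i, Bot i}" "1 \<le> i" "i \<le> p" by (auto simp: id_diagram_mem)
    then obtain j where j: "{Top i, Bot j} \<in> f" using up_strand[OF assms] by metis
    then have "{Top j, Bot i} \<in> bar f" by (simp add: bar_iff insert_commute)
    then show "e \<in> hat_comp (bar f) f" using hat_comp_strand[OF bar_closed[OF f] f j] i by simp
  qed
qed simp

lemma comp_bar_down: "f \<in> down_diagrams p q \<Longrightarrow> hat_comp f (bar f) = id_diagram q"
  using bar_comp_up[of "bar f" q p] by simp

section \<open>Uniqueness and existence of the monotone upward factor\<close>

lemma up_cancel:
  assumes "a \<in> up_diagrams s q" "x \<in> diagrams p s" "y \<in> diagrams p s" "hat_comp a x = hat_comp a y"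
  shows "x = y"
proof -
  note a = up_diagramsD[OF assms(1)]
  have "hat_comp (hat_comp (bar a) a) x = hat_comp (hat_comp (bar a) a) y"
    using assms hat_comp_assoc[OF bar_closed[OF a] a] by simp
  then show ?thesis using assms by (simp add: bar_comp_up hat_comp_id_left)
qed

text \<open>Monotonicity forces the \<open>k\<close>-th strand to end at the \<open>k\<close>-th
  bottom point that is a strand end at all. A monotone upward diagram is therefore determined by its
  set of strand ends and its bottom pairs.\<close>

lemma mono_rank:
  assumes "a \<in> mono_up_diagrams s q" "{Top k, Bot j} \<in> a"
  shows "k = Suc (card {j'. (\<exists>k'. {Top k', Bot j'} \<in> a) \<and> j' < j})"
proof -
  have u: "a \<in> up_diagrams s q" and m: "monotone_diagram a" using assms by (auto simp: mono_up_diagrams_def)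
  note a = up_diagramsD[OF u]
  have k: "1 \<le> k" "k \<le> s" using edge_bounds(1)[OF a assms(2)] by auto
  have mono: "k' < k \<longleftrightarrow> j' < j" if "{Top k', Bot j'} \<in> a" for k' j'
  proof (cases "k' = k")
    case True
    then show ?thesis using partner_uniqueD(1)[OF a] that assms(2) by blast
  next
    case False
    then have "(int k' - int k) * (int j' - int j) > 0"
      using m that assms(2) unfolding monotone_diagram_def by (metis doubleton_eq_iff point.distinct(1) point.inject(1))
    then show ?thesis by (auto simp: zero_less_mult_iff)
  qed
  define e where "e = (\<lambda>i. SOME j. {Top i, Bot j} \<in> a)"
  have e: "{Top i, Bot (e i)} \<in> a" if "i \<in> {1..<k}" for i
    unfolding e_def by (rule someI_ex) (use up_strand[OF u, of i] that k in auto)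
  have "bij_betw e {1..<k} {j'. (\<exists>k'. {Top k', Bot j'} \<in> a) \<and> j' < j}"
    unfolding bij_betw_def
  proof (intro conjI subset_antisym subsetI)
    show "inj_on e {1..<k}" using e partner_uniqueD(2)[OF a] by (metis inj_onI)
    fix j' assume "j' \<in> e ` {1..<k}"
    then obtain i where i: "i \<in> {1..<k}" "j' = e i" by blast
    then show "j' \<in> {j'. (\<exists>k'. {Top k', Bot j'} \<in> a) \<and> j' < j}" using e[of i] mono[of i "e i"] by auto
  next
    fix j' assume "j' \<in> {j'. (\<exists>k'. {Top k', Bot j'} \<in> a) \<and> j' < j}"
    then obtain k' where k': "{Top k', Bot j'} \<in> a" "j' < j" by blast
    then have "k' \<in> {1..<k}" using mono edge_bounds(1)[OF a] by auto
    moreover have "e k' = j'" using e[OF \<open>k' \<in> {1..<k}\<close>] k' partner_uniqueD(1)[OF a] by blast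
    ultimately show "j' \<in> e ` {1..<k}" by blast
  qed
  then have "card {1..<k} = card {j'. (\<exists>k'. {Top k', Bot j'} \<in> a) \<and> j' < j}" by (rule bij_betw_same_card)
  then show ?thesis using k by simp
qed

text \<open>The diagram \<open>x\<close> joins every middle point to the top, so no pair of bottom
  points can arise through the middle layer.\<close>

lemma up_factor_bot:
  assumes "a \<in> diagrams s q" "x \<in> down_diagrams p s"
  shows "{Bot i, Bot j} \<in> hat_comp a x \<longleftrightarrow> {Bot i, Bot j} \<in> a"
proof
  note x = down_diagramsD[OF assms(2)]
  have c: "hat_comp a x \<in> diagrams p q" using assms x by blast
  assume e: "{Bot i, Bot j} \<in> hat_comp a x"
  then have i: "1 \<le> i" "i \<le> q" using edge_bounds(3)[OF c] by auto
  show "{Bot i, Bot j} \<in> a"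
  proof (rule bot_cases[OF assms(1) i])
    fix k assume k: "{Bot i, Bot k} \<in> a"
    then show ?thesis using hat_comp_bot[OF assms(1) x k] e partner_uniqueD(4)[OF c] by blast
  next
    fix k assume k: "{Top k, Bot i} \<in> a"
    then have "1 \<le> k" "k \<le> s" using edge_bounds(1)[OF assms(1)] by blast+
    then obtain l where "{Top l, Bot k} \<in> x" using down_strand[OF assms(2)] by metis
    then have "{Top l, Bot i} \<in> hat_comp a x" using hat_comp_strand[OF assms(1) x _ k] by blast
    then show ?thesis using e partner_uniqueD(6)[OF c] by blast
  qed
qed (rule hat_comp_bot[OF assms(1) down_diagramsD[OF assms(2)]])

lemma up_strand_iff:
  assumes "a \<in> diagrams s q" "1 \<le> j" "j \<le> q"
  shows "(\<exists>k. {Top k, Bot j} \<in> a) \<longleftrightarrow> (\<nexists>i. {Bot j, Bot i} \<in> a)"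
  using bot_cases[OF assms] partner_uniqueD(6)[OF assms(1)] by metis

lemma up_card:
  assumes "a \<in> up_diagrams s q" shows "card {j. \<exists>k. {Top k, Bot j} \<in> a} = s"
proof -
  note a = up_diagramsD[OF assms]
  define e where "e = (\<lambda>i. SOME j. {Top i, Bot j} \<in> a)"
  have e: "{Top i, Bot (e i)} \<in> a" if "i \<in> {1..s}" for i
    unfolding e_def by (rule someI_ex) (use up_strand[OF assms, of i] that in auto)
  have "bij_betw e {1..s} {j. \<exists>k. {Top k, Bot j} \<in> a}"
    unfolding bij_betw_def
  proof (intro conjI subset_antisym subsetI)
    show "inj_on e {1..s}" using e partner_uniqueD(2)[OF a] by (metis inj_onI)
    fix j' assume "j' \<in> e ` {1..s}"
    then show "j' \<in> {j. \<exists>k. {Top k, Bot j} \<in> a}" using e by blast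
  next
    fix j assume "j \<in> {j. \<exists>k. {Top k, Bot j} \<in> a}"
    then obtain k where k: "{Top k, Bot j} \<in> a" by blast
    then have "k \<in> {1..s}" using edge_bounds(1)[OF a] by auto
    moreover have "e k = j" using e[OF \<open>k \<in> {1..s}\<close>] k partner_uniqueD(1)[OF a] by blast
    ultimately show "j \<in> e ` {1..s}" by blast
  qed
  then show ?thesis using bij_betw_same_card by fastforce
qed

text \<open>The bottom pairs of the composite are those of \<open>a\<close>. They fix the strand
  ends, hence their number \<open>s\<close>, and by monotonicity \<open>a\<close> itself; the left
  inverse of \<open>a\<close> then recovers \<open>x\<close>.\<close>

lemma up_factor_unique:
  assumes a: "a \<in> mono_up_diagrams s q" "a' \<in> mono_up_diagrams s' q"
    and x: "x \<in> down_diagrams p s" "x' \<in> down_diagrams p s'"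
    and eq: "hat_comp a x = hat_comp a' x'"
  shows "s = s'" "a = a'" "x = x'"
proof -
  note u = mono_up_up[OF a(1)] mono_up_up[OF a(2)]
  note d = up_diagramsD[OF u(1)] up_diagramsD[OF u(2)]
  have bots: "{Bot i, Bot j} \<in> a \<longleftrightarrow> {Bot i, Bot j} \<in> a'" for i j
    using up_factor_bot[OF d(1) x(1)] up_factor_bot[OF d(2) x(2)] eq by metis
  have F: "(\<exists>k. {Top k, Bot j} \<in> a) \<longleftrightarrow> (\<exists>k. {Top k, Bot j} \<in> a')" for j
  proof (cases "1 \<le> j \<and> j \<le> q")
    case True then show ?thesis using up_strand_iff[OF d(1)] up_strand_iff[OF d(2)] bots by metis
  next
    case False then show ?thesis using edge_bounds(4)[OF d(1)] edge_bounds(4)[OF d(2)] by metis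
  qed
  show s: "s = s'" using up_card[OF u(1)] up_card[OF u(2)] F by simp
  show a_eq: "a = a'"
  proof (rule diagrams_subset_eq[OF d(1) d(2)[folded s]])
    show "a \<subseteq> a'"
    proof (rule diagram_subsetI[OF d(1)])
      fix i j assume ij: "{Top i, Bot j} \<in> a"
      then obtain k where k: "{Top k, Bot j} \<in> a'" using F by blast
      have "i = k" using mono_rank[OF a(1) ij] mono_rank[OF a(2) k] F by simp
      then show "{Top i, Bot j} \<in> a'" using k by simp
    next
      fix i j assume "{Top i, Top j} \<in> a"
      then show "{Top i, Top j} \<in> a'" using u(1) by (auto simp: up_diagrams_def upward_def)
    qed (use bots in blast)
  qed
  show "x = x'"
    by (rule up_cancel[OF u(1), of _ p]) (use x s a_eq eq down_diagramsD in auto)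
qed

text \<open>Cut every strand of \<open>f\<close> and number the cuts in the order of the lower ends.
  The lower halves and the bottom pairs form the monotone \<open>a\<close>; all crossings of strands
  and the top pairs are left to \<open>x\<close>.\<close>

lemma up_factor_exists:
  assumes f: "f \<in> diagrams p q"
  obtains s a x where "a \<in> mono_up_diagrams s q" "x \<in> down_diagrams p s" "f = hat_comp a x"
proof -
  define F where "F = {j. \<exists>i. {Top i, Bot j} \<in> f}"
  define s where "s = card F"
  have "F \<subseteq> {1..q}" using edge_bounds(4)[OF f] by (auto simp: F_def)
  then have finF: "finite F" by (rule finite_subset) simp
  obtain e0 where e0: "bij_betw e0 {..<s} F" "strict_mono_on {..<s} e0"
    using ex_bij_betw_strict_mono_card[OF finF] unfolding s_def by metis
  \<comment> \<open>\<open>e0\<close> enumerates the strand ends from 0, whereas points are numbered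
    from 1.\<close>
  define e where "e = (\<lambda>k. e0 (k - 1))"
  have e_mem: "e k \<in> F" if "1 \<le> k" "k \<le> s" for k
    using e0(1) that by (auto simp: e_def bij_betw_def)
  have e_mono: "e k < e l" if "1 \<le> k" "k < l" "l \<le> s" for k l
    using strict_mono_onD[OF e0(2), of "k - 1" "l - 1"] that by (auto simp: e_def)
  have e_inj: "k = l" if "1 \<le> k" "1 \<le> l" "k \<le> s" "l \<le> s" "e k = e l" for k l
    using e_mono[of k l] e_mono[of l k] that by (cases k l rule: linorder_cases) auto
  have e_surj: "\<exists>k. 1 \<le> k \<and> k \<le> s \<and> e k = j" if "j \<in> F" for j
  proof -
    have "j \<in> e0 ` {..<s}" using that e0(1) unfolding bij_betw_def by blast
    then obtain k where "k < s" "e0 k = j" by blast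
    then show ?thesis by (intro exI[of _ "Suc k"]) (auto simp: e_def)
  qed
  define a where "a = {{Bot i, Bot j} | i j. {Bot i, Bot j} \<in> f} \<union> {{Top k, Bot (e k)} | k. 1 \<le> k \<and> k \<le> s}"
  define x where "x = {{Top i, Top j} | i j. {Top i, Top j} \<in> f} \<union>
    {{Top i, Bot k} | i k. 1 \<le> k \<and> k \<le> s \<and> {Top i, Bot (e k)} \<in> f}"
  have a_iff: "{Bot i, Bot j} \<in> a \<longleftrightarrow> {Bot i, Bot j} \<in> f" "{Top i, Top j} \<notin> a"
    "{Top k, Bot j} \<in> a \<longleftrightarrow> 1 \<le> k \<and> k \<le> s \<and> j = e k"
    "{Bot j, Top k} \<in> a \<longleftrightarrow> 1 \<le> k \<and> k \<le> s \<and> j = e k" for i j k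
    by (auto simp: a_def doubleton_eq_iff insert_commute)
  have x_iff: "{Top i, Top j} \<in> x \<longleftrightarrow> {Top i, Top j} \<in> f" "{Bot i, Bot j} \<notin> x"
    "{Top j, Bot k} \<in> x \<longleftrightarrow> 1 \<le> k \<and> k \<le> s \<and> {Top j, Bot (e k)} \<in> f"
    "{Bot k, Top j} \<in> x \<longleftrightarrow> 1 \<le> k \<and> k \<le> s \<and> {Top j, Bot (e k)} \<in> f" for i j k
    by (auto simp: x_def doubleton_eq_iff insert_commute)
  have aD: "a \<in> diagrams s q"
  proof (rule diagramsI)
    show "\<And>E. E \<in> a \<Longrightarrow> \<exists>x y. E = {x, y}" by (auto simp: a_def)
    fix u v
    show "u \<noteq> v \<and> u \<in> points s q" if "{u, v} \<in> a"
    proof -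
      have "1 \<le> e k \<and> e k \<le> q" if "1 \<le> k" "k \<le> s" for k
        using e_mem[OF that] \<open>F \<subseteq> {1..q}\<close> by auto
      then show ?thesis using that
        by (cases u; cases v) (auto simp: a_iff dest: edge_bounds[OF f] edge_points[OF f])
    qed
    show "\<exists>v. {u, v} \<in> a" if "u \<in> points s q"
    proof (cases u)
      case (Top k)
      then have "{u, Bot (e k)} \<in> a" using that by (simp add: a_iff)
      then show ?thesis by blast
    next
      case (Bot j)
      show ?thesis
      proof (rule bot_cases[OF f, of j])
        fix i assume "{Top i, Bot j} \<in> f"
        then have "j \<in> F" by (auto simp: F_def)
        then obtain k where "1 \<le> k" "k \<le> s" "e k = j" using e_surj by blast
        then have "{u, Top k} \<in> a" using Bot by (simp add: a_iff)
        then show ?thesis by blast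
      next
        fix i assume "{Bot j, Bot i} \<in> f"
        then have "{u, Bot i} \<in> a" using Bot by (simp add: a_iff)
        then show ?thesis by blast
      qed (use that Bot in auto)
    qed
    fix w
    show "v = w" if uv: "{u, v} \<in> a" and uw: "{u, w} \<in> a"
    proof -
      have ne: "e k \<noteq> j" if "{Bot j, Bot i} \<in> f" "1 \<le> k" "k \<le> s" for i j k
        using e_mem[OF that(2,3)] partner_uniqueD(6)[OF f that(1)] by (auto simp: F_def)
      show ?thesis
      proof (cases u)
        case (Top i)
        then show ?thesis using uv uw by (cases v; cases w) (simp_all add: a_iff)
      next
        case (Bot j)
        then show ?thesis using uv uw partner_uniqueD(4)[OF f, of j] e_inj ne[of j]
          by (cases v; cases w) (simp_all add: a_iff, metis+)
      qed
    qed
  qed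
  have xD: "x \<in> diagrams p s"
  proof (rule diagramsI)
    show "\<And>E. E \<in> x \<Longrightarrow> \<exists>x y. E = {x, y}" by (auto simp: x_def)
    fix u v
    show "u \<noteq> v \<and> u \<in> points p s" if "{u, v} \<in> x"
      using that edge_points[OF f] by (cases u; cases v) (auto simp: x_iff dest: edge_bounds[OF f])
    show "\<exists>v. {u, v} \<in> x" if "u \<in> points p s"
    proof (cases u)
      case (Bot k)
      then have k: "1 \<le> k" "k \<le> s" using that by auto
      then obtain i where "{Top i, Bot (e k)} \<in> f" using e_mem[of k] by (auto simp: F_def)
      then have "{u, Top i} \<in> x" using Bot k by (simp add: x_iff)
      then show ?thesis by blast
    next
      case (Top i)
      show ?thesis
      proof (rule top_cases[OF f, of i])
        fix j assume "{Top i, Bot j} \<in> f"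
        moreover obtain k where "1 \<le> k" "k \<le> s" "e k = j"
          using e_surj[of j] \<open>{Top i, Bot j} \<in> f\<close> by (auto simp: F_def)
        ultimately have "{u, Bot k} \<in> x" using Top by (simp add: x_iff)
        then show ?thesis by blast
      next
        fix j assume "{Top i, Top j} \<in> f"
        then have "{u, Top j} \<in> x" using Top by (simp add: x_iff)
        then show ?thesis by blast
      qed (use that Top in auto)
    qed
    fix w
    show "v = w" if uv: "{u, v} \<in> x" and uw: "{u, w} \<in> x"
    proof (cases u)
      case (Top i)
      then show ?thesis
        using uv uw partner_uniqueD(1)[OF f, of i] partner_uniqueD(3)[OF f, of i] partner_uniqueD(5)[OF f, of i] e_inj
        by (cases v; cases w) (simp_all add: x_iff, metis+)
    next
      case (Bot k)
      then show ?thesis using uv uw partner_uniqueD(2)[OF f, of _ "e k"] by (cases v; cases w) (simp_all add: x_iff)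
    qed
  qed
  have am: "a \<in> mono_up_diagrams s q"
  proof -
    have "(int i - int k) * (int (e i) - int (e k)) > 0" if "1 \<le> i" "i \<le> s" "1 \<le> k" "k \<le> s" "i \<noteq> k" for i k
      using e_mono[of i k] e_mono[of k i] that
      by (cases i k rule: linorder_cases) (auto intro: mult_neg_neg mult_pos_pos)
    then have "monotone_diagram a" unfolding monotone_diagram_def by (auto simp: a_iff)
    then show ?thesis using aD by (simp add: mono_up_diagrams_def up_diagrams_def upward_def a_iff)
  qed
  have xd: "x \<in> down_diagrams p s" using xD by (simp add: down_diagrams_def downward_def x_iff)
  have "f = hat_comp a x"
  proof (rule diagrams_subset_eq[OF f])
    show "f \<subseteq> hat_comp a x"
    proof (rule diagram_subsetI[OF f])
      fix i j
      show "{Top i, Top j} \<in> f \<Longrightarrow> {Top i, Top j} \<in> hat_comp a x"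
        by (rule hat_comp_top[OF aD xD]) (simp add: x_iff)
      show "{Bot i, Bot j} \<in> f \<Longrightarrow> {Bot i, Bot j} \<in> hat_comp a x"
        by (rule hat_comp_bot[OF aD xD]) (simp add: a_iff)
      assume ij: "{Top i, Bot j} \<in> f"
      then obtain k where "1 \<le> k" "k \<le> s" "e k = j" using e_surj[of j] by (auto simp: F_def)
      then show "{Top i, Bot j} \<in> hat_comp a x"
        using ij by (intro hat_comp_strand[OF aD xD, of i k]) (auto simp: a_iff x_iff)
    qed
  qed (use aD xD in blast)
  then show ?thesis using that am xd by blast
qed

section \<open>The factorisation of a diagram\<close>

lemma monotone_barI:
  assumes "monotone_diagram f" shows "monotone_diagram (bar f)"
  unfolding monotone_diagram_def
proof (intro allI impI)
  fix i j k l
  assume "{Top i, Bot j} \<in> bar f" "{Top k, Bot l} \<in> bar f" and ne: "{Top i, Bot j} \<noteq> {Top k, Bot l}"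
  then have "{Top j, Bot i} \<in> f" "{Top l, Bot k} \<in> f" by (simp_all add: bar_iff insert_commute)
  moreover have "{Top j, Bot i} \<noteq> {Top l, Bot k}" using ne by (auto simp: doubleton_eq_iff)
  ultimately have "(int j - int l) * (int i - int k) > 0" using assms unfolding monotone_diagram_def by metis
  then show "(int i - int k) * (int j - int l) > 0" by (simp add: mult.commute)
qed

lemma monotone_bar [simp]: "monotone_diagram (bar f) \<longleftrightarrow> monotone_diagram f"
  using monotone_barI[of f] monotone_barI[of "bar f"] by auto

lemma mono_down_bar: "c \<in> mono_down_diagrams p s \<longleftrightarrow> bar c \<in> mono_up_diagrams s p"
  by (simp add: mono_down_diagrams_def mono_up_diagrams_def)

lemma mono_up_diagramsD: "h \<in> mono_up_diagrams s q \<Longrightarrow> h \<in> diagrams s q"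
  and mono_up_bar_down: "h \<in> mono_up_diagrams s q \<Longrightarrow> bar h \<in> down_diagrams q s"
  by (auto dest: mono_up_up up_diagramsD)

lemma finite_up_diagrams [simp]: "finite (up_diagrams p q)" "finite (mono_up_diagrams p q)" "finite (level_diagrams p q)"
  by (auto simp: up_diagrams_def mono_up_diagrams_def level_diagrams_def intro: finite_subset[OF _ finite_diagrams[of p q]])

lemma mono_up_prec: "h \<in> mono_up_diagrams s q \<Longrightarrow> prec s q"
  by (blast dest: mono_up_up up_diagrams_prec)

lemma level_inverse:
  assumes "\<sigma> \<in> level_diagrams s s"
  shows "hat_comp (bar \<sigma>) \<sigma> = id_diagram s" "hat_comp \<sigma> (bar \<sigma>) = id_diagram s"
  using bar_comp_up[OF level_up[OF assms]] comp_bar_down[OF level_down[OF assms]] by auto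

text \<open>The downward factor of an upward diagram has no top pairs either, since these would
  survive, so it is a permutation.\<close>

lemma up_decomp:
  assumes "u \<in> up_diagrams s q"
  obtains h \<sigma> where "h \<in> mono_up_diagrams s q" "\<sigma> \<in> level_diagrams s s" "u = hat_comp h \<sigma>"
proof -
  obtain t h x where h: "h \<in> mono_up_diagrams t q" "x \<in> down_diagrams s t" "u = hat_comp h x"
    using up_factor_exists[OF up_diagramsD[OF assms]] by metis
  then have "upward x"
    using assms upward_hat_comp[OF mono_up_diagramsD[OF h(1)] down_diagramsD[OF h(2)]] by (simp add: up_diagrams_def)
  then have x: "x \<in> level_diagrams s t" using h by (simp add: level_diagrams_def down_diagrams_def level_def)
  then show ?thesis using that h level_diagrams_eq[OF x] by blast
qed

lemma down_decomp:
  assumes "c \<in> down_diagrams p s"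
  obtains h \<sigma> where "h \<in> mono_up_diagrams s p" "\<sigma> \<in> level_diagrams s s" "c = hat_comp \<sigma> (bar h)"
proof -
  obtain h \<sigma> where h: "h \<in> mono_up_diagrams s p" "\<sigma> \<in> level_diagrams s s" "bar c = hat_comp h \<sigma>"
    using up_decomp[of "bar c" s p] assms by auto
  then have "c = hat_comp (bar \<sigma>) (bar h)"
    using hat_comp_bar[OF mono_up_diagramsD[OF h(1)] level_diagramsD[OF h(2)]] by (metis bar_bar)
  then show ?thesis using that[of h "bar \<sigma>"] h by simp
qed

text \<open>Together with \<open>up_decomp\<close>: permutations act freely on upward diagrams from
  the right, with the monotone ones as orbit representatives. Hence \<open>Bplus\<close> is free as
  a right module.\<close>

lemma up_decomp_unique:
  assumes "h \<in> mono_up_diagrams s q" "\<sigma> \<in> level_diagrams s s" "h' \<in> mono_up_diagrams s q" "\<sigma>' \<in> level_diagrams s s"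
    "hat_comp h \<sigma> = hat_comp h' \<sigma>'"
  shows "h = h'" "\<sigma> = \<sigma>'"
  using up_factor_unique[OF assms(1,3) level_down[OF assms(2)] level_down[OF assms(4)] assms(5)] by auto

lemma diagrams_inj: "f \<in> diagrams p q \<Longrightarrow> f \<in> diagrams p' q' \<Longrightarrow> p = p' \<and> q = q'"
proof -
  assume "f \<in> diagrams p q" "f \<in> diagrams p' q'"
  then have "points p q = points p' q'" by (simp add: diagrams_iff)
  then have "Top i \<in> points p q \<longleftrightarrow> Top i \<in> points p' q'" "Bot i \<in> points p q \<longleftrightarrow> Bot i \<in> points p' q'" for i
    by simp_all
  then have "1 \<le> i \<and> i \<le> p \<longleftrightarrow> 1 \<le> i \<and> i \<le> p'" "1 \<le> i \<and> i \<le> q \<longleftrightarrow> 1 \<le> i \<and> i \<le> q'" for i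
    by simp_all
  from this(1)[of p] this(1)[of p'] this(2)[of q] this(2)[of q'] show ?thesis by linarith
qed

text \<open>Evaluates the definite description. Uniqueness is used twice, to split off the upward
  factor and, after reflection, to split the rest.\<close>

lemma factorisation_eq:
  assumes a: "a \<in> mono_up_diagrams s q" and \<sigma>: "\<sigma> \<in> level_diagrams s s" and h: "h \<in> mono_up_diagrams s p"
  shows "factorisation (hat_comp a (hat_comp \<sigma> (bar h))) = (s, a, \<sigma>, bar h)"
proof -
  let ?f = "hat_comp a (hat_comp \<sigma> (bar h))"
  note d = mono_up_diagramsD[OF a] level_diagramsD[OF \<sigma>] bar_closed[OF mono_up_diagramsD[OF h]]
  have f: "?f \<in> diagrams p q" using d by blast
  have dn: "hat_comp \<sigma> (bar h) \<in> down_diagrams p s" using level_down[OF \<sigma>] mono_up_bar_down[OF h] by blast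
  show ?thesis unfolding factorisation_def
  proof (rule the_equality)
    show "case (s, a, \<sigma>, bar h) of (s, a, \<sigma>, c) \<Rightarrow> \<exists>p q. ?f \<in> diagrams p q \<and>
      a \<in> mono_up_diagrams s q \<and> \<sigma> \<in> level_diagrams s s \<and> c \<in> mono_down_diagrams p s \<and>
      ?f = hat_comp a (hat_comp \<sigma> c)"
      using f a \<sigma> h by (auto simp: mono_down_bar)
  next
    fix z
    assume "case z of (s', a', \<sigma>', c') \<Rightarrow> \<exists>p q. ?f \<in> diagrams p q \<and>
      a' \<in> mono_up_diagrams s' q \<and> \<sigma>' \<in> level_diagrams s' s' \<and> c' \<in> mono_down_diagrams p s' \<and>
      ?f = hat_comp a' (hat_comp \<sigma>' c')"
    then obtain s' a' \<sigma>' c' p' q' where z: "z = (s', a', \<sigma>', c')" and f': "?f \<in> diagrams p' q'"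
      and a': "a' \<in> mono_up_diagrams s' q'" and \<sigma>': "\<sigma>' \<in> level_diagrams s' s'"
      and c': "c' \<in> mono_down_diagrams p' s'" and eq: "?f = hat_comp a' (hat_comp \<sigma>' c')"
      by auto
    have pq: "p' = p" "q' = q" using diagrams_inj f f' by blast+
    have h': "bar c' \<in> mono_up_diagrams s' p" using c' pq by (simp add: mono_down_bar)
    then have c'd: "c' \<in> down_diagrams p s'" using mono_up_bar_down by fastforce
    then have dn': "hat_comp \<sigma>' c' \<in> down_diagrams p s'" using level_down[OF \<sigma>'] by blast
    note u = up_factor_unique[OF a a'[unfolded pq] dn dn' eq]
    \<comment> \<open>The remaining factor is downward; its reflection is upward and decomposes
      uniquely as well.\<close>
    have "bar (hat_comp \<sigma> (bar h)) = bar (hat_comp \<sigma>' c')" using u by simp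
    then have "hat_comp h (bar \<sigma>) = hat_comp (bar c') (bar \<sigma>')"
      using hat_comp_bar[OF d(2,3)] hat_comp_bar[OF level_diagramsD[OF \<sigma>'] down_diagramsD[OF c'd]] by simp
    then have "h = bar c'" "bar \<sigma> = bar \<sigma>'"
      using up_decomp_unique[OF h _ _ _, of "bar \<sigma>" "bar c'" "bar \<sigma>'"] \<sigma> \<sigma>' h' u by auto
    then show "z = (s, a, \<sigma>, bar h)" using z u by (metis bar_bar)
  qed
qed

text \<open>In the identification of the tensor product with \<open>B\<close>, a diagram
  \<open>f\<close> stands for \<open>plus_part f\<close> \<otimes> \<open>rest_part f\<close>, the
  permutation being placed on the right factor.\<close>

abbreviation rest_part :: "diagram \<Rightarrow> diagram" where
  "rest_part f \<equiv> hat_comp (zero_part f) (minus_part f)"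

lemma diagram_parts:
  assumes "f \<in> diagrams p q"
  shows "plus_part f \<in> mono_up_diagrams (through f) q" "zero_part f \<in> level_diagrams (through f) (through f)"
    "bar (minus_part f) \<in> mono_up_diagrams (through f) p" "minus_part f \<in> down_diagrams p (through f)"
    "rest_part f \<in> down_diagrams p (through f)" "hat_comp (plus_part f) (rest_part f) = f"
proof -
  obtain s a x where a: "a \<in> mono_up_diagrams s q" "x \<in> down_diagrams p s" "f = hat_comp a x"
    using up_factor_exists[OF assms] by metis
  obtain h \<sigma> where h: "h \<in> mono_up_diagrams s p" "\<sigma> \<in> level_diagrams s s" "x = hat_comp \<sigma> (bar h)"
    using down_decomp[OF a(2)] by metis
  have F: "factorisation f = (s, a, \<sigma>, bar h)" using factorisation_eq[OF a(1) h(2,1)] a(3) h(3) by simp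
  then have P: "through f = s" "plus_part f = a" "zero_part f = \<sigma>" "minus_part f = bar h"
    by (simp_all add: plus_part_def zero_part_def minus_part_def through_def)
  show "plus_part f \<in> mono_up_diagrams (through f) q" "zero_part f \<in> level_diagrams (through f) (through f)"
    "bar (minus_part f) \<in> mono_up_diagrams (through f) p" "minus_part f \<in> down_diagrams p (through f)"
    "rest_part f \<in> down_diagrams p (through f)" "hat_comp (plus_part f) (rest_part f) = f"
    unfolding P using a h mono_up_bar_down[OF h(1)] by simp_all
qed

text \<open>The tensor \<open>u\<close> \<otimes> \<open>c\<close> and the normal form of its
  composite differ by a permutation \<open>\<sigma>\<close> moved from the left factor to the right
  one.\<close>

lemma comp_parts:
  assumes u: "u \<in> up_diagrams s q" and c: "c \<in> down_diagrams p s"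
  obtains \<sigma> where "plus_part (hat_comp u c) \<in> mono_up_diagrams s q" "\<sigma> \<in> level_diagrams s s"
    "u = hat_comp (plus_part (hat_comp u c)) \<sigma>" "rest_part (hat_comp u c) = hat_comp \<sigma> c"
    "through (hat_comp u c) = s"
proof -
  obtain a \<sigma> where a: "a \<in> mono_up_diagrams s q" "\<sigma> \<in> level_diagrams s s" "u = hat_comp a \<sigma>"
    using up_decomp[OF u] by metis
  obtain h \<tau> where h: "h \<in> mono_up_diagrams s p" "\<tau> \<in> level_diagrams s s" "c = hat_comp \<tau> (bar h)"
    using down_decomp[OF c] by metis
  note d = mono_up_diagramsD[OF a(1)] level_diagramsD[OF a(2)] level_diagramsD[OF h(2)]
    bar_closed[OF mono_up_diagramsD[OF h(1)]]
  have st: "hat_comp (hat_comp \<sigma> \<tau>) (bar h) = hat_comp \<sigma> c"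
    using hat_comp_assoc[OF d(2-4)] h by simp
  have "hat_comp u c = hat_comp a (hat_comp \<sigma> c)"
    using hat_comp_assoc[OF d(1,2) down_diagramsD[OF c]] a by simp
  also have "\<dots> = hat_comp a (hat_comp (hat_comp \<sigma> \<tau>) (bar h))" using st by simp
  finally have "factorisation (hat_comp u c) = (s, a, hat_comp \<sigma> \<tau>, bar h)"
    using factorisation_eq[OF a(1) level_comp[OF a(2) h(2)] h(1)] by simp
  then show ?thesis using that[of \<sigma>] a st
    by (simp add: plus_part_def zero_part_def minus_part_def through_def)
qed

lemma mono_up_id [simp]: "id_diagram p \<in> mono_up_diagrams p p"
proof -
  have "monotone_diagram (id_diagram p)"
    unfolding monotone_diagram_def id_diagram_iff by (auto simp: zero_less_mult_iff)
  then show ?thesis by (simp add: mono_up_diagrams_def)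
qed

lemma mono_up_self: "h \<in> mono_up_diagrams s s \<longleftrightarrow> h = id_diagram s"
proof
  assume h: "h \<in> mono_up_diagrams s s"
  then have l: "h \<in> level_diagrams s s" using up_diagram_le(2)[OF mono_up_up[OF h]] by simp
  have "hat_comp h (id_diagram s) = hat_comp (id_diagram s) h"
    using level_diagramsD[OF l] by (simp add: hat_comp_id_left hat_comp_id_right)
  then show "h = id_diagram s" using up_decomp_unique(1)[OF h id_level_diagram(1) mono_up_id l] by blast
qed simp

lemma id_parts [simp]:
  "through (id_diagram p) = p" "plus_part (id_diagram p) = id_diagram p"
  "zero_part (id_diagram p) = id_diagram p" "minus_part (id_diagram p) = id_diagram p"
  using factorisation_eq[of "id_diagram p" p p "id_diagram p" "id_diagram p" p]
  by (auto simp: through_def plus_part_def zero_part_def minus_part_def hat_comp_id_left[OF id_diagram_closed])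

text \<open>A permutation \<open>x\<close> maps the orbit of \<open>h\<close> to that of
  \<open>h'\<close>. The last equation is the reflected form of the one before it; together they
  show that \<open>x h\<close> \<otimes> \<open>bar h\<close> equals \<open>h'\<close> \<otimes>
  \<open>bar h' x\<close>, which lets \<open>x\<close> pass through the sum of all \<open>h\<close>
  \<otimes> \<open>bar h\<close>.\<close>

lemma level_times_mono:
  assumes x: "x \<in> level_diagrams q q" and h: "h \<in> mono_up_diagrams s q"
  defines "h' \<equiv> plus_part (hat_comp x h)" and "\<sigma> \<equiv> rest_part (hat_comp x h)"
  shows "h' \<in> mono_up_diagrams s q" "\<sigma> \<in> level_diagrams s s" "hat_comp x h = hat_comp h' \<sigma>"
    "hat_comp \<sigma> (bar h) = hat_comp (bar h') x"
proof -
  note d = level_diagramsD[OF x] mono_up_diagramsD[OF h]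
  have u: "hat_comp x h \<in> up_diagrams s q" using level_up[OF x] mono_up_up[OF h] by blast
  obtain \<tau> where \<tau>: "plus_part (hat_comp (hat_comp x h) (id_diagram s)) \<in> mono_up_diagrams s q" "\<tau> \<in> level_diagrams s s"
    "hat_comp x h = hat_comp (plus_part (hat_comp (hat_comp x h) (id_diagram s))) \<tau>"
    "rest_part (hat_comp (hat_comp x h) (id_diagram s)) = hat_comp \<tau> (id_diagram s)"
    using comp_parts[OF u id_level_diagram(3)] by metis
  have [simp]: "hat_comp (hat_comp x h) (id_diagram s) = hat_comp x h" "hat_comp \<tau> (id_diagram s) = \<tau>"
    using hat_comp_id_right[OF up_diagramsD[OF u]] hat_comp_id_right[OF level_diagramsD[OF \<tau>(2)]] by auto
  show h': "h' \<in> mono_up_diagrams s q" and \<sigma>: "\<sigma> \<in> level_diagrams s s" and eq: "hat_comp x h = hat_comp h' \<sigma>"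
    using \<tau> by (auto simp: h'_def \<sigma>_def)
  note d' = mono_up_diagramsD[OF h'] level_diagramsD[OF \<sigma>]
  have "hat_comp (bar h) (bar x) = hat_comp (bar \<sigma>) (bar h')"
    using eq hat_comp_bar[OF d] hat_comp_bar[OF d'] by simp
  then have "hat_comp (hat_comp \<sigma> (hat_comp (bar h) (bar x))) x = hat_comp (hat_comp \<sigma> (hat_comp (bar \<sigma>) (bar h'))) x" by simp
  moreover have "hat_comp (hat_comp \<sigma> (hat_comp (bar h) (bar x))) x = hat_comp \<sigma> (bar h)"
  proof -
    have "hat_comp (hat_comp \<sigma> (hat_comp (bar h) (bar x))) x = hat_comp \<sigma> (hat_comp (hat_comp (bar h) (bar x)) x)"
      using hat_comp_assoc[of \<sigma> s s "hat_comp (bar h) (bar x)" q x q] d d' by auto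
    also have "hat_comp (hat_comp (bar h) (bar x)) x = hat_comp (bar h) (hat_comp (bar x) x)"
      using hat_comp_assoc[of "bar h" q s "bar x" q x q] d d' by auto
    finally show ?thesis using level_inverse[OF x] hat_comp_id_right[OF bar_closed[OF d(2)]] by simp
  qed
  moreover have "hat_comp \<sigma> (hat_comp (bar \<sigma>) (bar h')) = bar h'"
    using hat_comp_assoc[of \<sigma> s s "bar \<sigma>" s "bar h'" q] d d' level_inverse[OF \<sigma>]
      hat_comp_id_left[OF bar_closed[OF d'(1)]] by auto
  ultimately show "hat_comp \<sigma> (bar h) = hat_comp (bar h') x" by simp
qed

text \<open>Left multiplication by \<open>x\<close> permutes the orbits of upward diagrams, hence
  their monotone representatives.\<close>

lemma level_times_mono_bij:
  assumes x: "x \<in> level_diagrams q q"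
  shows "bij_betw (\<lambda>h. plus_part (hat_comp x h)) (mono_up_diagrams s q) (mono_up_diagrams s q)"
proof -
  let ?m = "\<lambda>h. plus_part (hat_comp x h)"
  note L = level_times_mono[OF x]
  have "inj_on ?m (mono_up_diagrams s q)"
  proof (rule inj_onI)
    fix h k assume h: "h \<in> mono_up_diagrams s q" and k: "k \<in> mono_up_diagrams s q" and eq: "?m h = ?m k"
    have *: "g = hat_comp (hat_comp (bar x) (?m g)) (rest_part (hat_comp x g))" if g: "g \<in> mono_up_diagrams s q" for g
    proof -
      note d = level_diagramsD[OF x] mono_up_diagramsD[OF g]
      have "hat_comp (hat_comp (bar x) (?m g)) (rest_part (hat_comp x g)) = hat_comp (bar x) (hat_comp x g)"
        using hat_comp_assoc[OF bar_closed[OF d(1)] mono_up_diagramsD[OF L(1)[OF g]] level_diagramsD[OF L(2)[OF g]]]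
          L(3)[OF g] by simp
      also have "\<dots> = g"
        using hat_comp_assoc[OF bar_closed[OF d(1)] d] level_inverse[OF x] hat_comp_id_left[OF d(2)] by simp
      finally show ?thesis by simp
    qed
    \<comment> \<open>Both \<open>h\<close> and \<open>k\<close> arise from the upward diagram
      \<open>?a\<close> by a permutation, so they represent the same orbit.\<close>
    let ?a = "hat_comp (bar x) (?m h)"
    let ?\<sigma> = "rest_part (hat_comp x h)" and ?\<tau> = "rest_part (hat_comp x k)"
    have a: "?a \<in> up_diagrams s q"
      using level_up[of "bar x" q q] x mono_up_up[OF L(1)[OF h]] by (intro up_comp) auto
    note ad = up_diagramsD[OF a] and \<sigma>d = level_diagramsD[OF L(2)[OF h]] and \<tau>d = level_diagramsD[OF L(2)[OF k]]
    have "h = hat_comp ?a ?\<sigma>" "k = hat_comp ?a ?\<tau>" using *[OF h] *[OF k] eq by auto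
    moreover have "hat_comp (hat_comp ?a ?\<tau>) (hat_comp (bar ?\<tau>) ?\<sigma>) = hat_comp ?a (hat_comp (hat_comp ?\<tau> (bar ?\<tau>)) ?\<sigma>)"
      using hat_comp_assoc[of ?a s q ?\<tau> s "hat_comp (bar ?\<tau>) ?\<sigma>" s]
        hat_comp_assoc[of ?\<tau> s s "bar ?\<tau>" s ?\<sigma> s] ad \<sigma>d \<tau>d by auto
    moreover have "hat_comp (hat_comp ?\<tau> (bar ?\<tau>)) ?\<sigma> = ?\<sigma>"
      using level_inverse[OF L(2)[OF k]] hat_comp_id_left[OF \<sigma>d] by simp
    ultimately have "hat_comp h (id_diagram s) = hat_comp k (hat_comp (bar ?\<tau>) ?\<sigma>)"
      using hat_comp_id_right[OF mono_up_diagramsD[OF h]] by simp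
    moreover have "hat_comp (bar ?\<tau>) ?\<sigma> \<in> level_diagrams s s" using level_comp[of "bar ?\<tau>" s s ?\<sigma> s] L(2)[OF h] L(2)[OF k] by simp
    ultimately show "h = k" using up_decomp_unique(1)[OF h id_level_diagram(1) k] by blast
  qed
  moreover have "?m ` mono_up_diagrams s q \<subseteq> mono_up_diagrams s q" using L(1) by blast
  ultimately show ?thesis by (simp add: bij_betw_def endo_inj_surj)
qed

section \<open>Matching caps and the quasi-Brauer composition\<close>

text \<open>Each top pair of \<open>f\<close> closes up with a bottom pair of \<open>w\<close> into
  a loop. By \<open>b'_act_F_d'\<close> this decides whether the image of \<open>f\<close> under
  \<open>F_d'\<close> annihilates \<open>w\<close>.\<close>

definition caps_match :: "diagram \<Rightarrow> diagram \<Rightarrow> bool" where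
  "caps_match f w \<longleftrightarrow> (\<forall>i j. {Top i, Top j} \<in> f \<longrightarrow> {Bot i, Bot j} \<in> w)"

lemma down_factor_top:
  assumes "u \<in> up_diagrams s q" "c \<in> diagrams p s"
  shows "{Top i, Top j} \<in> hat_comp u c \<longleftrightarrow> {Top i, Top j} \<in> c"
proof -
  have "{Bot i, Bot j} \<in> hat_comp (bar c) (bar u) \<longleftrightarrow> {Bot i, Bot j} \<in> bar c"
    using assms by (intro up_factor_bot) auto
  then show ?thesis using hat_comp_bar[OF up_diagramsD[OF assms(1)] assms(2)] by (metis bar_iff flip.simps(2))
qed

lemma caps_match_comp: "u \<in> up_diagrams s q \<Longrightarrow> c \<in> diagrams p s \<Longrightarrow> caps_match (hat_comp u c) w \<longleftrightarrow> caps_match c w"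
  by (simp add: caps_match_def down_factor_top)

text \<open>The points joined by a top pair of \<open>f\<close> are already paired with each other
  in \<open>w\<close>, so a strand of \<open>w\<close> can only run into a strand of
  \<open>f\<close>.\<close>

lemma caps_match_up:
  assumes f: "f \<in> diagrams p q" and w: "w \<in> up_diagrams t p" and m: "caps_match f w"
  shows "hat_comp f w \<in> up_diagrams t q"
proof -
  note wd = up_diagramsD[OF w]
  have c: "hat_comp f w \<in> diagrams t q" using f wd by blast
  have "{Top i, Top k} \<notin> hat_comp f w" for i k
  proof
    assume e: "{Top i, Top k} \<in> hat_comp f w"
    then obtain j where j: "{Top i, Bot j} \<in> w" using up_strand[OF w] edge_bounds(1)[OF c] by metis
    show False
    proof (rule top_cases[OF f, of j])
      fix l assume "{Top j, Top l} \<in> f"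
      then show False using m partner_uniqueD(6)[OF wd _ j] by (auto simp: caps_match_def)
    next
      fix l assume "{Top j, Bot l} \<in> f"
      then show False using hat_comp_strand[OF f wd j] e partner_uniqueD(5)[OF c] by blast
    qed (use edge_bounds(4)[OF wd j] in auto)
  qed
  then show ?thesis using c by (simp add: up_diagrams_def upward_def)
qed

text \<open>The factor \<open>y\<close> is the composite of \<open>c\<close> and \<open>w\<close>.
  Composing it with \<open>bar c\<close> retraces the strands of \<open>c\<close> and restores the
  bottom pairs of \<open>w\<close> that had closed up with top pairs of \<open>c\<close>.\<close>

lemma caps_match_split:
  assumes c: "c \<in> down_diagrams p s" and w: "w \<in> up_diagrams t p"
  shows "caps_match c w \<longleftrightarrow> (\<exists>y\<in>up_diagrams t s. w = hat_comp (bar c) y)"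
proof
  note cd = down_diagramsD[OF c] and wd = up_diagramsD[OF w]
  note bd = bar_closed[OF cd]
  assume m: "caps_match c w"
  let ?y = "hat_comp c w"
  have y: "?y \<in> up_diagrams t s" using caps_match_up[OF cd w m] .
  note yd = up_diagramsD[OF y]
  have "w = hat_comp (bar c) ?y"
  proof (rule diagrams_subset_eq[OF wd])
    show "hat_comp (bar c) ?y \<in> diagrams t p" using bd yd by blast
    have b: "{Top k, Bot j} \<in> bar c" if "{Top j, Bot k} \<in> c" for j k
      using that by (simp add: bar_iff insert_commute)
    have strand: "\<exists>k. {Top j, Bot k} \<in> c" if "1 \<le> j" "j \<le> p" "\<nexists>i. {Top j, Top i} \<in> c" for j
      using top_cases[OF cd that(1,2)] that(3) by metis
    show "w \<subseteq> hat_comp (bar c) ?y"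
    proof (rule diagram_subsetI[OF wd])
      fix i j assume "{Top i, Top j} \<in> w"
      then show "{Top i, Top j} \<in> hat_comp (bar c) ?y" using w by (auto simp: up_diagrams_def upward_def)
    next
      fix i j assume ij: "{Top i, Bot j} \<in> w"
      have "{Top j, Top l} \<notin> c" for l
        using m partner_uniqueD(6)[OF wd _ ij] by (auto simp: caps_match_def)
      then obtain k where k: "{Top j, Bot k} \<in> c" using strand edge_bounds(4)[OF wd ij] by blast
      show "{Top i, Bot j} \<in> hat_comp (bar c) ?y"
        by (rule hat_comp_strand[OF bd yd hat_comp_strand[OF cd wd ij k] b[OF k]])
    next
      fix i j assume ij: "{Bot i, Bot j} \<in> w"
      then have ji: "{Bot j, Bot i} \<in> w" by (simp add: insert_commute)
      show "{Bot i, Bot j} \<in> hat_comp (bar c) ?y"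
      proof (cases "{Top i, Top j} \<in> c")
        case True
        then show ?thesis by (intro hat_comp_bot[OF bd yd]) (simp add: bar_iff)
      next
        case False
        have "{Top i, Top l} \<notin> c" for l
          using m False partner_uniqueD(4)[OF wd ij, of l] by (auto simp: caps_match_def)
        then obtain k where k: "{Top i, Bot k} \<in> c" using strand edge_bounds(3)[OF wd ij] by blast
        have "{Top j, Top l} \<notin> c" for l
          using m False partner_uniqueD(4)[OF wd ji, of l] by (auto simp: caps_match_def insert_commute)
        then obtain l where l: "{Top j, Bot l} \<in> c" using strand edge_bounds(3)[OF wd ji] by blast
        show ?thesis
          by (rule hat_comp_cup[OF bd yd b[OF k] hat_comp_cup[OF cd wd k ij l] b[OF l]])
      qed
    qed
  qed
  then show "\<exists>y\<in>up_diagrams t s. w = hat_comp (bar c) y" using y by blast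
next
  note bd = bar_closed[OF down_diagramsD[OF c]]
  assume "\<exists>y\<in>up_diagrams t s. w = hat_comp (bar c) y"
  then obtain y where y: "y \<in> up_diagrams t s" "w = hat_comp (bar c) y" by blast
  show "caps_match c w" unfolding caps_match_def
  proof (intro allI impI)
    fix i j assume "{Top i, Top j} \<in> c"
    then show "{Bot i, Bot j} \<in> w" unfolding y(2)
      by (intro hat_comp_bot[OF bd up_diagramsD[OF y(1)]]) (simp add: bar_iff)
  qed
qed

text \<open>An upper and a lower pair meet at \<open>j\<close> without closing to a loop: the
  vanishing condition of \<open>qcomp\<close>.\<close>

definition clash :: "diagram \<Rightarrow> diagram \<Rightarrow> bool" where
  "clash f g \<longleftrightarrow> (\<exists>i j k. i \<noteq> j \<and> j \<noteq> k \<and> i \<noteq> k \<and> {Bot i, Bot j} \<in> g \<and> {Top j, Top k} \<in> f)"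

lemma clashI: "{Bot j, Bot i} \<in> g \<Longrightarrow> {Top j, Top k} \<in> f \<Longrightarrow> i \<noteq> j \<Longrightarrow> j \<noteq> k \<Longrightarrow> i \<noteq> k \<Longrightarrow> clash f g"
  unfolding clash_def by (intro exI[of _ i] exI[of _ j] exI[of _ k]) (simp add: insert_commute)

text \<open>The bottom pair of \<open>g\<close> at \<open>j\<close> survives in the composite with
  \<open>w\<close>, so a match would give \<open>j\<close> two different partners there.\<close>

lemma clash_caps_match:
  assumes "clash f g" "f \<in> diagrams q r" "g \<in> diagrams p q" "w \<in> diagrams t p"
  shows "\<not> caps_match f (hat_comp g w)"
proof
  assume m: "caps_match f (hat_comp g w)"
  have c: "hat_comp g w \<in> diagrams t q" using assms by blast
  obtain i j k where ijk: "i \<noteq> k" "{Bot j, Bot i} \<in> g" "{Top j, Top k} \<in> f"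
    using assms(1) by (auto simp: clash_def insert_commute)
  then have "{Bot j, Bot i} \<in> hat_comp g w" "{Bot j, Bot k} \<in> hat_comp g w"
    using hat_comp_bot[OF assms(3,4)] m by (auto simp: caps_match_def)
  then show False using partner_uniqueD(4)[OF c] ijk by blast
qed

text \<open>Without a clash, a top pair of \<open>f\<close> either coincides with a bottom pair of
  \<open>g\<close> or joins the ends of two strands of \<open>g\<close>. The former match
  automatically; the latter, together with the top pairs of \<open>g\<close>, are the top pairs of
  the composite.\<close>

lemma no_clash_caps_match:
  assumes nc: "\<not> clash f g" and f: "f \<in> diagrams q r" and g: "g \<in> diagrams p q" and w: "w \<in> up_diagrams t p"
  shows "caps_match (hat_comp f g) w \<longleftrightarrow> caps_match g w \<and> caps_match f (hat_comp g w)"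
proof
  note wd = up_diagramsD[OF w]
  have fg: "hat_comp f g \<in> diagrams p r" and gw: "hat_comp g w \<in> diagrams t q" using f g wd by blast+
  {
    assume m: "caps_match (hat_comp f g) w"
    have "caps_match g w" using m hat_comp_top[OF f g] by (auto simp: caps_match_def)
    moreover have "caps_match f (hat_comp g w)" unfolding caps_match_def
    proof (intro allI impI)
      fix j k assume jk: "{Top j, Top k} \<in> f"
      then have kj: "{Top k, Top j} \<in> f" by (simp add: insert_commute)
      have ne: "j \<noteq> k" using edge_points[OF f jk] by simp
      \<comment> \<open>If \<open>g\<close> pairs \<open>j\<close> with another bottom point, the
        absence of a clash forces this point to be \<open>k\<close>.\<close>
      have main: "{Bot j, Bot k} \<in> hat_comp g w" if "{Bot j, Bot i} \<in> g" for i
      proof -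
        have "i \<noteq> j" using edge_points[OF g that] by simp
        then have "i = k" using nc clashI[OF that jk] ne by blast
        then show ?thesis using hat_comp_bot[OF g wd that] by simp
      qed
      have main': "{Bot j, Bot k} \<in> hat_comp g w" if "{Bot k, Bot i} \<in> g" for i
      proof -
        have "i \<noteq> k" using edge_points[OF g that] by simp
        then have "i = j" using nc clashI[OF that kj] ne by blast
        then show ?thesis using hat_comp_bot[OF g wd that] by (simp add: insert_commute)
      qed
      show "{Bot j, Bot k} \<in> hat_comp g w"
      proof (rule bot_cases[OF g, of j])
        fix a assume a: "{Top a, Bot j} \<in> g"
        show ?thesis
        proof (rule bot_cases[OF g, of k])
          fix b assume b: "{Top b, Bot k} \<in> g"
          have "{Bot a, Bot b} \<in> w" using m hat_comp_cap[OF f g a jk b] by (auto simp: caps_match_def)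
          then show ?thesis by (rule hat_comp_cup[OF g wd a _ b])
        qed (use main' edge_bounds(1)[OF f kj] in auto)
      qed (use main edge_bounds(1)[OF f jk] in auto)
    qed
    ultimately show "caps_match g w \<and> caps_match f (hat_comp g w)" by blast
  }
  assume m: "caps_match g w \<and> caps_match f (hat_comp g w)"
  show "caps_match (hat_comp f g) w" unfolding caps_match_def
  proof (intro allI impI)
    fix a b assume ab: "{Top a, Top b} \<in> hat_comp f g"
    have bounds: "1 \<le> a" "a \<le> p" using edge_bounds(1)[OF fg ab] by auto
    show "{Bot a, Bot b} \<in> w"
    proof (rule top_cases[OF g bounds])
      fix c assume c: "{Top a, Top c} \<in> g"
      then have "c = b" using hat_comp_top[OF f g c] ab partner_uniqueD(3)[OF fg] by blast
      then show ?thesis using c m by (auto simp: caps_match_def)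
    next
      fix j assume j: "{Top a, Bot j} \<in> g"
      have jb: "1 \<le> j" "j \<le> q" using edge_bounds(4)[OF g j] by auto
      show ?thesis
      proof (rule top_cases[OF f jb])
        fix k assume "{Top j, Bot k} \<in> f"
        then show ?thesis using hat_comp_strand[OF f g j] ab partner_uniqueD(5)[OF fg] by blast
      next
        fix k assume k: "{Top j, Top k} \<in> f"
        then have kj: "{Top k, Top j} \<in> f" by (simp add: insert_commute)
        have jk: "{Bot j, Bot k} \<in> hat_comp g w" using m k by (auto simp: caps_match_def)
        have ne: "j \<noteq> k" using edge_points[OF f k] by simp
        have kb: "1 \<le> k" "k \<le> q" using edge_bounds(1)[OF f kj] by auto
        obtain b' where b': "{Top b', Bot k} \<in> g"
        proof (rule bot_cases[OF g kb])
          fix i assume i: "{Bot k, Bot i} \<in> g"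
          then have "i \<noteq> k" using edge_points[OF g i] by simp
          moreover have "i \<noteq> j"
          proof
            assume "i = j"
            then have "{Bot j, Bot k} \<in> g" using i by (simp add: insert_commute)
            then show False using partner_uniqueD(6)[OF g _ j] by blast
          qed
          ultimately have "clash f g" using clashI[OF i kj] ne by blast
          then show ?thesis using nc by simp
        qed
        have bb: "b' = b" using hat_comp_cap[OF f g j k b'] ab partner_uniqueD(3)[OF fg] by blast
        show ?thesis
        \<comment> \<open>The partner of \<open>a\<close> in \<open>w\<close> is followed through
          \<open>g\<close>; only \<open>b\<close> is compatible with \<open>j\<close> and
          \<open>k\<close> being paired in the composite of \<open>g\<close> and
          \<open>w\<close>.\<close>
        proof (rule bot_cases[OF wd bounds])
          fix c assume c: "{Top c, Bot a} \<in> w"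
          show ?thesis using hat_comp_strand[OF g wd c j] jk partner_uniqueD(6)[OF gw] by blast
        next
          fix c assume c: "{Bot a, Bot c} \<in> w"
          then have ca: "{Bot c, Bot a} \<in> w" by (simp add: insert_commute)
          have cb: "1 \<le> c" "c \<le> p" using edge_bounds(3)[OF wd ca] by auto
          show ?thesis
          proof (rule top_cases[OF g cb])
            fix l assume l: "{Top c, Bot l} \<in> g"
            have "{Bot j, Bot l} \<in> hat_comp g w" by (rule hat_comp_cup[OF g wd j c l])
            then have "l = k" using jk partner_uniqueD(4)[OF gw] by blast
            then have "c = b'" using l b' partner_uniqueD(2)[OF g] by blast
            then show ?thesis using c bb by simp
          next
            \<comment> \<open>Here \<open>g\<close> would pair \<open>c\<close> with its partner in
              \<open>w\<close>, which is \<open>a\<close>, although \<open>a\<close> lies on a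
              strand of \<open>g\<close>.\<close>
            fix l assume l: "{Top c, Top l} \<in> g"
            then have "{Bot c, Bot l} \<in> w" using m by (auto simp: caps_match_def)
            then have "l = a" using ca partner_uniqueD(4)[OF wd] by blast
            then show ?thesis using l j partner_uniqueD(5)[OF g, of a c j] by (auto simp: insert_commute)
          qed
        qed
      qed
    qed
  qed
qed

section \<open>Linear extension and balanced pairings\<close>

lemma smul_simps [simp]:
  "smul c (v + w) = smul c v + smul c w" "smul (a + b) v = smul a v + smul b v"
  "smul a (smul b v) = smul (a * b) v" "smul 1 v = v" "smul 0 v = 0" "smul c 0 = 0"
  by (auto intro!: poly_mapping_eqI simp: lookup_add algebra_simps)

text \<open>Linearity is required on the whole type: the maps in question are extended linearly from
  all basis elements, meaningless ones included, so carriers enter only through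
  \<open>free_on\<close>.\<close>

definition lin :: "(('a \<Rightarrow>\<^sub>0 'k::comm_ring_1) \<Rightarrow> ('b \<Rightarrow>\<^sub>0 'k)) \<Rightarrow> bool" where
  "lin F \<longleftrightarrow> (\<forall>v w. F (v + w) = F v + F w) \<and> (\<forall>c v. F (smul c v) = smul c (F v))"

lemma linI: "(\<And>v w. F (v + w) = F v + F w) \<Longrightarrow> (\<And>c v. F (smul c v) = smul c (F v)) \<Longrightarrow> lin F"
  by (simp add: lin_def)

lemma lin_add: "lin F \<Longrightarrow> F (v + w) = F v + F w"
  and lin_smul: "lin F \<Longrightarrow> F (smul c v) = smul c (F v)"
  by (simp_all add: lin_def)

lemma lin_zero: "lin F \<Longrightarrow> F 0 = 0"
  using lin_smul[of F 0 0] by simp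

lemma diff_smul: "v - w = v + smul (- 1) w"
  by (rule poly_mapping_eqI) (simp add: lookup_add lookup_minus)

lemma lin_diff: "lin F \<Longrightarrow> F (v - w) = F v - F w"
  by (simp add: diff_smul lin_add lin_smul)

lemma lin_sum: "lin F \<Longrightarrow> F (\<Sum>i\<in>I. v i) = (\<Sum>i\<in>I. F (v i))"
  by (induction I rule: infinite_finite_induct) (auto simp: lin_zero lin_add)

lemma smul_sum: "smul c (\<Sum>i\<in>I. v i) = (\<Sum>i\<in>I. smul c (v i))"
  by (rule lin_sum) (auto intro: linI simp: mult.commute)

lemma lin_ext_superset:
  assumes "finite X" "Poly_Mapping.keys v \<subseteq> X"
  shows "lin_ext \<phi> v = (\<Sum>a\<in>X. smul (Poly_Mapping.lookup v a) (\<phi> a))"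
  unfolding lin_ext_def
  by (rule sum.mono_neutral_left) (use assms in \<open>auto simp: in_keys_iff\<close>)

lemma lin_ext_basis [simp]: "lin_ext \<phi> (basis a) = \<phi> a"
  using lin_ext_superset[of "{a}" "basis a" \<phi>] by (simp add: basis_def)

lemma keys_smul: "Poly_Mapping.keys (smul c v) \<subseteq> Poly_Mapping.keys v"
  by (auto simp: in_keys_iff)

lemma lin_ext_add: "lin_ext \<phi> (v + w) = lin_ext \<phi> v + lin_ext \<phi> w"
proof -
  let ?X = "Poly_Mapping.keys v \<union> Poly_Mapping.keys w"
  have "lin_ext \<phi> x = (\<Sum>a\<in>?X. smul (Poly_Mapping.lookup x a) (\<phi> a))" if "Poly_Mapping.keys x \<subseteq> ?X" for x
    by (rule lin_ext_superset) (use that in auto)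
  then show ?thesis using Poly_Mapping.keys_add[of v w]
    by (simp add: lookup_add sum.distrib)
qed

lemma lin_ext_smul: "lin_ext \<phi> (smul c v) = smul c (lin_ext \<phi> v)"
  using lin_ext_superset[OF finite_keys keys_smul, of \<phi> c v]
  by (simp add: lin_ext_def smul_sum)

lemma lin_ext_of_lin [intro]: "lin F \<Longrightarrow> lin (\<lambda>x. lin_ext \<phi> (F x))"
  by (auto intro!: linI simp: lin_add lin_smul lin_ext_add lin_ext_smul)

lemma lin_ident [intro]: "lin (\<lambda>x. x)"
  by (auto intro: linI)

lemma lin_lin_ext [intro]: "lin (lin_ext \<phi>)"
  by (auto intro!: linI simp: lin_ext_add lin_ext_smul)

lemma lin_sum_fun: "(\<And>i. i \<in> I \<Longrightarrow> lin (F i)) \<Longrightarrow> lin (\<lambda>x. \<Sum>i\<in>I. F i x)"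
  by (rule linI) (auto simp: lin_add lin_smul sum.distrib smul_sum)

lemma lin_smul_fun: "lin F \<Longrightarrow> lin (\<lambda>x. smul c (F x))"
  by (rule linI) (auto simp: lin_add lin_smul mult.commute)

lemma lin_bilin_left [intro]: "lin F \<Longrightarrow> lin (\<lambda>x. bilin_ext \<phi> (F x) w)"
  unfolding bilin_ext_def by (rule lin_ext_of_lin)

lemma lin_bilin_right [intro]: "lin F \<Longrightarrow> lin (\<lambda>x. bilin_ext \<phi> v (F x))"
  unfolding bilin_ext_def lin_ext_def[of _ v]
  by (intro lin_sum_fun lin_smul_fun lin_ext_of_lin)

lemma bilin_ext_basis [simp]: "bilin_ext \<phi> (basis a) (basis b) = \<phi> a b"
  by (simp add: bilin_ext_def)

lemma lin_ext_cong: "(\<And>a. a \<in> X \<Longrightarrow> \<phi> a = \<psi> a) \<Longrightarrow> v \<in> free_on X \<Longrightarrow> lin_ext \<phi> v = lin_ext \<psi> v"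
  unfolding lin_ext_def free_on_def by (intro sum.cong) auto

lemma free_on_expand: "v = (\<Sum>a\<in>Poly_Mapping.keys v. smul (Poly_Mapping.lookup v a) (basis a))"
proof (rule poly_mapping_eqI)
  fix b
  show "Poly_Mapping.lookup v b =
    Poly_Mapping.lookup (\<Sum>a\<in>Poly_Mapping.keys v. smul (Poly_Mapping.lookup v a) (basis a)) b"
    by (simp add: lookup_sum basis_def lookup_single when_def if_distrib sum.delta
        in_keys_iff cong: if_cong)
qed

lemma lin_expand: "lin F \<Longrightarrow> F v = (\<Sum>a\<in>Poly_Mapping.keys v. smul (Poly_Mapping.lookup v a) (F (basis a)))"
  by (subst free_on_expand[of v]) (simp only: lin_sum lin_smul)

lemma lin_eq_on:
  assumes "lin F" "lin G" "\<And>a. a \<in> X \<Longrightarrow> F (basis a) = G (basis a)" "v \<in> free_on X"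
  shows "F v = G v"
proof -
  have "F (basis a) = G (basis a)" if "a \<in> Poly_Mapping.keys v" for a
    using assms(3,4) that by (auto simp: free_on_def)
  then show ?thesis
    using lin_expand[OF assms(1), of v] lin_expand[OF assms(2), of v] by simp
qed

lemma free_on_zero [simp, intro]: "0 \<in> free_on X"
  by (simp add: free_on_def)

lemma free_on_add [intro]: "v \<in> free_on X \<Longrightarrow> w \<in> free_on X \<Longrightarrow> v + w \<in> free_on X"
  using Poly_Mapping.keys_add[of v w] by (auto simp: free_on_def)

lemma free_on_smul [intro]: "v \<in> free_on X \<Longrightarrow> smul c v \<in> free_on X"
  using keys_smul[of c v] by (auto simp: free_on_def)

lemma free_on_diff [intro]: "v \<in> free_on X \<Longrightarrow> w \<in> free_on X \<Longrightarrow> v - w \<in> free_on X"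
  by (simp add: diff_smul free_on_add free_on_smul)

lemma free_on_sum [intro]: "(\<And>i. i \<in> I \<Longrightarrow> v i \<in> free_on X) \<Longrightarrow> (\<Sum>i\<in>I. v i) \<in> free_on X"
  by (induction I rule: infinite_finite_induct) auto

lemma basis_free_on [simp]: "basis a \<in> free_on X \<longleftrightarrow> a \<in> X"
  by (simp add: free_on_def basis_def)

lemma free_on_mono: "X \<subseteq> Y \<Longrightarrow> v \<in> free_on X \<Longrightarrow> v \<in> free_on Y"
  by (auto simp: free_on_def)

lemma free_on_subspace: "Modules.module.subspace smul (free_on X)"
  by (auto simp: Modules.module.subspace_def[OF module_smul])

lemma lin_closed:
  assumes "lin F" "\<And>a. a \<in> X \<Longrightarrow> F (basis a) \<in> free_on Y" "v \<in> free_on X"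
  shows "F v \<in> free_on Y"
proof -
  have "F (basis a) \<in> free_on Y" if "a \<in> Poly_Mapping.keys v" for a
    using assms(2,3) that by (auto simp: free_on_def)
  then show ?thesis
    by (subst lin_expand[OF assms(1)]) (intro free_on_sum free_on_smul)
qed

lemma bilin_eq_on:
  assumes "\<And>v. lin (F v)" "\<And>w. lin (\<lambda>v. F v w)" "\<And>v. lin (G v)" "\<And>w. lin (\<lambda>v. G v w)"
    and "\<And>a b. a \<in> X \<Longrightarrow> b \<in> Y \<Longrightarrow> F (basis a) (basis b) = G (basis a) (basis b)"
    and "v \<in> free_on X" "w \<in> free_on Y"
  shows "F v w = G v w"
proof -
  have "F (basis a) w = G (basis a) w" if "a \<in> X" for a
    by (rule lin_eq_on[OF assms(1,3) _ assms(7)]) (use assms(5) that in auto)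
  then show ?thesis by (rule lin_eq_on[OF assms(2,4) _ assms(6)])
qed

lemma bilin_closed:
  assumes "\<And>v. lin (F v)" "\<And>w. lin (\<lambda>v. F v w)"
    and "\<And>a b. a \<in> X \<Longrightarrow> b \<in> Y \<Longrightarrow> F (basis a) (basis b) \<in> free_on Z"
    and "v \<in> free_on X" "w \<in> free_on Y"
  shows "F v w \<in> free_on Z"
proof -
  have "F (basis a) w \<in> free_on Z" if "a \<in> X" for a
    by (rule lin_closed[OF assms(1) _ assms(5)]) (use assms(3) that in auto)
  then show ?thesis by (rule lin_closed[OF assms(2) _ assms(4)])
qed

section \<open>The composition of the Brauer category on linear combinations\<close>

lemma lin_bcomp_left [intro]: "lin F \<Longrightarrow> lin (\<lambda>x. bcomp \<delta> (F x) w)"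
  and lin_bcomp_right [intro]: "lin F \<Longrightarrow> lin (\<lambda>x. bcomp \<delta> v (F x))"
  unfolding bcomp_def by (rule lin_bilin_left lin_bilin_right; assumption)+

lemma lin_bcomp [intro]: "lin (bcomp \<delta> v)"
  using lin_bcomp_right[OF lin_ident] .

lemma lin_pair_b_left [intro]: "lin F \<Longrightarrow> lin (\<lambda>x. pair_b \<delta> (F x) w)"
  and lin_pair_b_right [intro]: "lin F \<Longrightarrow> lin (\<lambda>x. pair_b \<delta> v (F x))"
  and lin_pair_b'_left [intro]: "lin F \<Longrightarrow> lin (\<lambda>x. pair_b' (F x) w)"
  and lin_pair_b'_right [intro]: "lin F \<Longrightarrow> lin (\<lambda>x. pair_b' v (F x))"
  and lin_qcomp_left [intro]: "lin F \<Longrightarrow> lin (\<lambda>x. qcomp (F x) w)"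
  and lin_qcomp_right [intro]: "lin F \<Longrightarrow> lin (\<lambda>x. qcomp v (F x))"
  and lin_pairing_comp_left [intro]: "lin F \<Longrightarrow> lin (\<lambda>x. pairing_comp \<delta> \<beta> (F x) w)"
  and lin_pairing_comp_right [intro]: "lin F \<Longrightarrow> lin (\<lambda>x. pairing_comp \<delta> \<beta> v (F x))"
  unfolding pair_b_def pair_b'_def qcomp_def pairing_comp_def
  by (rule lin_bilin_left lin_bilin_right; assumption)+

lemmas lin_intros = lin_ident lin_ext_of_lin lin_bcomp_left lin_bcomp_right lin_pair_b_left lin_pair_b_right
  lin_pair_b'_left lin_pair_b'_right lin_qcomp_left lin_qcomp_right lin_pairing_comp_left lin_pairing_comp_right

lemma bcomp_basis: "bcomp \<delta> (basis f) (basis g) = smul (\<delta> ^ loops f g) (basis (hat_comp f g))"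
  by (simp add: bcomp_def comp_diagrams_def)

lemma bcomp_closed [intro]:
  "f \<in> B_hom q r \<Longrightarrow> g \<in> B_hom p q \<Longrightarrow> bcomp \<delta> f g \<in> B_hom p r"
  unfolding B_hom_def
  by (rule bilin_closed[of "bcomp \<delta>"]) (auto simp: bcomp_basis intro!: free_on_smul)

lemma Bplus_B_hom: "f \<in> Bplus p q \<Longrightarrow> f \<in> B_hom p q"
  and Bminus_B_hom: "f \<in> Bminus p q \<Longrightarrow> f \<in> B_hom p q"
  and S_hom_B_hom: "f \<in> S_hom p q \<Longrightarrow> f \<in> B_hom p q"
  and S_hom_Bplus: "f \<in> S_hom p q \<Longrightarrow> f \<in> Bplus p q"
  and S_hom_Bminus: "f \<in> S_hom p q \<Longrightarrow> f \<in> Bminus p q"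
  unfolding Bplus_def Bminus_def S_hom_def B_hom_def
  by (auto elim!: free_on_mono[rotated] simp: level_iff dest: up_diagramsD down_diagramsD)

text \<open>On diagrams this is associativity of stacking together with the loop cocycle in the
  exponent of the parameter.\<close>

lemma bcomp_assoc:
  assumes "f \<in> B_hom r s" "g \<in> B_hom q r" "h \<in> B_hom p q"
  shows "bcomp \<delta> (bcomp \<delta> f g) h = bcomp \<delta> f (bcomp \<delta> g h)"
proof -
  have 1: "bcomp \<delta> (bcomp \<delta> (basis a) (basis b)) (basis c) = bcomp \<delta> (basis a) (bcomp \<delta> (basis b) (basis c))"
    if "a \<in> diagrams r s" "b \<in> diagrams q r" "c \<in> diagrams p q" for a b c
    using loops_assoc[OF that] hat_comp_assoc[OF that]
    by (simp add: bcomp_basis lin_smul[OF lin_bcomp] lin_smul[OF lin_bcomp_left[OF lin_ident]]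
        flip: power_add) (simp add: add.commute)
  have 2: "bcomp \<delta> (bcomp \<delta> (basis a) (basis b)) h = bcomp \<delta> (basis a) (bcomp \<delta> (basis b) h)"
    if "a \<in> diagrams r s" "b \<in> diagrams q r" for a b
    using assms(3) unfolding B_hom_def
    by (rule lin_eq_on[rotated -1]) (use 1 that in auto)
  show ?thesis
    by (rule bilin_eq_on[where F = "\<lambda>f g. bcomp \<delta> (bcomp \<delta> f g) h" and
          G = "\<lambda>f g. bcomp \<delta> f (bcomp \<delta> g h)", OF _ _ _ _ 2 assms(1,2)[unfolded B_hom_def]])
      (intro lin_bcomp_left lin_bcomp_right lin_ident | assumption)+
qed

lemma bcomp_up_basis: "u \<in> up_diagrams q r \<Longrightarrow> g \<in> diagrams p q \<Longrightarrow>
    bcomp \<delta> (basis u) (basis g) = basis (hat_comp u g)"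
  and bcomp_down_basis: "f \<in> diagrams q r \<Longrightarrow> c \<in> down_diagrams p q \<Longrightarrow>
    bcomp \<delta> (basis f) (basis c) = basis (hat_comp f c)"
  by (simp_all add: bcomp_basis)

lemma bcomp_Bplus [intro]: "f \<in> Bplus q r \<Longrightarrow> g \<in> Bplus p q \<Longrightarrow> bcomp \<delta> f g \<in> Bplus p r"
  unfolding Bplus_def
  by (rule bilin_closed[of "bcomp \<delta>"]) (auto simp: bcomp_up_basis[OF _ up_diagramsD])

lemma bcomp_Bminus [intro]: "f \<in> Bminus q r \<Longrightarrow> g \<in> Bminus p q \<Longrightarrow> bcomp \<delta> f g \<in> Bminus p r"
  unfolding Bminus_def
  by (rule bilin_closed[of "bcomp \<delta>"]) (auto simp: bcomp_down_basis[OF down_diagramsD])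

lemma bcomp_S_hom [intro]: "f \<in> S_hom q r \<Longrightarrow> g \<in> S_hom p q \<Longrightarrow> bcomp \<delta> f g \<in> S_hom p r"
  unfolding S_hom_def
  by (rule bilin_closed[of "bcomp \<delta>"]) (auto simp: bcomp_up_basis[OF level_up level_diagramsD])

lemma one_mem [simp, intro]: "one p \<in> S_hom p p" "one p \<in> B_hom p p" "one p \<in> Bplus p p" "one p \<in> Bminus p p"
  by (simp_all add: one_def S_hom_def B_hom_def Bplus_def Bminus_def)

lemma bcomp_one_left: "f \<in> B_hom p q \<Longrightarrow> bcomp \<delta> (one q) f = f"
  unfolding B_hom_def
  by (rule lin_eq_on[where F = "bcomp \<delta> (one q)" and G = "\<lambda>x. x"])
    (auto simp: one_def bcomp_up_basis[OF id_level_diagram(2)] hat_comp_id_left)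

lemma bcomp_one_right: "f \<in> B_hom p q \<Longrightarrow> bcomp \<delta> f (one p) = f"
  unfolding B_hom_def
  by (rule lin_eq_on[where F = "\<lambda>f. bcomp \<delta> f (one p)" and G = "\<lambda>x. x"])
    (auto simp: one_def bcomp_down_basis[OF _ id_level_diagram(3)] hat_comp_id_right)

lemma basis_parts:
  assumes "f \<in> diagrams p q"
  shows "basis f = bcomp \<delta> (basis (plus_part f)) (basis (rest_part f))"
  using diagram_parts[OF assms] bcomp_up_basis[OF mono_up_up down_diagramsD] by metis

lemma basis_rest_part:
  assumes "f \<in> diagrams p q"
  shows "bcomp \<delta> (basis (zero_part f)) (basis (minus_part f)) = basis (rest_part f)"
  using diagram_parts[OF assms] bcomp_up_basis[OF level_up down_diagramsD] by metis

text \<open>Every diagram is a composite of an upward and a downward one. Testing on all such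
  composites, not only on normal forms, allows the formulas for tensors \<open>u\<close> \<otimes>
  \<open>c\<close> to be applied directly.\<close>

lemma B_hom_eqI:
  assumes "lin F" "lin G" "x \<in> B_hom p q"
    and "\<And>s u c. u \<in> up_diagrams s q \<Longrightarrow> c \<in> down_diagrams p s \<Longrightarrow>
      F (bcomp \<delta> (basis u) (basis c)) = G (bcomp \<delta> (basis u) (basis c))"
  shows "F x = G x"
proof (rule lin_eq_on[OF assms(1,2) _ assms(3)[unfolded B_hom_def]])
  fix f assume f: "f \<in> diagrams p q"
  show "F (basis f) = G (basis f)"
    unfolding basis_parts[OF f, of \<delta>] using diagram_parts[OF f] by (intro assms(4)) (auto intro: mono_up_up)
qed

lemma B_hom_closedI:
  assumes "lin F" "x \<in> B_hom p q"
    and "\<And>s u c. u \<in> up_diagrams s q \<Longrightarrow> c \<in> down_diagrams p s \<Longrightarrow>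
      F (bcomp \<delta> (basis u) (basis c)) \<in> free_on Y"
  shows "F x \<in> free_on Y"
proof (rule lin_closed[OF assms(1) _ assms(2)[unfolded B_hom_def]])
  fix f assume f: "f \<in> diagrams p q"
  show "F (basis f) \<in> free_on Y"
    unfolding basis_parts[OF f, of \<delta>] using diagram_parts[OF f] by (intro assms(3)) (auto intro: mono_up_up)
qed

lemma basis_mem [simp]:
  "basis f \<in> B_hom p q \<longleftrightarrow> f \<in> diagrams p q" "basis f \<in> Bplus p q \<longleftrightarrow> f \<in> up_diagrams p q"
  "basis f \<in> Bminus p q \<longleftrightarrow> f \<in> down_diagrams p q" "basis f \<in> S_hom p q \<longleftrightarrow> f \<in> level_diagrams p q"
  by (simp_all add: B_hom_def Bplus_def Bminus_def S_hom_def)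

text \<open>Well-definedness of maps out of the tensor product of \<open>Bplus\<close> and \<open>Bminus\<close> under its
  identification with \<open>B\<close>.\<close>

lemma balanced_ext:
  assumes "\<And>u. lin (\<Psi> u)" "\<And>c. lin (\<lambda>u. \<Psi> u c)"
    and bal: "\<And>u \<sigma> c. u \<in> up_diagrams s q \<Longrightarrow> \<sigma> \<in> level_diagrams s s \<Longrightarrow> c \<in> down_diagrams p s \<Longrightarrow>
      \<Psi> (bcomp \<delta> (basis u) (basis \<sigma>)) (basis c) = \<Psi> (basis u) (bcomp \<delta> (basis \<sigma>) (basis c))"
    and "u \<in> Bplus s q" "c \<in> Bminus p s"
  shows "lin_ext (\<lambda>f. \<Psi> (basis (plus_part f)) (basis (rest_part f))) (bcomp \<delta> u c) = \<Psi> u c"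
proof (rule bilin_eq_on[where F = "\<lambda>u c. lin_ext (\<lambda>f. \<Psi> (basis (plus_part f)) (basis (rest_part f))) (bcomp \<delta> u c)"
      and G = \<Psi>, OF _ _ assms(1,2) _ assms(4,5)[unfolded Bplus_def Bminus_def]])
  fix u c assume u: "u \<in> up_diagrams s q" and c: "c \<in> down_diagrams p s"
  let ?f = "hat_comp u c"
  obtain \<sigma> where \<sigma>: "plus_part ?f \<in> mono_up_diagrams s q" "\<sigma> \<in> level_diagrams s s"
    "u = hat_comp (plus_part ?f) \<sigma>" "rest_part ?f = hat_comp \<sigma> c" using comp_parts[OF u c] by metis
  have "lin_ext (\<lambda>f. \<Psi> (basis (plus_part f)) (basis (rest_part f))) (bcomp \<delta> (basis u) (basis c)) =
    \<Psi> (basis (plus_part ?f)) (basis (hat_comp \<sigma> c))"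
    using \<sigma>(4) by (simp add: bcomp_up_basis[OF u down_diagramsD[OF c]])
  also have "\<dots> = \<Psi> (basis (plus_part ?f)) (bcomp \<delta> (basis \<sigma>) (basis c))"
    by (simp add: bcomp_up_basis[OF level_up[OF \<sigma>(2)] down_diagramsD[OF c]])
  also have "\<dots> = \<Psi> (bcomp \<delta> (basis (plus_part ?f)) (basis \<sigma>)) (basis c)"
    using bal[OF mono_up_up[OF \<sigma>(1)] \<sigma>(2) c] by simp
  also have "bcomp \<delta> (basis (plus_part ?f)) (basis \<sigma>) = basis u"
    using bcomp_up_basis[OF mono_up_up[OF \<sigma>(1)] level_diagramsD[OF \<sigma>(2)]] \<sigma>(3) by metis
  finally show "lin_ext (\<lambda>f. \<Psi> (basis (plus_part f)) (basis (rest_part f))) (bcomp \<delta> (basis u) (basis c)) =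
    \<Psi> (basis u) (basis c)" .
qed (intro lin_intros)+

text \<open>The properties shared by \<open>b\<close> and \<open>b'\<close>: \<open>left\<close> and
  \<open>right\<close> are bimodule linearity, \<open>balanced\<close> is the descent to the tensor
  product over permutations. The results on \<open>pairing_comp\<close> are thereby available for
  both.\<close>

locale balanced_pairing =
  fixes \<delta> :: "'k::comm_ring_1" and \<beta> :: "'k mor \<Rightarrow> 'k mor \<Rightarrow> 'k mor"
  assumes lin_left_arg: "lin (\<lambda>v. \<beta> v w)"
    and lin_right_arg: "lin (\<beta> v)"
    and closed [intro]: "c \<in> Bminus q s \<Longrightarrow> w \<in> Bplus p q \<Longrightarrow> \<beta> c w \<in> S_hom p s"
    and right: "c \<in> Bminus q s \<Longrightarrow> w \<in> Bplus p q \<Longrightarrow> x \<in> S_hom r p \<Longrightarrow>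
      \<beta> c (bcomp \<delta> w x) = bcomp \<delta> (\<beta> c w) x"
    and left: "c \<in> Bminus q s \<Longrightarrow> w \<in> Bplus p q \<Longrightarrow> x \<in> S_hom s r \<Longrightarrow>
      \<beta> (bcomp \<delta> x c) w = bcomp \<delta> x (\<beta> c w)"
    and balanced: "c \<in> Bminus q s \<Longrightarrow> x \<in> S_hom r q \<Longrightarrow> w \<in> Bplus p r \<Longrightarrow>
      \<beta> (bcomp \<delta> c x) w = \<beta> c (bcomp \<delta> x w)"
begin

lemma lin_left [intro]: "lin F \<Longrightarrow> lin (\<lambda>x. \<beta> (F x) w)"
  using lin_left_arg[of w] by (simp add: lin_def)

lemma lin_right [intro]: "lin F \<Longrightarrow> lin (\<lambda>x. \<beta> v (F x))"
  using lin_right_arg[of v] by (simp add: lin_def)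

definition act :: "'k mor \<Rightarrow> 'k mor \<Rightarrow> 'k mor" where
  "act x w = lin_ext (\<lambda>f. bcomp \<delta> (basis (plus_part f)) (\<beta> (basis (rest_part f)) w)) x"

lemma lin_act_left [intro]: "lin F \<Longrightarrow> lin (\<lambda>x. act (F x) w)"
  unfolding act_def by auto

lemma lin_act_right [intro]: "lin F \<Longrightarrow> lin (\<lambda>x. act y (F x))"
  unfolding act_def lin_ext_def by (intro lin_sum_fun lin_smul_fun lin_bcomp_right lin_right)

text \<open>\<open>act\<close> is defined on normal forms; left linearity of the pairing makes the
  value independent of how a morphism is factored.\<close>

lemma act_comp:
  assumes "u \<in> Bplus s q" "c \<in> Bminus p s" "w \<in> Bplus t p"
  shows "act (bcomp \<delta> u c) w = bcomp \<delta> u (\<beta> c w)"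
  unfolding act_def
proof (rule balanced_ext[where \<Psi> = "\<lambda>u c. bcomp \<delta> u (\<beta> c w)", OF _ _ _ assms(1,2)])
  fix u \<sigma> c assume h: "u \<in> up_diagrams s q" "\<sigma> \<in> level_diagrams s s" "c \<in> down_diagrams p s"
  have "\<beta> (basis c) w \<in> S_hom t s" using h assms(3) by (auto intro: closed)
  then show "bcomp \<delta> (bcomp \<delta> (basis u) (basis \<sigma>)) (\<beta> (basis c) w) =
    bcomp \<delta> (basis u) (\<beta> (bcomp \<delta> (basis \<sigma>) (basis c)) w)"
    using h assms(3) left[of "basis c" p s w t "basis \<sigma>" s] bcomp_assoc[of "basis u" s q "basis \<sigma>" s "\<beta> (basis c) w" t \<delta>]
    by (auto dest: up_diagramsD level_diagramsD S_hom_B_hom)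
qed (intro lin_intros lin_left)+

lemma act_closed [intro]:
  assumes "x \<in> B_hom p q" "w \<in> Bplus t p" shows "act x w \<in> Bplus t q"
  unfolding Bplus_def
proof (rule B_hom_closedI[where F = "\<lambda>x. act x w", OF _ assms(1)])
  fix s u c assume h: "u \<in> up_diagrams s q" "c \<in> down_diagrams p s"
  then show "act (bcomp \<delta> (basis u) (basis c)) w \<in> free_on (up_diagrams t q)"
    using assms(2) bcomp_Bplus[of "basis u" s q "\<beta> (basis c) w" t \<delta>] S_hom_Bplus[OF closed[of "basis c" p s w t]]
    by (subst act_comp[of _ s q _ p _ t]) (auto simp: Bplus_def[symmetric])
qed (intro lin_act_left lin_ident)

text \<open>The definition of \<open>pairing_comp\<close> refers to normal forms, from which the
  given factors differ by permutations \<open>\<sigma>\<close> and \<open>\<tau>\<close>. Left and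
  right linearity of the pairing move these into place.\<close>

lemma pairing_comp_basis:
  assumes u: "u \<in> up_diagrams s r" and c: "c \<in> down_diagrams q s"
    and u': "u' \<in> up_diagrams t q" and c': "c' \<in> down_diagrams p t"
  shows "pairing_comp \<delta> \<beta> (bcomp \<delta> (basis u) (basis c)) (bcomp \<delta> (basis u') (basis c')) =
    bcomp \<delta> (basis u) (bcomp \<delta> (\<beta> (basis c) (basis u')) (basis c'))"
proof -
  let ?f = "hat_comp u c" and ?g = "hat_comp u' c'"
  obtain \<sigma> where \<sigma>: "plus_part ?f \<in> mono_up_diagrams s r" "\<sigma> \<in> level_diagrams s s"
    "u = hat_comp (plus_part ?f) \<sigma>" "rest_part ?f = hat_comp \<sigma> c" "through ?f = s" using comp_parts[OF u c] by metis
  obtain \<tau> where \<tau>: "plus_part ?g \<in> mono_up_diagrams t q" "\<tau> \<in> level_diagrams t t"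
    "u' = hat_comp (plus_part ?g) \<tau>" "rest_part ?g = hat_comp \<tau> c'" using comp_parts[OF u' c'] by metis
  have f: "?f \<in> diagrams q r" and g: "?g \<in> diagrams p q"
    using u c u' c' by (auto dest: up_diagramsD down_diagramsD)
  note pf = diagram_parts[OF f, unfolded \<sigma>(5)]
  let ?P = "basis (plus_part ?f) :: 'k mor" and ?Z = "basis (zero_part ?f) :: 'k mor"
    and ?M = "basis (minus_part ?f) :: 'k mor" and ?P' = "basis (plus_part ?g) :: 'k mor"
  have m: "?P \<in> Bplus s r" "?Z \<in> S_hom s s" "?M \<in> Bminus q s" "?P' \<in> Bplus t q"
    "basis \<sigma> \<in> S_hom s s" "basis \<tau> \<in> S_hom t t" "basis c \<in> Bminus q s" "basis c' \<in> Bminus p t"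
    using pf \<sigma> \<tau> c c' by (auto intro: mono_up_up)
  note mB = Bplus_B_hom[OF m(1)] S_hom_B_hom[OF m(2)] Bminus_B_hom[OF m(3)] Bplus_B_hom[OF m(4)]
    S_hom_B_hom[OF m(5)] S_hom_B_hom[OF m(6)] Bminus_B_hom[OF m(7)] Bminus_B_hom[OF m(8)]
  have b1: "\<beta> ?M ?P' \<in> S_hom t s" and b2: "\<beta> (basis c) ?P' \<in> S_hom t s"
    using m by (auto intro: closed)
  note b1B = S_hom_B_hom[OF b1] and b2B = S_hom_B_hom[OF b2]
  have 1: "bcomp \<delta> ?Z (\<beta> ?M ?P') = bcomp \<delta> (basis \<sigma>) (\<beta> (basis c) ?P')"
  proof -
    have "bcomp \<delta> ?Z (\<beta> ?M ?P') = \<beta> (bcomp \<delta> ?Z ?M) ?P'" using left[OF m(3,4,2)] by simp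
    also have "bcomp \<delta> ?Z ?M = bcomp \<delta> (basis \<sigma>) (basis c)"
      using basis_rest_part[OF f] bcomp_up_basis[OF level_up[OF \<sigma>(2)] down_diagramsD[OF c]] \<sigma>(4) by metis
    also have "\<beta> (bcomp \<delta> (basis \<sigma>) (basis c)) ?P' = bcomp \<delta> (basis \<sigma>) (\<beta> (basis c) ?P')"
      using left[OF m(7,4,5)] by simp
    finally show ?thesis .
  qed
  have 2: "bcomp \<delta> (basis (zero_part ?g)) (basis (minus_part ?g)) = bcomp \<delta> (basis \<tau>) (basis c')"
    using basis_rest_part[OF g] bcomp_up_basis[OF level_up[OF \<tau>(2)] down_diagramsD[OF c']] \<tau>(4) by metis
  have 3: "bcomp \<delta> ?P (basis \<sigma>) = basis u"
    using bcomp_up_basis[OF mono_up_up[OF \<sigma>(1)] level_diagramsD[OF \<sigma>(2)]] \<sigma>(3) by metis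
  have 4: "bcomp \<delta> ?P' (basis \<tau>) = basis u'"
    using bcomp_up_basis[OF mono_up_up[OF \<tau>(1)] level_diagramsD[OF \<tau>(2)]] \<tau>(3) by metis
  have "pairing_comp \<delta> \<beta> (bcomp \<delta> (basis u) (basis c)) (bcomp \<delta> (basis u') (basis c')) =
    bcomp \<delta> (bcomp \<delta> (bcomp \<delta> ?P ?Z) (\<beta> ?M ?P'))
      (bcomp \<delta> (basis (zero_part ?g)) (basis (minus_part ?g)))"
    by (simp add: pairing_comp_def bcomp_up_basis[OF u down_diagramsD[OF c]] bcomp_up_basis[OF u' down_diagramsD[OF c']])
  also have "\<dots> = bcomp \<delta> (bcomp \<delta> ?P (bcomp \<delta> (basis \<sigma>) (\<beta> (basis c) ?P'))) (bcomp \<delta> (basis \<tau>) (basis c'))"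
    unfolding 2 using bcomp_assoc[where \<delta> = \<delta>, OF mB(1,2) b1B] 1 by simp
  also have "\<dots> = bcomp \<delta> (bcomp \<delta> (basis u) (\<beta> (basis c) ?P')) (bcomp \<delta> (basis \<tau>) (basis c'))"
    using bcomp_assoc[where \<delta> = \<delta>, OF mB(1,5) b2B] 3 by simp
  also have "\<dots> = bcomp \<delta> (basis u) (bcomp \<delta> (\<beta> (basis c) ?P') (bcomp \<delta> (basis \<tau>) (basis c')))"
    using bcomp_assoc[where \<delta> = \<delta>, of "basis u" s r, OF _ b2B bcomp_closed[OF mB(6,8)]] up_diagramsD[OF u] by simp
  also have "bcomp \<delta> (\<beta> (basis c) ?P') (bcomp \<delta> (basis \<tau>) (basis c')) =
    bcomp \<delta> (bcomp \<delta> (\<beta> (basis c) ?P') (basis \<tau>)) (basis c')"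
    using bcomp_assoc[where \<delta> = \<delta>, OF b2B mB(6,8)] by simp
  also have "bcomp \<delta> (\<beta> (basis c) ?P') (basis \<tau>) = \<beta> (basis c) (basis u')"
    using right[OF m(7,4,6)] 4 by simp
  finally show ?thesis .
qed

lemma pairing_comp_comp:
  assumes "u \<in> Bplus s r" "c \<in> Bminus q s" "u' \<in> Bplus t q" "c' \<in> Bminus p t"
  shows "pairing_comp \<delta> \<beta> (bcomp \<delta> u c) (bcomp \<delta> u' c') = bcomp \<delta> u (bcomp \<delta> (\<beta> c u') c')"
proof -
  have "pairing_comp \<delta> \<beta> (bcomp \<delta> u c) (bcomp \<delta> (basis a) (basis b)) =
    bcomp \<delta> u (bcomp \<delta> (\<beta> c (basis a)) (basis b))" if "a \<in> up_diagrams t q" "b \<in> down_diagrams p t" for a b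
    by (rule bilin_eq_on[where F = "\<lambda>u c. pairing_comp \<delta> \<beta> (bcomp \<delta> u c) (bcomp \<delta> (basis a) (basis b))"
          and G = "\<lambda>u c. bcomp \<delta> u (bcomp \<delta> (\<beta> c (basis a)) (basis b))",
          OF _ _ _ _ pairing_comp_basis[OF _ _ that] assms(1,2)[unfolded Bplus_def Bminus_def]])
      (intro lin_intros lin_left | assumption)+
  then show ?thesis
    by (rule bilin_eq_on[where F = "\<lambda>u' c'. pairing_comp \<delta> \<beta> (bcomp \<delta> u c) (bcomp \<delta> u' c')"
          and G = "\<lambda>u' c'. bcomp \<delta> u (bcomp \<delta> (\<beta> c u') c')",
          OF _ _ _ _ _ assms(3,4)[unfolded Bplus_def Bminus_def], rotated 4])
      (intro lin_intros lin_right | assumption)+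
qed

lemma pairing_comp_closed [intro]:
  assumes "x \<in> B_hom q r" "y \<in> B_hom p q" shows "pairing_comp \<delta> \<beta> x y \<in> B_hom p r"
proof -
  have "pairing_comp \<delta> \<beta> (bcomp \<delta> (basis u) (basis c)) y \<in> free_on (diagrams p r)"
    if uc: "u \<in> up_diagrams s r" "c \<in> down_diagrams q s" for s u c
  proof (rule B_hom_closedI[where F = "pairing_comp \<delta> \<beta> (bcomp \<delta> (basis u) (basis c))", OF _ assms(2)])
    fix t u' c' assume uc': "u' \<in> up_diagrams t q" "c' \<in> down_diagrams p t"
    have "\<beta> (basis c) (basis u') \<in> B_hom t s" using uc uc' by (auto intro!: S_hom_B_hom closed)
    then show "pairing_comp \<delta> \<beta> (bcomp \<delta> (basis u) (basis c)) (bcomp \<delta> (basis u') (basis c')) \<in> free_on (diagrams p r)"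
      unfolding pairing_comp_basis[OF uc uc'] B_hom_def[symmetric] using uc uc'
      by (intro bcomp_closed) (auto intro: up_diagramsD down_diagramsD)
  qed (intro lin_intros)
  then show ?thesis unfolding B_hom_def
    by (rule B_hom_closedI[where F = "\<lambda>x. pairing_comp \<delta> \<beta> x y", OF _ assms(1), rotated])
      (intro lin_intros | assumption)+
qed

text \<open>For \<open>x\<close> = \<open>u\<close> \<otimes> \<open>c\<close> and \<open>y\<close>
  = \<open>u'\<close> \<otimes> \<open>c'\<close> both sides equal \<open>u\<close>
  \<beta>(\<open>c\<close>, \<open>u'\<close>) \<beta>(\<open>c'\<close>, \<open>w\<close>), by left
  linearity on one side and right linearity on the other.\<close>

lemma act_pairing_comp:
  assumes x: "x \<in> B_hom q r" and y: "y \<in> B_hom p q" and w: "w \<in> Bplus t p"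
  shows "act (pairing_comp \<delta> \<beta> x y) w = act x (act y w)"
proof -
  have "act (pairing_comp \<delta> \<beta> (bcomp \<delta> (basis u) (basis c)) y) w = act (bcomp \<delta> (basis u) (basis c)) (act y w)"
    if u: "u \<in> up_diagrams s r" and c: "c \<in> down_diagrams q s" for s u c
  proof (rule B_hom_eqI[where F = "\<lambda>y. act (pairing_comp \<delta> \<beta> (bcomp \<delta> (basis u) (basis c)) y) w"
        and G = "\<lambda>y. act (bcomp \<delta> (basis u) (basis c)) (act y w)", OF _ _ y])
    fix z u' c' assume u': "u' \<in> up_diagrams z q" and c': "c' \<in> down_diagrams p z"
    have m: "basis u \<in> Bplus s r" "basis c \<in> Bminus q s" "basis u' \<in> Bplus z q" "basis c' \<in> Bminus p z"
      using u c u' c' by auto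
    note b = closed[OF m(2,3)] closed[OF m(4) w]
    have "act (pairing_comp \<delta> \<beta> (bcomp \<delta> (basis u) (basis c)) (bcomp \<delta> (basis u') (basis c'))) w =
      act (bcomp \<delta> (basis u) (bcomp \<delta> (\<beta> (basis c) (basis u')) (basis c'))) w"
      using pairing_comp_basis[OF u c u' c'] by simp
    also have "\<dots> = bcomp \<delta> (basis u) (\<beta> (bcomp \<delta> (\<beta> (basis c) (basis u')) (basis c')) w)"
      using m b by (intro act_comp[OF _ _ w]) (auto intro: S_hom_Bminus)
    also have "\<beta> (bcomp \<delta> (\<beta> (basis c) (basis u')) (basis c')) w = bcomp \<delta> (\<beta> (basis c) (basis u')) (\<beta> (basis c') w)"
      by (rule left[OF m(4) w b(1)])
    also have "\<dots> = \<beta> (basis c) (bcomp \<delta> (basis u') (\<beta> (basis c') w))"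
      by (rule right[OF m(2,3) b(2), symmetric])
    also have "bcomp \<delta> (basis u) \<dots> = act (bcomp \<delta> (basis u) (basis c)) (bcomp \<delta> (basis u') (\<beta> (basis c') w))"
      using m b by (intro act_comp[symmetric]) (auto intro: S_hom_Bplus)
    also have "bcomp \<delta> (basis u') (\<beta> (basis c') w) = act (bcomp \<delta> (basis u') (basis c')) w"
      by (rule act_comp[symmetric, OF m(3,4) w])
    finally show "act (pairing_comp \<delta> \<beta> (bcomp \<delta> (basis u) (basis c)) (bcomp \<delta> (basis u') (basis c'))) w =
      act (bcomp \<delta> (basis u) (basis c)) (act (bcomp \<delta> (basis u') (basis c')) w)" .
  qed (intro lin_act_left lin_act_right lin_pairing_comp_right lin_ident)+
  then show ?thesis
    by (intro B_hom_eqI[where F = "\<lambda>x. act (pairing_comp \<delta> \<beta> x y) w" and G = "\<lambda>x. act x (act y w)", OF _ _ x])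
      (intro lin_act_left lin_intros | assumption)+
qed

end

section \<open>Linear categories and the pairings \<open>b\<close> and \<open>b'\<close>\<close>

lemma B_hom_category:
  fixes C :: "'k::comm_ring_1 mor \<Rightarrow> 'k mor \<Rightarrow> 'k mor"
  assumes "\<And>w. lin (\<lambda>v. C v w)" "\<And>v. lin (C v)"
    and "\<And>p q r f g. f \<in> B_hom q r \<Longrightarrow> g \<in> B_hom p q \<Longrightarrow> C f g \<in> B_hom p r"
    and "\<And>p. I p \<in> B_hom p p"
    and "\<And>p q r s f g h. f \<in> B_hom r s \<Longrightarrow> g \<in> B_hom q r \<Longrightarrow> h \<in> B_hom p q \<Longrightarrow> C (C f g) h = C f (C g h)"
    and "\<And>p q f. f \<in> B_hom p q \<Longrightarrow> C (I q) f = f"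
    and "\<And>p q f. f \<in> B_hom p q \<Longrightarrow> C f (I p) = f"
  shows "linear_category \<lparr>Hom = B_hom, Comp = C, Ident = I\<rparr>"
proof
  show "Modules.module.subspace smul (Hom \<lparr>Hom = B_hom, Comp = C, Ident = I\<rparr> p q)" for p q
    unfolding lin_cat.simps B_hom_def by (rule free_on_subspace)
qed (use assms lin_add[OF assms(1)] lin_add[OF assms(2)] lin_smul[OF assms(1)] lin_smul[OF assms(2)] in simp_all)

text \<open>Only the target is assumed to be a category: applying the injective \<open>F\<close> to
  a law of the source turns it into a law of the target.\<close>

lemma B_hom_category_iso:
  fixes C D :: "'k::comm_ring_1 mor \<Rightarrow> 'k mor \<Rightarrow> 'k mor"
  assumes D: "linear_category \<lparr>Hom = B_hom, Comp = D, Ident = J\<rparr>"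
    and linC: "\<And>w. lin (\<lambda>v. C v w)" "\<And>v. lin (C v)"
    and closed: "\<And>p q r f g. f \<in> B_hom q r \<Longrightarrow> g \<in> B_hom p q \<Longrightarrow> C f g \<in> B_hom p r"
    and I: "\<And>p. I p \<in> B_hom p p"
    and linF: "\<And>p q. lin (F p q)"
    and bij: "\<And>p q. bij_betw (F p q) (B_hom p q) (B_hom p q)"
    and F_comp: "\<And>p q r f g. f \<in> B_hom q r \<Longrightarrow> g \<in> B_hom p q \<Longrightarrow> F p r (C f g) = D (F q r f) (F p q g)"
    and F_id: "\<And>p. F p p (I p) = J p"
  shows "linear_category_iso \<lparr>Hom = B_hom, Comp = C, Ident = I\<rparr> \<lparr>Hom = B_hom, Comp = D, Ident = J\<rparr> F"
proof -
  interpret D: linear_category "\<lparr>Hom = B_hom, Comp = D, Ident = J\<rparr>" by (rule D)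
  have inj: "x = y" if "F p q x = F p q y" "x \<in> B_hom p q" "y \<in> B_hom p q" for p q and x y :: "'k mor"
    using bij[of p q] that by (auto simp: bij_betw_def inj_on_def)
  have mem: "F p q x \<in> B_hom p q" if "x \<in> B_hom p q" for p q and x :: "'k mor"
    using bij[of p q] that by (auto simp: bij_betw_def)
  have C: "linear_category \<lparr>Hom = B_hom, Comp = C, Ident = I\<rparr>"
  proof (rule B_hom_category[OF linC closed I])
    fix p q r s and f g h :: "'k mor" assume h: "f \<in> B_hom r s" "g \<in> B_hom q r" "h \<in> B_hom p q"
    note c = closed[OF h(1,2)] closed[OF h(2,3)]
    have "F p s (C (C f g) h) = F p s (C f (C g h))"
      using D.Comp_assoc[of "F p q h" p q "F q r g" r "F r s f" s] mem h
      by (simp add: F_comp[OF c(1) h(3)] F_comp[OF h(1,2)] F_comp[OF h(1) c(2)] F_comp[OF h(2,3)])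
    then show "C (C f g) h = C f (C g h)" using inj closed[OF c(1) h(3)] closed[OF h(1) c(2)] by blast
  next
    fix p q and f :: "'k mor" assume f: "f \<in> B_hom p q"
    have "F p q (C (I q) f) = F p q f"
      using D.Ident_left[of "F p q f" p q] mem[OF f] by (simp add: F_comp[OF I f] F_id)
    then show "C (I q) f = f" using inj closed[OF I f] f by blast
    have "F p q (C f (I p)) = F p q f"
      using D.Ident_right[of "F p q f" p q] mem[OF f] by (simp add: F_comp[OF f I] F_id)
    then show "C f (I p) = f" using inj closed[OF f I] f by blast
  qed
  show ?thesis
    by (intro linear_category_iso.intro linear_category_iso_axioms.intro C D)
      (use bij F_comp F_id lin_add[OF linF] lin_smul[OF linF] in simp_all)
qed

lemma linear_category_iso_inverse:
  assumes "linear_category_iso C D F"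
  shows "linear_category_iso D C (inv_functor C F)"
proof -
  interpret F: linear_category_iso C D F by (rule assms)
  let ?G = "inv_functor C F"
  have FG: "F p q (?G p q y) = y" and G: "?G p q y \<in> Hom C p q" if "y \<in> Hom D p q" for p q y
    using F.F_bij[of p q] that
    by (auto simp: inv_functor_def bij_betw_def f_inv_into_f inv_into_into)
  have GF: "?G p q (F p q x) = x" if "x \<in> Hom C p q" for p q x
    using F.F_bij[of p q] that by (auto simp: inv_functor_def bij_betw_def)
  note sub = F.source.Hom_submodule
  have add: "x + y \<in> Hom C p q" and sm: "smul c x \<in> Hom C p q" if "x \<in> Hom C p q" "y \<in> Hom C p q" for x y c p q
    using sub[of p q] that by (auto simp: Modules.module.subspace_def[OF module_smul])
  show ?thesis
  proof (intro linear_category_iso.intro linear_category_iso_axioms.intro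
      F.source.linear_category_axioms F.target.linear_category_axioms)
    show "bij_betw (?G p q) (Hom D p q) (Hom C p q)" for p q
      unfolding inv_functor_def by (rule bij_betw_inv_into[OF F.F_bij])
    show "?G p q (f + g) = ?G p q f + ?G p q g" if "f \<in> Hom D p q" "g \<in> Hom D p q" for p q f g
      using GF[OF add[OF G G], of f p q g] that by (simp add: F.F_add G FG)
    show "?G p q (smul c f) = smul c (?G p q f)" if "f \<in> Hom D p q" for p q c f
      using GF[OF sm[OF G G], of f p q f c] that by (simp add: F.F_smul G FG)
    show "?G p r (Comp D f g) = Comp C (?G q r f) (?G p q g)" if "g \<in> Hom D p q" "f \<in> Hom D q r" for p q r f g
      using GF[OF F.source.Comp_closed[OF G[OF that(1)] G[OF that(2)]]] that
      by (simp add: F.F_Comp[OF G[OF that(1)] G[OF that(2)]] FG)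
    show "?G p p (Ident D p) = Ident C p" for p
      using GF[OF F.source.Ident_closed[of p]] by (simp add: F.F_Ident)
  qed
qed

text \<open>\<open>F\<close> minus the identity lowers the rank \<open>r\<close>, hence is nilpotent
  on a finite basis. Kernel and image are determined by induction on a bound for the rank.\<close>

lemma triangular_bij:
  fixes r :: "'a \<Rightarrow> nat"
  assumes X: "finite X" and l: "lin F"
    and tri: "\<And>f. f \<in> X \<Longrightarrow> F (basis f) - basis f \<in> free_on {g \<in> X. r g < r f}"
  shows "bij_betw F (free_on X) (free_on X)"
proof -
  have step: "F v - v \<in> free_on {g \<in> X. r g < n}" if "v \<in> free_on {g \<in> X. r g < Suc n}" for v n
  proof (rule lin_closed[OF _ _ that])
    show "lin (\<lambda>v. F v - v)" using l by (auto intro!: linI simp: lin_add lin_smul diff_smul mult.commute)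
    fix f assume "f \<in> {g \<in> X. r g < Suc n}"
    then show "F (basis f) - basis f \<in> free_on {g \<in> X. r g < n}"
      using tri[of f] by (auto elim!: free_on_mono[rotated])
  qed
  have inj: "v = 0" if "v \<in> free_on {g \<in> X. r g < n}" "F v = 0" for v n
    using that
  proof (induction n arbitrary: v)
    case 0 then show ?case by (simp add: free_on_def)
  next
    case (Suc n)
    have "smul (- 1) (F v - v) \<in> free_on {g \<in> X. r g < n}" using step[OF Suc.prems(1)] by blast
    then have "v \<in> free_on {g \<in> X. r g < n}" using Suc.prems(2) by (simp add: diff_smul)
    then show ?case using Suc by blast
  qed
  have surj: "\<exists>w\<in>free_on {g \<in> X. r g < n}. F w = v" if "v \<in> free_on {g \<in> X. r g < n}" for v n
    using that
  proof (induction n arbitrary: v)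
    case 0 then show ?case using lin_zero[OF l] by (simp add: free_on_def)
  next
    case (Suc n)
    \<comment> \<open>The error \<open>F v - v\<close> has smaller rank and is hit by some
      \<open>w\<close>; subtracting \<open>w\<close> from \<open>v\<close> corrects it.\<close>
    obtain w where w: "w \<in> free_on {g \<in> X. r g < n}" "F w = F v - v" using Suc.IH[OF step[OF Suc.prems]] by blast
    have "w \<in> free_on {g \<in> X. r g < Suc n}" by (rule free_on_mono[OF _ w(1)]) auto
    then have "v - w \<in> free_on {g \<in> X. r g < Suc n}" using Suc.prems by blast
    moreover have "F (v - w) = v" using w lin_diff[OF l] by simp
    ultimately show ?case by blast
  qed
  obtain n where n: "\<And>f. f \<in> X \<Longrightarrow> r f < n"
    using finite_nat_set_iff_bounded[of "r ` X"] X by blast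
  then have Xn: "{g \<in> X. r g < n} = X" by auto
  have "inj_on F (free_on X)"
  proof (rule inj_onI)
    fix x y assume "x \<in> free_on X" "y \<in> free_on X" "F x = F y"
    then have "x - y = 0" using inj[of "x - y" n] Xn lin_diff[OF l, of x y] by auto
    then show "x = y" by simp
  qed
  moreover have "F ` free_on X = free_on X"
  proof
    show "F ` free_on X \<subseteq> free_on X"
    proof (rule image_subsetI, rule lin_closed[OF l])
      fix f assume f: "f \<in> X"
      have "F (basis f) - basis f \<in> free_on X" using tri[OF f] by (rule free_on_mono[rotated]) auto
      then have "(F (basis f) - basis f) + basis f \<in> free_on X" using f by (intro free_on_add) auto
      then show "F (basis f) \<in> free_on X" by simp
    qed
    show "free_on X \<subseteq> F ` free_on X" using surj[of _ n] Xn by auto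
  qed
  ultimately show ?thesis by (simp add: bij_betw_def)
qed

text \<open>Level diagrams exist only between equal numbers of points. In sums over through numbers
  this leaves a single term.\<close>

lemma S_hom_neq: "x \<in> S_hom p q \<Longrightarrow> p \<noteq> q \<Longrightarrow> x = 0"
  using level_diagrams_eq unfolding S_hom_def free_on_def
  by (metis (no_types, lifting) ex_in_conv keys_eq_empty mem_Collect_eq subsetD)

section \<open>The pairing \<open>b\<close>\<close>

lemma upward_comp_level:
  assumes "f \<in> diagrams p q" "x \<in> level_diagrams p p"
  shows "upward (hat_comp f x) \<longleftrightarrow> upward f"
proof
  note x = level_diagramsD[OF assms(2)]
  have c: "hat_comp f x \<in> diagrams p q" using assms x by blast
  assume "upward (hat_comp f x)"
  then have "hat_comp (hat_comp f x) (bar x) \<in> up_diagrams p q"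
    using c assms(2) by (intro up_comp[of "hat_comp f x" p]) (auto simp: up_diagrams_def level_diagrams_def level_def)
  moreover have "hat_comp (hat_comp f x) (bar x) = f"
    using hat_comp_assoc[OF assms(1) x bar_closed[OF x]] level_inverse[OF assms(2)] hat_comp_id_right[OF assms(1)] by simp
  ultimately show "upward f" by (simp add: up_diagrams_def)
next
  assume "upward f"
  then have "hat_comp f x \<in> up_diagrams p q"
    using assms by (intro up_comp[of f p]) (auto simp: up_diagrams_def level_diagrams_def level_def)
  then show "upward (hat_comp f x)" by (simp add: up_diagrams_def)
qed

lemma downward_comp_level:
  assumes "f \<in> diagrams p q" "x \<in> level_diagrams q q"
  shows "downward (hat_comp x f) \<longleftrightarrow> downward f"
  using upward_comp_level[of "bar f" q p "bar x"] assms hat_comp_bar[OF level_diagramsD[OF assms(2)] assms(1)]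
  by (metis bar_mem(1,4) upward_bar)

lemma level_comp_iff:
  assumes "f \<in> diagrams p q"
  shows "x \<in> level_diagrams p p \<Longrightarrow> level (hat_comp f x) \<longleftrightarrow> level f"
    "x \<in> level_diagrams q q \<Longrightarrow> level (hat_comp x f) \<longleftrightarrow> level f"
  using upward_comp_level[OF assms] down_comp_iff[OF assms level_down]
    downward_comp_level[OF assms] up_comp_iff[OF level_up assms]
  by (auto simp: level_def)

lemma pair_b_basis: "pair_b \<delta> (basis c) (basis w) =
    (if level (hat_comp c w) then smul (\<delta> ^ loops c w) (basis (hat_comp c w)) else 0)"
  by (simp add: pair_b_def comp_diagrams_def)

text \<open>Multiplication by a permutation creates no loops and does not affect being level, so the
  three laws reduce to associativity of stacking and the loop cocycle.\<close>

lemma pair_b_balanced: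
  fixes \<delta> :: "'k::comm_ring_1"
  shows "balanced_pairing \<delta> (pair_b \<delta>)"
proof
  show "lin (\<lambda>v. pair_b \<delta> v w)" "lin (pair_b \<delta> v)" for v w by (intro lin_intros)+
next
  fix c w :: "'k mor" and q s p assume "c \<in> Bminus q s" "w \<in> Bplus p q"
  then show "pair_b \<delta> c w \<in> S_hom p s" unfolding Bminus_def Bplus_def S_hom_def
  proof (rule bilin_closed[rotated -2])
    fix a b assume "a \<in> down_diagrams q s" "b \<in> up_diagrams p q"
    then have "hat_comp a b \<in> diagrams p s" by (auto dest: up_diagramsD down_diagramsD)
    then show "pair_b \<delta> (basis a) (basis b) \<in> free_on (level_diagrams p s)"
      unfolding pair_b_basis by (auto simp: level_diagrams_def intro!: free_on_smul)
  qed (intro lin_intros)+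
next
  have *: "pair_b \<delta> (basis c) (bcomp \<delta> (basis w) (basis x)) = bcomp \<delta> (pair_b \<delta> (basis c) (basis w)) (basis x)"
    if "c \<in> down_diagrams q s" "w \<in> up_diagrams p q" "x \<in> level_diagrams r p" for c w x q s p r
  proof -
    have rp: "r = p" using level_diagrams_eq that by blast
    note d = down_diagramsD[OF that(1)] up_diagramsD[OF that(2)] level_diagramsD[OF that(3)]
    have cw: "hat_comp c w \<in> diagrams p s" using d by blast
    show ?thesis
      using loops_assoc[OF d] hat_comp_assoc[OF d] level_comp_iff(1)[OF cw, of x] that(3) rp
        loops_down[OF d(2) level_down[OF that(3)]] loops_down[OF cw level_down[OF that(3)]]
      by (simp add: bcomp_down_basis[OF d(2) level_down[OF that(3)]] pair_b_basis
          lin_smul[OF lin_bcomp_left[OF lin_ident]] lin_zero[OF lin_bcomp_left[OF lin_ident]]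
          bcomp_down_basis[OF cw level_down[OF that(3)]])
  qed
  fix c w x :: "'k mor" and q s p r assume m: "c \<in> Bminus q s" "w \<in> Bplus p q" "x \<in> S_hom r p"
  have "pair_b \<delta> c (bcomp \<delta> (basis w) (basis x)) = bcomp \<delta> (pair_b \<delta> c (basis w)) (basis x)"
    if "w \<in> up_diagrams p q" "x \<in> level_diagrams r p" for w x
    by (rule lin_eq_on[where F = "\<lambda>c. pair_b \<delta> c (bcomp \<delta> (basis w) (basis x))", OF _ _ *[OF _ that]
          m(1)[unfolded Bminus_def]]) (intro lin_intros | assumption)+
  then show "pair_b \<delta> c (bcomp \<delta> w x) = bcomp \<delta> (pair_b \<delta> c w) x"
    by (rule bilin_eq_on[where F = "\<lambda>w x. pair_b \<delta> c (bcomp \<delta> w x)" and G = "\<lambda>w x. bcomp \<delta> (pair_b \<delta> c w) x",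
          OF _ _ _ _ _ m(2,3)[unfolded Bplus_def S_hom_def], rotated 4]) (intro lin_intros | assumption)+
next
  have *: "pair_b \<delta> (bcomp \<delta> (basis x) (basis c)) (basis w) = bcomp \<delta> (basis x) (pair_b \<delta> (basis c) (basis w))"
    if "x \<in> level_diagrams s r" "c \<in> down_diagrams q s" "w \<in> up_diagrams p q" for c w x q s p r
  proof -
    have rp: "r = s" using level_diagrams_eq that by blast
    note d = level_diagramsD[OF that(1)] down_diagramsD[OF that(2)] up_diagramsD[OF that(3)]
    have cw: "hat_comp c w \<in> diagrams p s" using d by blast
    show ?thesis
      using loops_assoc[OF d] hat_comp_assoc[OF d] level_comp_iff(2)[OF cw, of x] that(1) rp
        loops_up[OF level_up[OF that(1)] d(2)] loops_up[OF level_up[OF that(1)] cw]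
      by (simp add: bcomp_up_basis[OF level_up[OF that(1)] d(2)] pair_b_basis
          lin_smul[OF lin_bcomp] lin_zero[OF lin_bcomp]
          bcomp_up_basis[OF level_up[OF that(1)] cw])
  qed
  fix c w x :: "'k mor" and q s p r assume m: "c \<in> Bminus q s" "w \<in> Bplus p q" "x \<in> S_hom s r"
  have "pair_b \<delta> (bcomp \<delta> (basis x) (basis c)) w = bcomp \<delta> (basis x) (pair_b \<delta> (basis c) w)"
    if "x \<in> level_diagrams s r" "c \<in> down_diagrams q s" for x c
    by (rule lin_eq_on[where F = "\<lambda>w. pair_b \<delta> (bcomp \<delta> (basis x) (basis c)) w", OF _ _ *[OF that]
          m(2)[unfolded Bplus_def]]) (intro lin_intros | assumption)+
  then show "pair_b \<delta> (bcomp \<delta> x c) w = bcomp \<delta> x (pair_b \<delta> c w)"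
    by (rule bilin_eq_on[where F = "\<lambda>x c. pair_b \<delta> (bcomp \<delta> x c) w" and G = "\<lambda>x c. bcomp \<delta> x (pair_b \<delta> c w)",
          OF _ _ _ _ _ m(3,1)[unfolded Bminus_def S_hom_def], rotated 4]) (intro lin_intros | assumption)+
next
  have *: "pair_b \<delta> (bcomp \<delta> (basis c) (basis x)) (basis w) = pair_b \<delta> (basis c) (bcomp \<delta> (basis x) (basis w))"
    if "c \<in> down_diagrams q s" "x \<in> level_diagrams r q" "w \<in> up_diagrams p r" for c w x q s p r
  proof -
    note d = down_diagramsD[OF that(1)] level_diagramsD[OF that(2)] up_diagramsD[OF that(3)]
    show ?thesis
      using loops_assoc[OF d] hat_comp_assoc[OF d]
        loops_up[OF level_up[OF that(2)] d(3)] loops_down[OF d(1) level_down[OF that(2)]]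
      by (simp add: bcomp_up_basis[OF level_up[OF that(2)] d(3)] bcomp_down_basis[OF d(1) level_down[OF that(2)]]
          pair_b_basis)
  qed
  fix c w x :: "'k mor" and q s p r assume m: "c \<in> Bminus q s" "x \<in> S_hom r q" "w \<in> Bplus p r"
  have "pair_b \<delta> (bcomp \<delta> (basis c) (basis x)) w = pair_b \<delta> (basis c) (bcomp \<delta> (basis x) w)"
    if "c \<in> down_diagrams q s" "x \<in> level_diagrams r q" for x c
    by (rule lin_eq_on[where F = "\<lambda>w. pair_b \<delta> (bcomp \<delta> (basis c) (basis x)) w", OF _ _ *[OF that]
          m(3)[unfolded Bplus_def]]) (intro lin_intros | assumption)+
  then show "pair_b \<delta> (bcomp \<delta> c x) w = pair_b \<delta> c (bcomp \<delta> x w)"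
    by (rule bilin_eq_on[where F = "\<lambda>c x. pair_b \<delta> (bcomp \<delta> c x) w" and G = "\<lambda>c x. pair_b \<delta> c (bcomp \<delta> x w)",
          OF _ _ _ _ _ m(1,2)[unfolded Bminus_def S_hom_def], rotated 4]) (intro lin_intros | assumption)+
qed

interpretation b: balanced_pairing \<delta> "pair_b \<delta>" for \<delta>
  by (rule pair_b_balanced)

section \<open>The pairing \<open>b'\<close>\<close>

lemma b'_factor_iff:
  assumes "w \<in> up_diagrams p q"
  shows "b'_factor c w \<sigma> \<longleftrightarrow> \<sigma> \<in> level_diagrams p p \<and> c = hat_comp \<sigma> (bar w)"
proof
  assume "b'_factor c w \<sigma>"
  then obtain p' q' where "w \<in> up_diagrams p' q'" "\<sigma> \<in> level_diagrams p' p'" "c = hat_comp \<sigma> (bar w)"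
    by (auto simp: b'_factor_def)
  then show "\<sigma> \<in> level_diagrams p p \<and> c = hat_comp \<sigma> (bar w)"
    using diagrams_inj[OF up_diagramsD up_diagramsD, OF assms] by blast
qed (use assms in \<open>auto simp: b'_factor_def\<close>)

lemma bar_cancel_right:
  assumes "w \<in> up_diagrams p q" "\<sigma> \<in> diagrams p r" shows "hat_comp (hat_comp \<sigma> (bar w)) w = \<sigma>"
  using hat_comp_assoc[OF assms(2) bar_closed[OF up_diagramsD[OF assms(1)]] up_diagramsD[OF assms(1)]]
    bar_comp_up[OF assms(1)] hat_comp_id_right[OF assms(2)] by simp

lemma pair_b'_eq:
  assumes "w \<in> up_diagrams p q" "\<sigma> \<in> level_diagrams p p"
  shows "pair_b' (basis (hat_comp \<sigma> (bar w))) (basis w) = basis \<sigma>"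
proof -
  have "b'_factor (hat_comp \<sigma> (bar w)) w \<tau> \<longleftrightarrow> \<tau> = \<sigma>" for \<tau>
    unfolding b'_factor_iff[OF assms(1)]
    using assms bar_cancel_right[OF assms(1) level_diagramsD] by metis
  then have "b'_factor (hat_comp \<sigma> (bar w)) w = (\<lambda>\<tau>. \<tau> = \<sigma>)" by (intro ext)
  then show ?thesis by (simp add: pair_b'_def)
qed

lemma pair_b'_zero:
  assumes "w \<in> up_diagrams p q" "\<And>\<sigma>. \<sigma> \<in> level_diagrams p p \<Longrightarrow> c \<noteq> hat_comp \<sigma> (bar w)"
  shows "pair_b' (basis c) (basis w) = 0"
proof -
  have "\<not> (\<exists>\<sigma>. b'_factor c w \<sigma>)" using assms(2) by (auto simp: b'_factor_iff[OF assms(1)])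
  then have "b'_factor c w = (\<lambda>\<sigma>. False)" by auto
  then show ?thesis by (simp add: pair_b'_def)
qed

lemma level_cancel:
  assumes "x \<in> level_diagrams p p"
  shows "f \<in> diagrams p q \<Longrightarrow> hat_comp (hat_comp f x) (bar x) = f"
    "f \<in> diagrams p q \<Longrightarrow> hat_comp (hat_comp f (bar x)) x = f"
    "f \<in> diagrams q p \<Longrightarrow> hat_comp x (hat_comp (bar x) f) = f"
    "f \<in> diagrams q p \<Longrightarrow> hat_comp (bar x) (hat_comp x f) = f"
proof -
  note x = level_diagramsD[OF assms]
  note b = bar_closed[OF x]
  show "f \<in> diagrams p q \<Longrightarrow> hat_comp (hat_comp f x) (bar x) = f"
    "f \<in> diagrams p q \<Longrightarrow> hat_comp (hat_comp f (bar x)) x = f"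
    using hat_comp_assoc[OF _ x b] hat_comp_assoc[OF _ b x] level_inverse[OF assms] hat_comp_id_right by metis+
  show "f \<in> diagrams q p \<Longrightarrow> hat_comp x (hat_comp (bar x) f) = f"
    "f \<in> diagrams q p \<Longrightarrow> hat_comp (bar x) (hat_comp x f) = f"
    using hat_comp_assoc[OF x b] hat_comp_assoc[OF b x] level_inverse[OF assms] hat_comp_id_left by metis+
qed

text \<open>If \<open>\<sigma>\<close> carries \<open>bar w\<close> to \<open>c\<close>, then
  \<open>hat_comp \<sigma> x\<close> carries the reflection of \<open>hat_comp w x\<close> to
  \<open>c\<close>. Conversely, a factor for \<open>hat_comp w x\<close> gives one for
  \<open>w\<close> after multiplication by \<open>bar x\<close>.\<close>

lemma pair_b'_right_basis:
  assumes "c \<in> down_diagrams q s" "w \<in> up_diagrams p q" "x \<in> level_diagrams r p"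
  shows "pair_b' (basis c) (bcomp \<delta> (basis w) (basis x)) = bcomp \<delta> (pair_b' (basis c) (basis w)) (basis x)"
proof -
  have x: "x \<in> level_diagrams p p" "r = p" using level_diagrams_eq[OF assms(3)] assms(3) by auto
  note xd = level_diagramsD[OF x(1)] and wd = up_diagramsD[OF assms(2)]
  have wx: "hat_comp w x \<in> up_diagrams p q" using assms(2) level_up[OF x(1)] by blast
  have bwx: "bar (hat_comp w x) = hat_comp (bar x) (bar w)" by (rule hat_comp_bar[OF wd xd])
  have L: "bcomp \<delta> (basis w) (basis x) = basis (hat_comp w x)" by (rule bcomp_up_basis[OF assms(2) xd])
  show ?thesis
  proof (cases "\<exists>\<sigma>\<in>level_diagrams p p. c = hat_comp \<sigma> (bar w)")
    case True
    then obtain \<sigma> where 1: "\<sigma> \<in> level_diagrams p p" "c = hat_comp \<sigma> (bar w)" by blast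
    have v: "pair_b' (basis c) (basis w) = basis \<sigma>" by (simp add: 1(2) pair_b'_eq[OF assms(2) 1(1)])
    note \<sigma>d = level_diagramsD[OF 1(1)]
    have "hat_comp (hat_comp \<sigma> x) (bar (hat_comp w x)) = hat_comp (hat_comp (hat_comp \<sigma> x) (bar x)) (bar w)"
      unfolding bwx using hat_comp_assoc[OF hat_comp_closed[OF \<sigma>d xd] bar_closed[OF xd] bar_closed[OF wd]] by simp
    then have "c = hat_comp (hat_comp \<sigma> x) (bar (hat_comp w x))"
      using level_cancel(1)[OF x(1) \<sigma>d] 1(2) by simp
    then have "pair_b' (basis c) (basis (hat_comp w x)) = basis (hat_comp \<sigma> x)"
      using pair_b'_eq[OF wx level_comp[OF 1(1) x(1)]] by metis
    then show ?thesis by (simp add: v L bcomp_up_basis[OF level_up[OF 1(1)] xd])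
  next
    case False
    then have 2: "\<And>\<sigma>. \<sigma> \<in> level_diagrams p p \<Longrightarrow> c \<noteq> hat_comp \<sigma> (bar w)" by blast
    have "c \<noteq> hat_comp \<tau> (bar (hat_comp w x))" if "\<tau> \<in> level_diagrams p p" for \<tau>
      using 2[of "hat_comp \<tau> (bar x)"] that x(1)
        hat_comp_assoc[OF level_diagramsD[OF that] bar_closed[OF xd] bar_closed[OF wd]]
        level_comp[of \<tau> p p "bar x" p]
      unfolding bwx by auto
    then show ?thesis
      by (simp add: L pair_b'_zero[OF wx] pair_b'_zero[OF assms(2) 2] lin_zero[OF lin_bcomp_left[OF lin_ident]])
  qed
qed

lemma pair_b'_left_basis:
  assumes "x \<in> level_diagrams s r" "c \<in> down_diagrams q s" "w \<in> up_diagrams p q"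
  shows "pair_b' (bcomp \<delta> (basis x) (basis c)) (basis w) = bcomp \<delta> (basis x) (pair_b' (basis c) (basis w))"
proof -
  have x: "x \<in> level_diagrams s s" "r = s" using level_diagrams_eq[OF assms(1)] assms(1) by auto
  note xd = level_diagramsD[OF x(1)] and wd = up_diagramsD[OF assms(3)] and cd = down_diagramsD[OF assms(2)]
  have L: "bcomp \<delta> (basis x) (basis c) = basis (hat_comp x c)" by (rule bcomp_up_basis[OF level_up[OF x(1)] cd])
  show ?thesis
  proof (cases "\<exists>\<sigma>\<in>level_diagrams p p. c = hat_comp \<sigma> (bar w)")
    case True
    then obtain \<sigma> where 1: "\<sigma> \<in> level_diagrams p p" "c = hat_comp \<sigma> (bar w)" by blast
    have v: "pair_b' (basis c) (basis w) = basis \<sigma>" by (simp add: 1(2) pair_b'_eq[OF assms(3) 1(1)])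
    note \<sigma>d = level_diagramsD[OF 1(1)]
    have "hat_comp \<sigma> (bar w) \<in> diagrams q p" using \<sigma>d wd by blast
    then have sp: "s = p" using diagrams_inj[OF cd] 1(2) by blast
    have "hat_comp x c = hat_comp (hat_comp x \<sigma>) (bar w)"
      using hat_comp_assoc[OF xd \<sigma>d[folded sp] bar_closed[OF wd, folded sp]] 1(2) by simp
    then have "pair_b' (basis (hat_comp x c)) (basis w) = basis (hat_comp x \<sigma>)"
      using pair_b'_eq[OF assms(3) level_comp[OF x(1)[unfolded sp] 1(1)]] by metis
    then show ?thesis by (simp add: v L bcomp_up_basis[OF level_up[OF x(1)] \<sigma>d[folded sp]])
  next
    case False
    then have 2: "\<And>\<sigma>. \<sigma> \<in> level_diagrams p p \<Longrightarrow> c \<noteq> hat_comp \<sigma> (bar w)" by blast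
    have "hat_comp x c \<noteq> hat_comp \<tau> (bar w)" if t: "\<tau> \<in> level_diagrams p p" for \<tau>
    proof
      assume eq: "hat_comp x c = hat_comp \<tau> (bar w)"
      note \<tau>d = level_diagramsD[OF t]
      have "hat_comp x c \<in> diagrams q s" "hat_comp \<tau> (bar w) \<in> diagrams q p" using xd cd \<tau>d wd by blast+
      then have sp: "s = p" using diagrams_inj eq by metis
      have "c = hat_comp (bar x) (hat_comp x c)" using level_cancel(4)[OF x(1) cd] by simp
      also have "\<dots> = hat_comp (hat_comp (bar x) \<tau>) (bar w)"
        using hat_comp_assoc[OF bar_closed[OF xd] \<tau>d[folded sp] bar_closed[OF wd, folded sp]] eq by simp
      finally show False using 2[of "hat_comp (bar x) \<tau>"] level_comp[of "bar x" p p \<tau> p] x(1) t sp by auto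
    qed
    then show ?thesis
      by (simp add: L pair_b'_zero[OF assms(3)] pair_b'_zero[OF assms(3) 2] lin_zero[OF lin_bcomp])
  qed
qed

text \<open>As \<open>x\<close> is invertible, the equation between \<open>hat_comp c x\<close> and
  \<open>hat_comp \<sigma> (bar w)\<close> can be solved for \<open>c\<close>, which yields the
  equation defining the other side with the same \<open>\<sigma>\<close>.\<close>

lemma pair_b'_balanced_basis:
  assumes "c \<in> down_diagrams q s" "x \<in> level_diagrams r q" "w \<in> up_diagrams p r"
  shows "pair_b' (bcomp \<delta> (basis c) (basis x)) (basis w) = pair_b' (basis c) (bcomp \<delta> (basis x) (basis w))"
proof -
  have x: "x \<in> level_diagrams q q" and rq: "r = q" using level_diagrams_eq[OF assms(2)] assms(2) by auto
  have w: "w \<in> up_diagrams p q" using assms(3) rq by simp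
  note xd = level_diagramsD[OF x] and wd = up_diagramsD[OF w] and cd = down_diagramsD[OF assms(1)]
  have L: "bcomp \<delta> (basis c) (basis x) = basis (hat_comp c x)" by (rule bcomp_down_basis[OF cd level_down[OF x]])
  have R: "bcomp \<delta> (basis x) (basis w) = basis (hat_comp x w)" by (rule bcomp_up_basis[OF level_up[OF x] wd])
  have xw: "hat_comp x w \<in> up_diagrams p q" using level_up[OF x] w by blast
  have bxw: "bar (hat_comp x w) = hat_comp (bar w) (bar x)" by (rule hat_comp_bar[OF xd wd])
  have key: "c = hat_comp \<sigma> (bar (hat_comp x w)) \<longleftrightarrow> hat_comp c x = hat_comp \<sigma> (bar w)"
    if s: "\<sigma> \<in> level_diagrams p p" for \<sigma>
  proof -
    note \<sigma>d = level_diagramsD[OF s]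
    have e: "hat_comp \<sigma> (bar (hat_comp x w)) = hat_comp (hat_comp \<sigma> (bar w)) (bar x)"
      unfolding bxw using hat_comp_assoc[OF \<sigma>d bar_closed[OF wd] bar_closed[OF xd]] by simp
    have sw: "hat_comp \<sigma> (bar w) \<in> diagrams q p" using \<sigma>d wd by blast
    show ?thesis unfolding e using level_cancel(1)[OF x cd] level_cancel(2)[OF x sw] by metis
  qed
  show ?thesis unfolding L R
  proof (cases "\<exists>\<sigma>\<in>level_diagrams p p. hat_comp c x = hat_comp \<sigma> (bar w)")
    case True
    then obtain \<sigma> where 1: "\<sigma> \<in> level_diagrams p p" "hat_comp c x = hat_comp \<sigma> (bar w)" by blast
    then have "c = hat_comp \<sigma> (bar (hat_comp x w))" using key by blast
    then show "pair_b' (basis (hat_comp c x)) (basis w) = pair_b' (basis c) (basis (hat_comp x w))"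
      using pair_b'_eq[OF xw 1(1)] pair_b'_eq[OF w 1(1)] 1(2) by metis
  next
    case False
    then show "pair_b' (basis (hat_comp c x)) (basis w) = pair_b' (basis c) (basis (hat_comp x w))"
      using key pair_b'_zero[OF xw, of c] pair_b'_zero[OF w, of "hat_comp c x"] by metis
  qed
qed

lemma pair_b'_balanced:
  fixes \<delta> :: "'k::comm_ring_1"
  shows "balanced_pairing \<delta> pair_b'"
proof
  show "lin (\<lambda>v. pair_b' v w)" "lin (pair_b' v)" for v w by (intro lin_intros)+
next
  fix c w :: "'k mor" and q s p assume "c \<in> Bminus q s" "w \<in> Bplus p q"
  then show "pair_b' c w \<in> S_hom p s" unfolding Bminus_def Bplus_def S_hom_def
  proof (rule bilin_closed[rotated -2])
    fix a b assume a: "a \<in> down_diagrams q s" and b: "b \<in> up_diagrams p q"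
    show "pair_b' (basis a) (basis b) \<in> free_on (level_diagrams p s)"
    proof (cases "\<exists>\<sigma>\<in>level_diagrams p p. a = hat_comp \<sigma> (bar b)")
      case True
      then obtain \<sigma> where 1: "\<sigma> \<in> level_diagrams p p" "a = hat_comp \<sigma> (bar b)" by blast
      then have "hat_comp \<sigma> (bar b) \<in> diagrams q p" using level_diagramsD up_diagramsD[OF b] by blast
      then have "s = p" using diagrams_inj[OF down_diagramsD[OF a]] 1(2) by blast
      then show ?thesis using 1 by (simp add: pair_b'_eq[OF b 1(1)])
    next
      case False
      then show ?thesis by (subst pair_b'_zero[OF b]) auto
    qed
  qed (intro lin_intros)+
next
  fix c w x :: "'k mor" and q s p r assume m: "c \<in> Bminus q s" "w \<in> Bplus p q" "x \<in> S_hom r p"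
  have "pair_b' c (bcomp \<delta> (basis w) (basis x)) = bcomp \<delta> (pair_b' c (basis w)) (basis x)"
    if "w \<in> up_diagrams p q" "x \<in> level_diagrams r p" for w x
    by (rule lin_eq_on[where F = "\<lambda>c. pair_b' c (bcomp \<delta> (basis w) (basis x))", OF _ _ pair_b'_right_basis[OF _ that]
          m(1)[unfolded Bminus_def]]) (intro lin_intros | assumption)+
  then show "pair_b' c (bcomp \<delta> w x) = bcomp \<delta> (pair_b' c w) x"
    by (rule bilin_eq_on[where F = "\<lambda>w x. pair_b' c (bcomp \<delta> w x)" and G = "\<lambda>w x. bcomp \<delta> (pair_b' c w) x",
          OF _ _ _ _ _ m(2,3)[unfolded Bplus_def S_hom_def], rotated 4]) (intro lin_intros | assumption)+
next
  fix c w x :: "'k mor" and q s p r assume m: "c \<in> Bminus q s" "w \<in> Bplus p q" "x \<in> S_hom s r"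
  have "pair_b' (bcomp \<delta> (basis x) (basis c)) w = bcomp \<delta> (basis x) (pair_b' (basis c) w)"
    if "x \<in> level_diagrams s r" "c \<in> down_diagrams q s" for x c
    by (rule lin_eq_on[where F = "\<lambda>w. pair_b' (bcomp \<delta> (basis x) (basis c)) w", OF _ _ pair_b'_left_basis[OF that]
          m(2)[unfolded Bplus_def]]) (intro lin_intros | assumption)+
  then show "pair_b' (bcomp \<delta> x c) w = bcomp \<delta> x (pair_b' c w)"
    by (rule bilin_eq_on[where F = "\<lambda>x c. pair_b' (bcomp \<delta> x c) w" and G = "\<lambda>x c. bcomp \<delta> x (pair_b' c w)",
          OF _ _ _ _ _ m(3,1)[unfolded Bminus_def S_hom_def], rotated 4]) (intro lin_intros | assumption)+
next
  fix c w x :: "'k mor" and q s p r assume m: "c \<in> Bminus q s" "x \<in> S_hom r q" "w \<in> Bplus p r"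
  have "pair_b' (bcomp \<delta> (basis c) (basis x)) w = pair_b' (basis c) (bcomp \<delta> (basis x) w)"
    if "c \<in> down_diagrams q s" "x \<in> level_diagrams r q" for x c
    by (rule lin_eq_on[where F = "\<lambda>w. pair_b' (bcomp \<delta> (basis c) (basis x)) w", OF _ _ pair_b'_balanced_basis[OF that]
          m(3)[unfolded Bplus_def]]) (intro lin_intros | assumption)+
  then show "pair_b' (bcomp \<delta> c x) w = pair_b' c (bcomp \<delta> x w)"
    by (rule bilin_eq_on[where F = "\<lambda>c x. pair_b' (bcomp \<delta> c x) w" and G = "\<lambda>c x. pair_b' c (bcomp \<delta> x w)",
          OF _ _ _ _ _ m(1,2)[unfolded Bminus_def S_hom_def], rotated 4]) (intro lin_intros | assumption)+
qed

interpretation b': balanced_pairing \<delta> pair_b' for \<delta>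
  by (rule pair_b'_balanced)

section \<open>The map \<open>K_plus\<close> and the matrix Brauer category\<close>

definition upart :: "'k::comm_ring_1 mor \<Rightarrow> 'k mor" where
  "upart = lin_ext (\<lambda>f. if upward f then basis f else 0)"

lemma lin_upart: "lin F \<Longrightarrow> lin (\<lambda>x. upart (F x))"
  unfolding upart_def by (rule lin_ext_of_lin)

lemma upart_basis: "upart (basis f) = (if upward f then basis f else 0)"
  by (simp add: upart_def)

lemma upart_closed: "x \<in> B_hom p q \<Longrightarrow> upart x \<in> Bplus p q"
  unfolding B_hom_def Bplus_def
  by (rule lin_closed[OF lin_upart[OF lin_ident]]) (auto simp: upart_basis up_diagrams_def)

lemma upart_Bplus: "x \<in> Bplus p q \<Longrightarrow> upart x = x"
  unfolding Bplus_def
  by (rule lin_eq_on[OF lin_upart[OF lin_ident] lin_ident]) (auto simp: upart_basis up_diagrams_def)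

lemma upart_bcomp_left:
  assumes "u \<in> Bplus q r" "x \<in> B_hom p q"
  shows "upart (bcomp \<delta> u x) = bcomp \<delta> u (upart x)"
proof (rule bilin_eq_on[where F = "\<lambda>u x. upart (bcomp \<delta> u x)" and G = "\<lambda>u x. bcomp \<delta> u (upart x)",
      OF _ _ _ _ _ assms[unfolded Bplus_def B_hom_def]])
  fix a b assume a: "a \<in> up_diagrams q r" and b: "b \<in> diagrams p q"
  show "upart (bcomp \<delta> (basis a) (basis b)) = bcomp \<delta> (basis a) (upart (basis b))"
    by (simp add: bcomp_up_basis[OF a b] upart_basis up_comp_iff[OF a b] lin_zero[OF lin_bcomp])
qed (intro lin_upart lin_intros)+

text \<open>A top pair survives composition from below, so the kernel of \<open>upart\<close> is
  stable under it. Hence composition followed by projection is an action of the Brauer category on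
  upward diagrams.\<close>

lemma upart_bcomp_right:
  assumes "f \<in> B_hom q r" "x \<in> B_hom p q"
  shows "upart (bcomp \<delta> f (upart x)) = upart (bcomp \<delta> f x)"
proof (rule bilin_eq_on[where F = "\<lambda>f x. upart (bcomp \<delta> f (upart x))" and G = "\<lambda>f x. upart (bcomp \<delta> f x)",
      OF _ _ _ _ _ assms[unfolded B_hom_def]])
  fix a b assume "a \<in> diagrams q r" "b \<in> diagrams p q"
  then have "upward (hat_comp a b) \<Longrightarrow> upward b" by (rule upward_hat_comp)
  then show "upart (bcomp \<delta> (basis a) (upart (basis b))) = upart (bcomp \<delta> (basis a) (basis b))"
    by (auto simp: bcomp_basis upart_basis lin_zero[OF lin_bcomp] lin_smul[OF lin_upart[OF lin_ident]]
        lin_zero[OF lin_upart[OF lin_ident]])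
qed (intro lin_upart lin_intros)+

text \<open>A top pair in the composite of \<open>z\<close> and \<open>w\<close> survives
  composition with \<open>c\<close>, and \<open>b\<close> then vanishes; on the remaining terms the
  powers of the parameter agree by the loop cocycle.\<close>

lemma pair_b_upart:
  assumes "c \<in> Bminus q s" "z \<in> Bminus r q" "w \<in> Bplus p r"
  shows "pair_b \<delta> (bcomp \<delta> c z) w = pair_b \<delta> c (upart (bcomp \<delta> z w))"
proof -
  have *: "pair_b \<delta> (bcomp \<delta> (basis c) (basis z)) (basis w) = pair_b \<delta> (basis c) (upart (bcomp \<delta> (basis z) (basis w)))"
    if "c \<in> down_diagrams q s" "z \<in> down_diagrams r q" "w \<in> up_diagrams p r" for c z w
  proof -
    note d = down_diagramsD[OF that(1)] down_diagramsD[OF that(2)] up_diagramsD[OF that(3)]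
    have "level (hat_comp c (hat_comp z w)) \<Longrightarrow> upward (hat_comp z w)"
      using upward_hat_comp[OF d(1) hat_comp_closed[OF d(2,3)]] by (simp add: level_def)
    then show ?thesis
      using loops_assoc[OF d] hat_comp_assoc[OF d] loops_down[OF d(1) that(2)]
      by (auto simp: bcomp_down_basis[OF d(1) that(2)] pair_b_basis bcomp_basis lin_smul[OF lin_upart[OF lin_ident]]
          upart_basis lin_smul[OF lin_pair_b_right[OF lin_ident]] lin_zero[OF lin_pair_b_right[OF lin_ident]]
          simp flip: power_add) (simp add: add.commute)
  qed
  have "pair_b \<delta> (bcomp \<delta> (basis c) (basis z)) w = pair_b \<delta> (basis c) (upart (bcomp \<delta> (basis z) w))"
    if "c \<in> down_diagrams q s" "z \<in> down_diagrams r q" for c z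
    by (rule lin_eq_on[where F = "\<lambda>w. pair_b \<delta> (bcomp \<delta> (basis c) (basis z)) w", OF _ _ *[OF that]
          assms(3)[unfolded Bplus_def]]) (intro lin_upart lin_intros | assumption)+
  then show ?thesis
    by (rule bilin_eq_on[where F = "\<lambda>c z. pair_b \<delta> (bcomp \<delta> c z) w" and
          G = "\<lambda>c z. pair_b \<delta> c (upart (bcomp \<delta> z w))",
          OF _ _ _ _ _ assms(1,2)[unfolded Bminus_def], rotated 4]) (intro lin_upart lin_intros | assumption)+
qed

text \<open>Taking the identity for \<open>\<kappa>\<close> gives the copairing of \<open>b'\<close>, taking the inverse of \<open>K_plus\<close> the one of \<open>b\<close>.\<close>

definition diag_tensor ::
  "(nat \<Rightarrow> nat \<Rightarrow> 'k::comm_ring_1 mor \<Rightarrow> 'k mor) \<Rightarrow> nat \<Rightarrow> 'k tens" where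
  "diag_tensor \<kappa> p = (\<Sum>s\<in>{s. prec s p}. \<Sum>h\<in>mono_up_diagrams s p. basis (s, \<kappa> s p (basis h), basis (bar h)))"

lemma d'_one_eq: "d'_one = diag_tensor (\<lambda>s p x. x)"
  by (simp add: fun_eq_iff d'_one_def diag_tensor_def)

lemma lin_ext_diag_tensor:
  "lin_ext \<phi> (diag_tensor \<kappa> p) =
    (\<Sum>s\<in>{s. prec s p}. \<Sum>h\<in>mono_up_diagrams s p. \<phi> (s, \<kappa> s p (basis h), basis (bar h)))"
  by (simp add: diag_tensor_def lin_sum[OF lin_lin_ext])

lemma finite_prec [simp]: "finite {s. prec s p}"
  by (rule finite_subset[of _ "{..p}"]) (auto simp: prec_def)

text \<open>If \<open>t\<close> does not precede \<open>p\<close> there are no monotone upward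
  diagrams from \<open>t\<close>, and both sides vanish.\<close>

lemma diag_sum_single:
  assumes "\<And>s h. h \<in> mono_up_diagrams s p \<Longrightarrow> s \<noteq> t \<Longrightarrow> \<phi> s h = 0"
  shows "(\<Sum>s\<in>{s. prec s p}. \<Sum>h\<in>mono_up_diagrams s p. \<phi> s h) = (\<Sum>h\<in>mono_up_diagrams t p. \<phi> t h)"
proof -
  have "(\<Sum>s\<in>{s. prec s p}. \<Sum>h\<in>mono_up_diagrams s p. \<phi> s h) =
    (\<Sum>s\<in>{s. prec s p}. if s = t then \<Sum>h\<in>mono_up_diagrams t p. \<phi> t h else 0)"
    by (rule sum.cong) (auto simp: assms)
  also have "\<dots> = (\<Sum>h\<in>mono_up_diagrams t p. \<phi> t h)"
    using mono_up_prec[of _ t p] by (auto simp: sum.delta intro!: sum.neutral)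
  finally show ?thesis .
qed

text \<open>Distinct monotone diagrams represent distinct orbits under permutations, so they are
  orthonormal for \<open>b'\<close>.\<close>

lemma pair_b'_mono:
  assumes h: "h \<in> mono_up_diagrams s p" and k: "k \<in> mono_up_diagrams s p"
  shows "pair_b' (basis (bar h)) (basis k) = (if h = k then one s else 0)"
proof (cases "h = k")
  case True
  have "bar h = hat_comp (id_diagram s) (bar k)"
    using True hat_comp_id_left[OF bar_closed[OF mono_up_diagramsD[OF k]]] by simp
  then show ?thesis using True pair_b'_eq[OF mono_up_up[OF k] id_level_diagram(1)] unfolding one_def by metis
next
  case False
  have "bar h \<noteq> hat_comp \<sigma> (bar k)" if s: "\<sigma> \<in> level_diagrams s s" for \<sigma>
  proof
    assume "bar h = hat_comp \<sigma> (bar k)"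
    then have "bar (bar h) = hat_comp (bar (bar k)) (bar \<sigma>)"
      using hat_comp_bar[OF level_diagramsD[OF s] bar_closed[OF mono_up_diagramsD[OF k]]] by simp
    then have "hat_comp h (id_diagram s) = hat_comp k (bar \<sigma>)"
      using hat_comp_id_right[OF mono_up_diagramsD[OF h]] by simp
    then show False using up_decomp_unique(1)[OF h id_level_diagram(1) k, of "bar \<sigma>"] s False by simp
  qed
  then show ?thesis using False by (simp add: pair_b'_zero[OF mono_up_up[OF k]])
qed

text \<open>Expansion in an orthonormal basis: on an upward diagram only its own orbit
  representative \<open>k\<close> contributes. This is one of the two copairing identities for
  \<open>d'\<close>.\<close>

lemma b'_zigzag_plus:
  fixes w :: "'k::comm_ring_1 mor"
  assumes "w \<in> Bplus s p"
  shows "(\<Sum>h\<in>mono_up_diagrams s p. bcomp \<delta> (basis h) (pair_b' (basis (bar h)) w)) = w"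
proof (rule lin_eq_on[where F = "\<lambda>w. \<Sum>h\<in>mono_up_diagrams s p. bcomp \<delta> (basis h) (pair_b' (basis (bar h)) w)",
      OF _ lin_ident _ assms[unfolded Bplus_def]])
  fix u assume "u \<in> up_diagrams s p"
  then obtain k \<tau> where k: "k \<in> mono_up_diagrams s p" "\<tau> \<in> level_diagrams s s" "u = hat_comp k \<tau>"
    using up_decomp by metis
  have u: "basis u = bcomp \<delta> (basis k) (basis \<tau>)"
    by (simp add: k(3) bcomp_up_basis[OF mono_up_up[OF k(1)] level_diagramsD[OF k(2)]])
  have "pair_b' (basis (bar h)) (basis u) = (if h = k then basis \<tau> else 0 :: 'k mor)"
    if h: "h \<in> mono_up_diagrams s p" for h
    unfolding u pair_b'_right_basis[OF mono_up_bar_down[OF h] mono_up_up[OF k(1)] k(2)] pair_b'_mono[OF h k(1)]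
    using k(2) by (auto simp: lin_zero[OF lin_bcomp_left[OF lin_ident]] bcomp_one_left[of _ s s] level_diagramsD)
  then have "(\<Sum>h\<in>mono_up_diagrams s p. bcomp \<delta> (basis h) (pair_b' (basis (bar h)) (basis u))) =
    (\<Sum>h\<in>mono_up_diagrams s p. if h = k then basis u else 0)"
    by (intro sum.cong) (auto simp: u lin_zero[OF lin_bcomp])
  then show "(\<Sum>h\<in>mono_up_diagrams s p. bcomp \<delta> (basis h) (pair_b' (basis (bar h)) (basis u))) = basis u"
    using k(1) by (simp add: sum.delta)
qed (intro lin_sum_fun lin_intros)

lemma b'_zigzag_minus:
  fixes c :: "'k::comm_ring_1 mor"
  assumes "c \<in> Bminus p s"
  shows "(\<Sum>h\<in>mono_up_diagrams s p. bcomp \<delta> (pair_b' c (basis h)) (basis (bar h))) = c"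
proof (rule lin_eq_on[where F = "\<lambda>c. \<Sum>h\<in>mono_up_diagrams s p. bcomp \<delta> (pair_b' c (basis h)) (basis (bar h))",
      OF _ lin_ident _ assms[unfolded Bminus_def]])
  fix u assume "u \<in> down_diagrams p s"
  then obtain k \<tau> where k: "k \<in> mono_up_diagrams s p" "\<tau> \<in> level_diagrams s s" "u = hat_comp \<tau> (bar k)"
    using down_decomp by metis
  have u: "basis u = bcomp \<delta> (basis \<tau>) (basis (bar k))"
    by (simp add: k(3) bcomp_up_basis[OF level_up[OF k(2)] bar_closed[OF mono_up_diagramsD[OF k(1)]]])
  have "pair_b' (basis u) (basis h) = (if h = k then basis \<tau> else 0 :: 'k mor)"
    if h: "h \<in> mono_up_diagrams s p" for h
    unfolding u pair_b'_left_basis[OF k(2) mono_up_bar_down[OF k(1)] mono_up_up[OF h]] pair_b'_mono[OF k(1) h]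
    using k(2) by (auto simp: lin_zero[OF lin_bcomp] bcomp_one_right[of _ s s] level_diagramsD)
  then have "(\<Sum>h\<in>mono_up_diagrams s p. bcomp \<delta> (pair_b' (basis u) (basis h)) (basis (bar h))) =
    (\<Sum>h\<in>mono_up_diagrams s p. if h = k then basis u else 0)"
    by (intro sum.cong) (auto simp: u lin_zero[OF lin_bcomp_left[OF lin_ident]])
  then show "(\<Sum>h\<in>mono_up_diagrams s p. bcomp \<delta> (pair_b' (basis u) (basis h)) (basis (bar h))) = basis u"
    using k(1) by (simp add: sum.delta)
qed (intro lin_sum_fun lin_intros)

lemma mono_mem: "h \<in> mono_up_diagrams s p \<Longrightarrow> basis h \<in> Bplus s p"
  "h \<in> mono_up_diagrams s p \<Longrightarrow> basis (bar h) \<in> Bminus p s"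
  by (auto intro: mono_up_up)

lemma K_plus_eq:
  assumes "w \<in> Bplus s q"
  shows "K_plus \<delta> p q w = (\<Sum>h\<in>mono_up_diagrams s q. bcomp \<delta> (basis h) (pair_b \<delta> (basis (bar h)) w))"
proof -
  have "pair_b \<delta> (basis (bar h)) w = 0" if "h \<in> mono_up_diagrams t q" "t \<noteq> s" for t h
    using S_hom_neq[OF b.closed[OF mono_mem(2)[OF that(1)] assms]] that by simp
  then have "(\<Sum>t\<in>{t. prec t q}. \<Sum>h\<in>mono_up_diagrams t q. bcomp \<delta> (basis h) (pair_b \<delta> (basis (bar h)) w)) =
    (\<Sum>h\<in>mono_up_diagrams s q. bcomp \<delta> (basis h) (pair_b \<delta> (basis (bar h)) w))"
    by (intro diag_sum_single) (simp add: lin_zero[OF lin_bcomp])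
  then show ?thesis by (simp add: K_plus_def d'_one_eq lin_ext_diag_tensor)
qed

lemma lin_K_plus: "lin F \<Longrightarrow> lin (\<lambda>x. K_plus \<delta> p q (F x))"
  unfolding K_plus_def d'_one_eq lin_ext_diag_tensor prod.case by (intro lin_sum_fun lin_intros)

lemma Bplus_sum: "(\<And>i. i \<in> I \<Longrightarrow> v i \<in> Bplus p q) \<Longrightarrow> (\<Sum>i\<in>I. v i) \<in> Bplus p q"
  unfolding Bplus_def by (rule free_on_sum)

lemma K_plus_closed:
  assumes "w \<in> Bplus s q" shows "K_plus \<delta> p q w \<in> Bplus s q"
  unfolding K_plus_eq[OF assms]
  by (intro Bplus_sum bcomp_Bplus[OF mono_mem(1)] S_hom_Bplus b.closed[OF mono_mem(2) assms])

lemma K_plus_right: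
  assumes "w \<in> Bplus s q" "x \<in> S_hom s s"
  shows "K_plus \<delta> p q (bcomp \<delta> w x) = bcomp \<delta> (K_plus \<delta> p q w) x"
proof -
  have "bcomp \<delta> (basis h) (pair_b \<delta> (basis (bar h)) (bcomp \<delta> w x)) =
    bcomp \<delta> (bcomp \<delta> (basis h) (pair_b \<delta> (basis (bar h)) w)) x" if h: "h \<in> mono_up_diagrams s q" for h
    unfolding b.right[OF mono_mem(2)[OF h] assms]
    by (rule bcomp_assoc[symmetric, OF Bplus_B_hom[OF mono_mem(1)[OF h]]
          S_hom_B_hom[OF b.closed[OF mono_mem(2)[OF h] assms(1)]] S_hom_B_hom[OF assms(2)]])
  then show ?thesis
    by (simp add: K_plus_eq[OF assms(1)] K_plus_eq[OF bcomp_Bplus[OF assms(1) S_hom_Bplus[OF assms(2)]]]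
        lin_sum[OF lin_bcomp_left[OF lin_ident]])
qed

text \<open>Bimodule linearity moves the coefficient of \<open>h\<close> in \<open>K_plus\<close>
  out of \<open>b'\<close> and the value of \<open>b'\<close> into \<open>b\<close>; what remains is
  the expansion of \<open>c\<close> from \<open>b'_zigzag_minus\<close>.\<close>

lemma pair_b'_K_plus:
  assumes c: "c \<in> Bminus q s" and w: "w \<in> Bplus r q"
  shows "pair_b' c (K_plus \<delta> p q w) = pair_b \<delta> c w"
proof (cases "r = s")
  case True
  have "pair_b' c (bcomp \<delta> (basis h) (pair_b \<delta> (basis (bar h)) w)) =
    pair_b \<delta> (bcomp \<delta> (pair_b' c (basis h)) (basis (bar h))) w" if h: "h \<in> mono_up_diagrams s q" for h
    using b'.right[OF c mono_mem(1)[OF h] b.closed[OF mono_mem(2)[OF h] w]]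
      b.left[OF mono_mem(2)[OF h] w b'.closed[OF c mono_mem(1)[OF h]]] by simp
  then have "pair_b' c (K_plus \<delta> p q w) =
    pair_b \<delta> (\<Sum>h\<in>mono_up_diagrams s q. bcomp \<delta> (pair_b' c (basis h)) (basis (bar h))) w"
    by (simp add: K_plus_eq[OF w] True lin_sum[OF lin_pair_b'_right[OF lin_ident]] lin_sum[OF lin_pair_b_left[OF lin_ident]])
  then show ?thesis by (simp add: b'_zigzag_minus[OF c])
next
  case False
  then show ?thesis
    using S_hom_neq[OF b.closed[OF c w]] S_hom_neq[OF b'.closed[OF c K_plus_closed[OF w]]] by simp
qed

text \<open>By \<open>b'_zigzag_plus\<close> an element is determined by its pairings with all
  \<open>bar h\<close>. Balancedness of both pairings moves \<open>x\<close> to the side of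
  \<open>bar h\<close>, where \<open>b'\<close> after \<open>K_plus\<close> becomes
  \<open>b\<close>.\<close>

lemma K_plus_left:
  assumes w: "w \<in> Bplus s q" and x: "x \<in> S_hom q q"
  shows "K_plus \<delta> p q (bcomp \<delta> x w) = bcomp \<delta> x (K_plus \<delta> p q w)"
proof -
  have xw: "bcomp \<delta> x w \<in> Bplus s q" using w S_hom_Bplus[OF x] by blast
  note Kw = K_plus_closed[OF w, where \<delta> = \<delta> and p = p]
  have "pair_b' (basis (bar h)) (bcomp \<delta> x (K_plus \<delta> p q w)) = pair_b \<delta> (basis (bar h)) (bcomp \<delta> x w)"
    if h: "h \<in> mono_up_diagrams s q" for h
  proof -
    note m = mono_mem(2)[OF h]
    have "bcomp \<delta> (basis (bar h)) x \<in> Bminus q s" using m S_hom_Bminus[OF x] by blast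
    then show ?thesis
      using b'.balanced[OF m x Kw] b.balanced[OF m x w] pair_b'_K_plus[of _ q s, OF _ w] by metis
  qed
  then show ?thesis
    using b'_zigzag_plus[OF bcomp_Bplus[where \<delta> = \<delta>, OF S_hom_Bplus[OF x] Kw], where \<delta> = \<delta>] by (simp add: K_plus_eq[OF xw])
qed

section \<open>The functor from the pseudo-Brauer to the matrix Brauer category\<close>

lemma lin_K_functor: "lin F \<Longrightarrow> lin (\<lambda>x. K_functor \<delta> p q (F x))"
  unfolding K_functor_def by (rule lin_ext_of_lin)

text \<open>Right linearity of \<open>K_plus\<close> is the balancing that lets
  \<open>K_plus\<close> \<otimes> id descend to composites.\<close>

lemma K_functor_comp:
  assumes u: "u \<in> Bplus s q" and c: "c \<in> Bminus p s"
  shows "K_functor \<delta> p q (bcomp \<delta> u c) = bcomp \<delta> (K_plus \<delta> t q u) c"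
proof -
  have "K_functor \<delta> p q (bcomp \<delta> u c) =
    lin_ext (\<lambda>f. bcomp \<delta> (K_plus \<delta> t q (basis (plus_part f))) (basis (rest_part f))) (bcomp \<delta> u c)"
    unfolding K_functor_def
  proof (rule lin_ext_cong)
    show "bcomp \<delta> u c \<in> free_on (diagrams p q)"
      using bcomp_closed[OF Bplus_B_hom[OF u] Bminus_B_hom[OF c]] by (simp add: B_hom_def)
  qed (simp add: basis_rest_part K_plus_def)
  also have "\<dots> = bcomp \<delta> (K_plus \<delta> t q u) c"
  proof (rule balanced_ext[where \<Psi> = "\<lambda>u c. bcomp \<delta> (K_plus \<delta> t q u) c", OF _ _ _ u c])
    fix u \<sigma> c assume h: "u \<in> up_diagrams s q" "\<sigma> \<in> level_diagrams s s" "c \<in> down_diagrams p s"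
    then have m: "basis u \<in> Bplus s q" "basis \<sigma> \<in> S_hom s s" "basis c \<in> Bminus p s" by auto
    show "bcomp \<delta> (K_plus \<delta> t q (bcomp \<delta> (basis u) (basis \<sigma>))) (basis c) =
      bcomp \<delta> (K_plus \<delta> t q (basis u)) (bcomp \<delta> (basis \<sigma>) (basis c))"
      unfolding K_plus_right[OF m(1,2)]
      by (rule bcomp_assoc[OF Bplus_B_hom[OF K_plus_closed[OF m(1)]] S_hom_B_hom[OF m(2)] Bminus_B_hom[OF m(3)]])
  qed (intro lin_intros lin_K_plus)+
  finally show ?thesis .
qed

lemma K_functor_closed:
  assumes "x \<in> B_hom p q" shows "K_functor \<delta> p q x \<in> B_hom p q"
  unfolding B_hom_def
proof (rule B_hom_closedI[OF lin_K_functor[OF lin_ident] assms])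
  fix s u c assume "u \<in> up_diagrams s q" "c \<in> down_diagrams p s"
  then have m: "basis u \<in> Bplus s q" "basis c \<in> Bminus p s" by auto
  show "K_functor \<delta> p q (bcomp \<delta> (basis u) (basis c)) \<in> free_on (diagrams p q)"
    unfolding K_functor_comp[OF m, of _ 0] B_hom_def[symmetric]
    by (rule bcomp_closed[OF Bplus_B_hom[OF K_plus_closed[OF m(1)]] Bminus_B_hom[OF m(2)]])
qed

text \<open>On tensors the two sides differ only in the middle factor, \<open>b\<close> of
  \<open>c\<close> and \<open>u'\<close> against \<open>b'\<close> of \<open>c\<close> and
  \<open>K_plus u'\<close>.\<close>

lemma K_functor_pairing_comp:
  assumes x: "x \<in> B_hom q r" and y: "y \<in> B_hom p q"
  shows "K_functor \<delta> p r (pairing_comp \<delta> (pair_b \<delta>) x y) =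
    pairing_comp \<delta> pair_b' (K_functor \<delta> q r x) (K_functor \<delta> p q y)"
proof -
  have "K_functor \<delta> p r (pairing_comp \<delta> (pair_b \<delta>) (bcomp \<delta> (basis u) (basis c)) y) =
    pairing_comp \<delta> pair_b' (K_functor \<delta> q r (bcomp \<delta> (basis u) (basis c))) (K_functor \<delta> p q y)"
    if "u \<in> up_diagrams s r" "c \<in> down_diagrams q s" for s u c
  proof (rule B_hom_eqI[where F = "\<lambda>y. K_functor \<delta> p r (pairing_comp \<delta> (pair_b \<delta>) (bcomp \<delta> (basis u) (basis c)) y)"
        and G = "\<lambda>y. pairing_comp \<delta> pair_b' (K_functor \<delta> q r (bcomp \<delta> (basis u) (basis c))) (K_functor \<delta> p q y)",
        OF _ _ y])
    fix t u' c' assume "u' \<in> up_diagrams t q" "c' \<in> down_diagrams p t"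
    then have m: "basis u \<in> Bplus s r" "basis c \<in> Bminus q s" "basis u' \<in> Bplus t q" "basis c' \<in> Bminus p t"
      using that by auto
    note Ku = K_plus_closed[OF m(1), of \<delta> 0] and Ku' = K_plus_closed[OF m(3), of \<delta> 0]
    have bc: "bcomp \<delta> (pair_b \<delta> (basis c) (basis u')) (basis c') \<in> Bminus p s"
      using S_hom_Bminus[OF b.closed[OF m(2,3)]] m(4) by blast
    show "K_functor \<delta> p r (pairing_comp \<delta> (pair_b \<delta>) (bcomp \<delta> (basis u) (basis c)) (bcomp \<delta> (basis u') (basis c'))) =
      pairing_comp \<delta> pair_b' (K_functor \<delta> q r (bcomp \<delta> (basis u) (basis c))) (K_functor \<delta> p q (bcomp \<delta> (basis u') (basis c')))"
      unfolding b.pairing_comp_comp[OF m] K_functor_comp[OF m(1) bc, of _ 0] K_functor_comp[OF m(1,2), of _ 0]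
        K_functor_comp[OF m(3,4), of _ 0] b'.pairing_comp_comp[OF Ku m(2) Ku' m(4)] pair_b'_K_plus[OF m(2,3)] ..
  qed (intro lin_intros lin_K_functor)+
  then show ?thesis
    by (rule B_hom_eqI[where F = "\<lambda>x. K_functor \<delta> p r (pairing_comp \<delta> (pair_b \<delta>) x y)"
          and G = "\<lambda>x. pairing_comp \<delta> pair_b' (K_functor \<delta> q r x) (K_functor \<delta> p q y)", OF _ _ x, rotated 2])
      (intro lin_intros lin_K_functor | assumption)+
qed

section \<open>The matrix Brauer category\<close>

lemma b'_act_faithful:
  assumes x: "x \<in> B_hom p q" "y \<in> B_hom p q"
    and eq: "\<And>s w. w \<in> Bplus s p \<Longrightarrow> b'.act \<delta> x w = b'.act \<delta> y w"
  shows "x = y"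
proof -
  define R where "R = (\<lambda>z. \<Sum>s\<in>{s. prec s p}. \<Sum>h\<in>mono_up_diagrams s p.
    bcomp \<delta> (b'.act \<delta> z (basis h)) (basis (bar h)))"
  have "R z = z" if z: "z \<in> B_hom p q" for z
  proof (rule B_hom_eqI[where F = R and G = "\<lambda>z. z", OF _ lin_ident z])
    show "lin R" unfolding R_def by (intro lin_sum_fun lin_intros b'.lin_act_left)
    fix s u c assume "u \<in> up_diagrams s q" "c \<in> down_diagrams p s"
    then have m: "basis u \<in> Bplus s q" "basis c \<in> Bminus p s" by auto
    have *: "bcomp \<delta> (b'.act \<delta> (bcomp \<delta> (basis u) (basis c)) (basis h)) (basis (bar h)) =
      bcomp \<delta> (basis u) (bcomp \<delta> (pair_b' (basis c) (basis h)) (basis (bar h)))"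
      if h: "h \<in> mono_up_diagrams t p" for t h
      unfolding b'.act_comp[OF m mono_mem(1)[OF h]]
      by (rule bcomp_assoc[OF Bplus_B_hom[OF m(1)] S_hom_B_hom[OF b'.closed[OF m(2) mono_mem(1)[OF h]]]
            Bminus_B_hom[OF mono_mem(2)[OF h]]])
    have z: "pair_b' (basis c) (basis h) = (0 :: 'a mor)" if "h \<in> mono_up_diagrams t p" "t \<noteq> s" for t h
      by (rule S_hom_neq[OF b'.closed[OF m(2) mono_mem(1)[OF that(1)]] that(2)])
    have "R (bcomp \<delta> (basis u) (basis c)) = (\<Sum>t\<in>{t. prec t p}. \<Sum>h\<in>mono_up_diagrams t p.
      bcomp \<delta> (basis u) (bcomp \<delta> (pair_b' (basis c) (basis h)) (basis (bar h))))"
      unfolding R_def by (intro sum.cong refl *)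
    also have "\<dots> = (\<Sum>h\<in>mono_up_diagrams s p. bcomp \<delta> (basis u) (bcomp \<delta> (pair_b' (basis c) (basis h)) (basis (bar h))))"
      by (rule diag_sum_single) (simp add: z lin_zero[OF lin_bcomp] lin_zero[OF lin_bcomp_left[OF lin_ident]])
    also have "\<dots> = bcomp \<delta> (basis u) (basis c)"
      using b'_zigzag_minus[OF m(2), of \<delta>] by (simp flip: lin_sum[OF lin_bcomp])
    finally show "R (bcomp \<delta> (basis u) (basis c)) = bcomp \<delta> (basis u) (basis c)" .
  qed
  moreover have "R x = R y" unfolding R_def by (intro sum.cong refl) (simp add: eq[OF mono_mem(1)])
  ultimately show ?thesis using x by metis
qed

lemma tensor_comp_diag:
  "tensor_comp \<delta> (diag_tensor \<kappa> p) =
    (\<Sum>s\<in>{s. prec s p}. \<Sum>h\<in>mono_up_diagrams s p. bcomp \<delta> (\<kappa> s p (basis h)) (basis (bar h)))"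
  by (simp add: tensor_comp_def lin_ext_diag_tensor)

lemma B_hom_sum: "(\<And>i. i \<in> I \<Longrightarrow> v i \<in> B_hom p q) \<Longrightarrow> (\<Sum>i\<in>I. v i) \<in> B_hom p q"
  unfolding B_hom_def by (rule free_on_sum)

lemma tensor_comp_diag_closed:
  assumes "\<And>s h. h \<in> mono_up_diagrams s p \<Longrightarrow> \<kappa> s p (basis h) \<in> Bplus s p"
  shows "tensor_comp \<delta> (diag_tensor \<kappa> p) \<in> B_hom p p"
  unfolding tensor_comp_diag
  by (intro B_hom_sum) (auto intro!: bcomp_closed[OF Bplus_B_hom[OF assms] Bminus_B_hom[OF mono_mem(2)]])

lemma b'_act_ident:
  assumes w: "w \<in> Bplus s p"
  shows "b'.act \<delta> (tensor_comp \<delta> (d'_one p)) w = w"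
proof -
  have *: "b'.act \<delta> (bcomp \<delta> (basis h) (basis (bar h))) w = bcomp \<delta> (basis h) (pair_b' (basis (bar h)) w)"
    if "h \<in> mono_up_diagrams t p" for t h
    by (rule b'.act_comp[OF mono_mem(1)[OF that] mono_mem(2)[OF that] w])
  have z: "pair_b' (basis (bar h)) w = 0" if "h \<in> mono_up_diagrams t p" "t \<noteq> s" for t h
    using S_hom_neq[OF b'.closed[OF mono_mem(2)[OF that(1)] w]] that by simp
  have "b'.act \<delta> (tensor_comp \<delta> (d'_one p)) w =
    (\<Sum>t\<in>{t. prec t p}. \<Sum>h\<in>mono_up_diagrams t p. bcomp \<delta> (basis h) (pair_b' (basis (bar h)) w))"
    unfolding d'_one_eq tensor_comp_diag lin_sum[OF b'.lin_act_left[OF lin_ident]] by (intro sum.cong refl *)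
  also have "\<dots> = (\<Sum>h\<in>mono_up_diagrams s p. bcomp \<delta> (basis h) (pair_b' (basis (bar h)) w))"
    by (rule diag_sum_single) (simp add: z lin_zero[OF lin_bcomp])
  finally show ?thesis using b'_zigzag_plus[OF w] by simp
qed

lemma mBrauer_category: "linear_category (mBrauer \<delta>)"
  unfolding mBrauer_def
proof (rule B_hom_category)
  note cl = b'.pairing_comp_closed
  have I: "tensor_comp \<delta> (d'_one p) \<in> B_hom p p" for p
    unfolding d'_one_eq by (rule tensor_comp_diag_closed) (rule mono_mem)
  then show "tensor_comp \<delta> (d'_one p) \<in> B_hom p p" for p .
  fix p q r s and f g h :: "'a mor"
  show "pairing_comp \<delta> pair_b' f g \<in> B_hom p r" if "f \<in> B_hom q r" "g \<in> B_hom p q"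
    using cl that by blast
  show "pairing_comp \<delta> pair_b' (pairing_comp \<delta> pair_b' f g) h = pairing_comp \<delta> pair_b' f (pairing_comp \<delta> pair_b' g h)"
    if d: "f \<in> B_hom r s" "g \<in> B_hom q r" "h \<in> B_hom p q"
  proof (rule b'_act_faithful[where \<delta> = \<delta>])
    fix t and w :: "'a mor" assume w: "w \<in> Bplus t p"
    show "b'.act \<delta> (pairing_comp \<delta> pair_b' (pairing_comp \<delta> pair_b' f g) h) w =
      b'.act \<delta> (pairing_comp \<delta> pair_b' f (pairing_comp \<delta> pair_b' g h)) w"
      by (simp only: b'.act_pairing_comp[OF cl[OF d(1,2)] d(3) w] b'.act_pairing_comp[OF d(1) cl[OF d(2,3)] w]
          b'.act_pairing_comp[OF d(2,3) w] b'.act_pairing_comp[OF d(1,2) b'.act_closed[OF d(3) w]])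
  qed (use cl d in blast)+
  assume f: "f \<in> B_hom p q"
  show "pairing_comp \<delta> pair_b' (tensor_comp \<delta> (d'_one q)) f = f"
  proof (rule b'_act_faithful[OF cl[OF I f] f, where \<delta> = \<delta>])
    fix t and w :: "'a mor" assume w: "w \<in> Bplus t p"
    show "b'.act \<delta> (pairing_comp \<delta> pair_b' (tensor_comp \<delta> (d'_one q)) f) w = b'.act \<delta> f w"
      by (simp only: b'.act_pairing_comp[OF I f w] b'_act_ident[OF b'.act_closed[OF f w]])
  qed
  show "pairing_comp \<delta> pair_b' f (tensor_comp \<delta> (d'_one p)) = f"
  proof (rule b'_act_faithful[OF cl[OF f I] f, where \<delta> = \<delta>])
    fix t and w :: "'a mor" assume w: "w \<in> Bplus t p"
    show "b'.act \<delta> (pairing_comp \<delta> pair_b' f (tensor_comp \<delta> (d'_one p))) w = b'.act \<delta> f w"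
      by (simp only: b'.act_pairing_comp[OF f I w] b'_act_ident[OF w])
  qed
qed (intro lin_intros)+

section \<open>The functors\<close>

lemma F_functor_basis:
  "F_functor \<delta> (diag_tensor \<kappa>) p q (basis f) =
    (\<Sum>t\<in>{t. prec t (through f)}. \<Sum>h\<in>mono_up_diagrams t (through f).
      bcomp \<delta> (bcomp \<delta> (basis (plus_part f)) (\<kappa> t (through f) (basis h)))
        (bcomp \<delta> (basis (bar h)) (bcomp \<delta> (basis (zero_part f)) (basis (minus_part f)))))"
  by (simp add: F_functor_def lin_ext_diag_tensor tensor_comp_def lin_sum[OF lin_lin_ext])

lemma lin_F_functor: "lin F \<Longrightarrow> lin (\<lambda>x. F_functor \<delta> D p q (F x))"
  unfolding F_functor_def by (rule lin_ext_of_lin)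

text \<open>The identity diagram is its own normal form in all three parts, so the functor returns
  the composite of the copairing element itself.\<close>

lemma F_functor_one:
  assumes "\<And>s h. h \<in> mono_up_diagrams s p \<Longrightarrow> \<kappa> s p (basis h) \<in> Bplus s p"
  shows "F_functor \<delta> (diag_tensor \<kappa>) p p (one p) = tensor_comp \<delta> (diag_tensor \<kappa> p)"
proof -
  have "bcomp \<delta> (bcomp \<delta> (basis (id_diagram p)) (\<kappa> t p (basis h)))
      (bcomp \<delta> (basis (bar h)) (bcomp \<delta> (basis (id_diagram p)) (basis (id_diagram p)))) =
    bcomp \<delta> (\<kappa> t p (basis h)) (basis (bar h))" if h: "h \<in> mono_up_diagrams t p" for t h
    using bcomp_one_left[OF Bplus_B_hom[OF assms[OF h]]] bcomp_one_left[OF one_mem(2)]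
      bcomp_one_right[OF Bminus_B_hom[OF mono_mem(2)[OF h]]] unfolding one_def by metis
  then show ?thesis unfolding one_def F_functor_basis id_parts tensor_comp_diag
    by (intro sum.cong refl) simp
qed

lemma bcomp_through_less:
  assumes "u \<in> Bplus t q" "c \<in> Bminus p t" "t < s"
  shows "bcomp \<delta> u c \<in> free_on {g \<in> diagrams p q. through g < s}"
proof (rule bilin_closed[where F = "bcomp \<delta>", OF _ _ _ assms(1,2)[unfolded Bplus_def Bminus_def]])
  fix a b assume a: "a \<in> up_diagrams t q" and b: "b \<in> down_diagrams p t"
  have "through (hat_comp a b) = t" using comp_parts[OF a b] by metis
  then show "bcomp \<delta> (basis a) (basis b) \<in> free_on {g \<in> diagrams p q. through g < s}"
    using a b assms(3) by (auto simp: bcomp_up_basis[OF a down_diagramsD[OF b]] dest: up_diagramsD down_diagramsD)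
qed (intro lin_intros)+

lemma mono_up_diagrams_self: "mono_up_diagrams s s = {id_diagram s}"
  by (auto simp: mono_up_self)

text \<open>The summands of the copairing element at \<open>s\<close> pass through some
  \<open>t\<close> preceding \<open>s\<close>. The only one with \<open>t = s\<close> belongs to the
  identity and reproduces \<open>f\<close>; all others have fewer through strands.\<close>

lemma F_functor_bij:
  assumes cl: "\<And>t s h. h \<in> mono_up_diagrams t s \<Longrightarrow> \<kappa> t s (basis h) \<in> Bplus t s"
    and one: "\<And>s. \<kappa> s s (one s) = one s"
  shows "bij_betw (F_functor \<delta> (diag_tensor \<kappa>) p q) (B_hom p q) (B_hom p q)"
  unfolding B_hom_def
proof (rule triangular_bij[where r = through, OF finite_diagrams lin_F_functor[OF lin_ident]])
  fix f assume f: "f \<in> diagrams p q"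
  define s where "s = through f"
  note parts = diagram_parts[OF f, folded s_def]
  have P: "basis (plus_part f) \<in> Bplus s q" and R: "basis (rest_part f) \<in> Bminus p s"
    using parts by (auto intro: mono_up_up)
  define T where "T = (\<lambda>t. \<Sum>h\<in>mono_up_diagrams t s.
      bcomp \<delta> (bcomp \<delta> (basis (plus_part f)) (\<kappa> t s (basis h))) (bcomp \<delta> (basis (bar h)) (basis (rest_part f))))"
  have F: "F_functor \<delta> (diag_tensor \<kappa>) p q (basis f) = (\<Sum>t\<in>{t. prec t s}. T t)"
    by (simp add: F_functor_basis basis_rest_part[OF f] T_def s_def)
  have "\<kappa> s s (basis (id_diagram s)) = basis (id_diagram s)" using one[of s] by (simp add: one_def)
  then have "T s = bcomp \<delta> (basis (plus_part f)) (basis (rest_part f))"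
    using bcomp_one_right[OF Bplus_B_hom[OF P], of \<delta>] bcomp_one_left[OF Bminus_B_hom[OF R], of \<delta>]
    by (simp add: T_def one_def mono_up_diagrams_self)
  also have "\<dots> = basis f" using basis_parts[OF f] by metis
  finally have Ts: "T s = basis f" .
  have low: "T t \<in> free_on {g \<in> diagrams p q. through g < s}" if t: "t < s" for t
    unfolding T_def
  proof (rule free_on_sum)
    fix h assume h: "h \<in> mono_up_diagrams t s"
    show "bcomp \<delta> (bcomp \<delta> (basis (plus_part f)) (\<kappa> t s (basis h))) (bcomp \<delta> (basis (bar h)) (basis (rest_part f))) \<in>
      free_on {g \<in> diagrams p q. through g < s}"
      by (rule bcomp_through_less[OF bcomp_Bplus[OF P cl[OF h]] bcomp_Bminus[OF mono_mem(2)[OF h] R] t])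
  qed
  have "(\<Sum>t\<in>{t. prec t s}. T t) = T s + (\<Sum>t\<in>{t. prec t s} - {s}. T t)"
    by (rule sum.remove) (auto simp: prec_def)
  then have "F_functor \<delta> (diag_tensor \<kappa>) p q (basis f) - basis f = (\<Sum>t\<in>{t. prec t s} - {s}. T t)"
    by (simp add: F Ts)
  also have "\<dots> \<in> free_on {g \<in> diagrams p q. through g < s}"
    by (intro free_on_sum low) (auto simp: prec_def)
  finally show "F_functor \<delta> (diag_tensor \<kappa>) p q (basis f) - basis f \<in> free_on {g \<in> diagrams p q. through g < through f}"
    by (simp add: s_def)
qed

text \<open>The summands of the copairing element act separately, and one that passes through
  \<open>t\<close> different from \<open>r\<close> pairs to zero with \<open>w\<close>.\<close>

lemma (in balanced_pairing) act_F_functor: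
  assumes cl: "\<And>t s h. h \<in> mono_up_diagrams t s \<Longrightarrow> \<kappa> t s (basis h) \<in> Bplus t s"
    and f: "f \<in> diagrams p q" and w: "w \<in> Bplus r p"
  defines "s \<equiv> through f"
  shows "act (F_functor \<delta> (diag_tensor \<kappa>) p q (basis f)) w = bcomp \<delta> (basis (plus_part f))
    (\<Sum>h\<in>mono_up_diagrams r s. bcomp \<delta> (\<kappa> r s (basis h)) (\<beta> (bcomp \<delta> (basis (bar h)) (basis (rest_part f))) w))"
proof -
  note parts = diagram_parts[OF f, folded s_def]
  have P: "basis (plus_part f) \<in> Bplus s q" and R: "basis (rest_part f) \<in> Bminus p s"
    using parts by (auto intro: mono_up_up)
  let ?x = "\<lambda>t h. bcomp \<delta> (bcomp \<delta> (basis (plus_part f)) (\<kappa> t s (basis h))) (bcomp \<delta> (basis (bar h)) (basis (rest_part f)))"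
  let ?y = "\<lambda>t h. bcomp \<delta> (basis (plus_part f))
    (bcomp \<delta> (\<kappa> t s (basis h)) (\<beta> (bcomp \<delta> (basis (bar h)) (basis (rest_part f))) w))"
  have xy: "act (?x t h) w = ?y t h" if h: "h \<in> mono_up_diagrams t s" for t h
  proof -
    note bR = bcomp_Bminus[OF mono_mem(2)[OF h] R, where \<delta> = \<delta>]
    show ?thesis unfolding act_comp[OF bcomp_Bplus[OF P cl[OF h]] bR w]
      by (rule bcomp_assoc[OF Bplus_B_hom[OF P] Bplus_B_hom[OF cl[OF h]] S_hom_B_hom[OF closed[OF bR w]]])
  qed
  have z: "?y t h = 0" if h: "h \<in> mono_up_diagrams t s" and ne: "t \<noteq> r" for t h
  proof -
    note bR = bcomp_Bminus[OF mono_mem(2)[OF h] R, where \<delta> = \<delta>]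
    have "\<beta> (bcomp \<delta> (basis (bar h)) (basis (rest_part f))) w = 0"
      using S_hom_neq[OF closed[OF bR w]] ne by simp
    then show ?thesis by (simp add: lin_zero[OF lin_bcomp])
  qed
  have "act (F_functor \<delta> (diag_tensor \<kappa>) p q (basis f)) w =
    (\<Sum>t\<in>{t. prec t s}. \<Sum>h\<in>mono_up_diagrams t s. act (?x t h) w)"
    by (simp add: F_functor_basis basis_rest_part[OF f] s_def lin_sum[OF lin_act_left[OF lin_ident]])
  also have "\<dots> = (\<Sum>t\<in>{t. prec t s}. \<Sum>h\<in>mono_up_diagrams t s. ?y t h)"
    by (intro sum.cong refl xy)
  also have "\<dots> = (\<Sum>h\<in>mono_up_diagrams r s. ?y r h)"
    by (rule diag_sum_single) (rule z)
  finally show ?thesis by (simp add: lin_sum[OF lin_bcomp])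
qed

section \<open>The functor from the quasi-Brauer category\<close>

lemma down_cancel:
  assumes "c \<in> down_diagrams p s" "x \<in> diagrams s q" "y \<in> diagrams s q" "hat_comp x c = hat_comp y c"
  shows "x = y"
proof -
  note c = down_diagramsD[OF assms(1)]
  have "hat_comp (bar c) (bar x) = hat_comp (bar c) (bar y)"
    using hat_comp_bar[OF assms(2) c] hat_comp_bar[OF assms(3) c] assms(4) by simp
  then have "bar x = bar y" using up_cancel[of "bar c" s p "bar x" q "bar y"] assms by auto
  then show ?thesis by (metis bar_bar)
qed

text \<open>The reflection of \<open>hat_comp (bar c) y\<close> ends in the factor \<open>c\<close>,
  which can be cancelled in the equation defining \<open>b'\<close> because a downward diagram has a
  right inverse.\<close>

lemma pair_b'_cancel:
  assumes c: "c \<in> down_diagrams p s" and y: "y \<in> up_diagrams r s" and g: "g \<in> down_diagrams s t"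
  shows "pair_b' (basis (hat_comp g c)) (basis (hat_comp (bar c) y)) = pair_b' (basis g) (basis y)"
proof -
  note cd = down_diagramsD[OF c] and yd = up_diagramsD[OF y] and gd = down_diagramsD[OF g]
  have w: "hat_comp (bar c) y \<in> up_diagrams r p" using c y by (intro up_comp[of "bar c" s]) auto
  have bw: "bar (hat_comp (bar c) y) = hat_comp (bar y) c" using hat_comp_bar[OF bar_closed[OF cd] yd] by simp
  have key: "hat_comp g c = hat_comp \<sigma> (bar (hat_comp (bar c) y)) \<longleftrightarrow> g = hat_comp \<sigma> (bar y)"
    if s: "\<sigma> \<in> level_diagrams r r" for \<sigma>
  proof -
    note \<sigma>d = level_diagramsD[OF s]
    have sy: "hat_comp \<sigma> (bar y) \<in> diagrams s r" using \<sigma>d yd by blast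
    have e: "hat_comp \<sigma> (bar (hat_comp (bar c) y)) = hat_comp (hat_comp \<sigma> (bar y)) c"
      unfolding bw using hat_comp_assoc[OF \<sigma>d bar_closed[OF yd] cd] by simp
    show ?thesis unfolding e
    proof
      assume eq: "hat_comp g c = hat_comp (hat_comp \<sigma> (bar y)) c"
      then have "t = r" using diagrams_inj[OF hat_comp_closed[OF gd cd]] hat_comp_closed[OF sy cd] by metis
      then show "g = hat_comp \<sigma> (bar y)" using down_cancel[OF c _ sy eq] gd by simp
    qed simp
  qed
  show ?thesis
  proof (cases "\<exists>\<sigma>\<in>level_diagrams r r. g = hat_comp \<sigma> (bar y)")
    case True
    then obtain \<sigma> where s: "\<sigma> \<in> level_diagrams r r" "g = hat_comp \<sigma> (bar y)" by blast
    then have "hat_comp g c = hat_comp \<sigma> (bar (hat_comp (bar c) y))" using key by blast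
    then show ?thesis using pair_b'_eq[OF w s(1)] pair_b'_eq[OF y s(1)] s(2) by metis
  next
    case False
    then show ?thesis
      using key pair_b'_zero[OF y, of g] pair_b'_zero[OF w, of "hat_comp g c"] by metis
  qed
qed

lemma F_d'_eq: "F_d' \<delta> = F_functor \<delta> (diag_tensor (\<lambda>s p x. x))"
  by (simp add: F_d'_def d'_one_eq)

text \<open>If the caps match, \<open>w\<close> is \<open>bar c\<close> times some \<open>y\<close>,
  and cancelling \<open>c\<close> turns the sum over \<open>h\<close> into the expansion of
  \<open>y\<close>. If they do not, a nonzero summand would exhibit \<open>w\<close> as such a
  product.\<close>

lemma b'_act_F_d':
  fixes \<delta> :: "'k::comm_ring_1"
  assumes f: "f \<in> diagrams p q" and w: "w \<in> up_diagrams r p"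
  shows "b'.act \<delta> (F_d' \<delta> p q (basis f)) (basis w) =
    (if caps_match f w then basis (hat_comp f w) else (0 :: 'k mor))"
proof -
  define s where "s = through f"
  note parts = diagram_parts[OF f, folded s_def]
  define c where "c = rest_part f"
  have c: "c \<in> down_diagrams p s" and P: "plus_part f \<in> up_diagrams s q" and f_eq: "f = hat_comp (plus_part f) c"
    using parts by (auto simp: c_def intro: mono_up_up)
  note cd = down_diagramsD[OF c] and Pd = up_diagramsD[OF P] and wd = up_diagramsD[OF w]
  have cm: "caps_match f w \<longleftrightarrow> caps_match c w" using caps_match_comp[OF P cd] f_eq by metis
  have bc: "bcomp \<delta> (basis (bar h)) (basis c) = basis (hat_comp (bar h) c)" if "h \<in> mono_up_diagrams r s" for h
    by (rule bcomp_down_basis[OF bar_closed[OF mono_up_diagramsD[OF that]] c])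
  have A: "b'.act \<delta> (F_d' \<delta> p q (basis f)) (basis w) = bcomp \<delta> (basis (plus_part f))
    (\<Sum>h\<in>mono_up_diagrams r s. bcomp \<delta> (basis h) (pair_b' (basis (hat_comp (bar h) c)) (basis w)))"
  proof -
    have wB: "basis w \<in> Bplus r p" using w by simp
    have "b'.act \<delta> (F_d' \<delta> p q (basis f)) (basis w) = bcomp \<delta> (basis (plus_part f))
      (\<Sum>h\<in>mono_up_diagrams r s. bcomp \<delta> (basis h) (pair_b' (bcomp \<delta> (basis (bar h)) (basis c)) (basis w)))"
      unfolding F_d'_eq c_def s_def
      by (rule b'.act_F_functor[where \<kappa> = "\<lambda>s p x. x", OF mono_mem(1) f wB])
    also have "(\<Sum>h\<in>mono_up_diagrams r s. bcomp \<delta> (basis h) (pair_b' (bcomp \<delta> (basis (bar h)) (basis c)) (basis w))) =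
      (\<Sum>h\<in>mono_up_diagrams r s. bcomp \<delta> (basis h) (pair_b' (basis (hat_comp (bar h) c)) (basis w)))"
      by (intro sum.cong refl) (simp only: bc)
    finally show ?thesis .
  qed
  show ?thesis
  proof (cases "caps_match c w")
    case True
    then obtain y where y: "y \<in> up_diagrams r s" "w = hat_comp (bar c) y" using caps_match_split[OF c w] by blast
    note yd = up_diagramsD[OF y(1)]
    have "hat_comp c w = y"
      unfolding y(2) using hat_comp_assoc[OF cd bar_closed[OF cd] yd] comp_bar_down[OF c] hat_comp_id_left[OF yd] by simp
    then have fw: "hat_comp f w = hat_comp (plus_part f) y"
      using hat_comp_assoc[OF Pd cd wd] f_eq by simp
    have "(\<Sum>h\<in>mono_up_diagrams r s. bcomp \<delta> (basis h) (pair_b' (basis (hat_comp (bar h) c)) (basis w))) =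
      (\<Sum>h\<in>mono_up_diagrams r s. bcomp \<delta> (basis h) (pair_b' (basis (bar h)) (basis y :: 'k mor)))"
      unfolding y(2) by (intro sum.cong refl) (simp add: pair_b'_cancel[OF c y(1) mono_up_bar_down])
    also have "\<dots> = basis y" by (rule b'_zigzag_plus) (use y in simp)
    finally show ?thesis using True cm by (simp add: A bcomp_up_basis[OF P yd] fw)
  next
    case False
    have "pair_b' (basis (hat_comp (bar h) c)) (basis w) = (0 :: 'k mor)" if h: "h \<in> mono_up_diagrams r s" for h
    proof (rule pair_b'_zero[OF w], rule notI)
      fix \<sigma> assume s: "\<sigma> \<in> level_diagrams r r" and eq: "hat_comp (bar h) c = hat_comp \<sigma> (bar w)"
      note \<sigma>d = level_diagramsD[OF s] and hd = mono_up_diagramsD[OF h]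
      have "bar (hat_comp (bar h) c) = bar (hat_comp \<sigma> (bar w))" using eq by simp
      then have "hat_comp (bar c) h = hat_comp w (bar \<sigma>)"
        using hat_comp_bar[OF bar_closed[OF hd] cd] hat_comp_bar[OF \<sigma>d bar_closed[OF wd]] by simp
      then have "w = hat_comp (hat_comp (bar c) h) \<sigma>" using level_cancel(2)[OF s wd] by simp
      also have "\<dots> = hat_comp (bar c) (hat_comp h \<sigma>)" by (rule hat_comp_assoc[OF bar_closed[OF cd] hd \<sigma>d])
      finally show False
        using False caps_match_split[OF c w] up_comp[OF mono_up_up[OF h] level_up[OF s]] by blast
    qed
    then show ?thesis using False cm by (simp add: A lin_zero[OF lin_bcomp])
  qed
qed

lemma qcomp_basis: "qcomp (basis f) (basis g) = (if clash f g then 0 else basis (hat_comp f g))"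
  by (simp add: qcomp_def clash_def)

lemma qcomp_closed: "f \<in> B_hom q r \<Longrightarrow> g \<in> B_hom p q \<Longrightarrow> qcomp f g \<in> B_hom p r"
  unfolding B_hom_def
  by (rule bilin_closed[where F = qcomp]) (auto simp: qcomp_basis intro!: lin_intros)

lemma lin_F_d': "lin F \<Longrightarrow> lin (\<lambda>x. F_d' \<delta> p q (F x))"
  unfolding F_d'_def by (rule lin_F_functor)

lemma F_d'_bij: "bij_betw (F_d' \<delta> p q) (B_hom p q) (B_hom p q)"
  unfolding F_d'_eq by (rule F_functor_bij) (simp_all add: mono_up_up)

text \<open>Acting on a diagram \<open>v\<close>, the right side survives iff the caps of
  \<open>g\<close> match \<open>v\<close> and those of \<open>f\<close> match the composite of
  \<open>g\<close> and \<open>v\<close>. A clash excludes this; without a clash it says that the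
  caps of the composite match \<open>v\<close>.\<close>

lemma F_d'_qcomp:
  fixes \<delta> :: "'k::comm_ring_1"
  assumes x: "x \<in> B_hom q r" and y: "y \<in> B_hom p q"
  shows "F_d' \<delta> p r (qcomp x y) = pairing_comp \<delta> pair_b' (F_d' \<delta> q r x) (F_d' \<delta> p q y)"
proof (rule bilin_eq_on[where F = "\<lambda>x y. F_d' \<delta> p r (qcomp x y)" and
      G = "\<lambda>x y. pairing_comp \<delta> pair_b' (F_d' \<delta> q r x) (F_d' \<delta> p q y)", OF _ _ _ _ _ x[unfolded B_hom_def] y[unfolded B_hom_def]])
  fix f g assume f: "f \<in> diagrams q r" and g: "g \<in> diagrams p q"
  have Fm: "F_d' \<delta> p q z \<in> B_hom p q" if "z \<in> B_hom p q" for p q z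
    using F_d'_bij[of \<delta> p q] that by (auto simp: bij_betw_def)
  have Ff: "F_d' \<delta> q r (basis f) \<in> B_hom q r" and Fg: "F_d' \<delta> p q (basis g) \<in> B_hom p q" using f g Fm by auto
  show "F_d' \<delta> p r (qcomp (basis f) (basis g)) =
    pairing_comp \<delta> pair_b' (F_d' \<delta> q r (basis f)) (F_d' \<delta> p q (basis g))"
  proof (rule b'_act_faithful[where \<delta> = \<delta>])
    show "F_d' \<delta> p r (qcomp (basis f) (basis g)) \<in> B_hom p r"
      using qcomp_closed[of "basis f" q r "basis g" p] f g Fm by auto
    show "pairing_comp \<delta> pair_b' (F_d' \<delta> q r (basis f)) (F_d' \<delta> p q (basis g)) \<in> B_hom p r"
      by (rule b'.pairing_comp_closed[OF Ff Fg])
    fix s and w :: "'k mor" assume "w \<in> Bplus s p"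
    then show "b'.act \<delta> (F_d' \<delta> p r (qcomp (basis f) (basis g))) w =
      b'.act \<delta> (pairing_comp \<delta> pair_b' (F_d' \<delta> q r (basis f)) (F_d' \<delta> p q (basis g))) w"
      unfolding Bplus_def
    proof (rule lin_eq_on[OF b'.lin_act_right[OF lin_ident] b'.lin_act_right[OF lin_ident], rotated])
      fix v assume v: "v \<in> up_diagrams s p"
      then have vB: "basis v \<in> Bplus s p" by simp
      note vd = up_diagramsD[OF v]
      have gv: "hat_comp g v \<in> up_diagrams s q" if "caps_match g v" using caps_match_up[OF g v that] .
      have fg: "hat_comp f g \<in> diagrams p r" using f g by blast
      have R: "b'.act \<delta> (pairing_comp \<delta> pair_b' (F_d' \<delta> q r (basis f)) (F_d' \<delta> p q (basis g))) (basis v) =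
        (if caps_match g v \<and> caps_match f (hat_comp g v) then basis (hat_comp f (hat_comp g v)) else 0)"
        unfolding b'.act_pairing_comp[OF Ff Fg vB] b'_act_F_d'[OF g v]
        using b'_act_F_d'[OF f gv, of \<delta>] by (auto simp: lin_zero[OF b'.lin_act_right[OF lin_ident]])
      show "b'.act \<delta> (F_d' \<delta> p r (qcomp (basis f) (basis g))) (basis v) =
        b'.act \<delta> (pairing_comp \<delta> pair_b' (F_d' \<delta> q r (basis f)) (F_d' \<delta> p q (basis g))) (basis v)"
      proof (cases "clash f g")
        case True
        then have "\<not> caps_match f (hat_comp g v)" by (rule clash_caps_match[OF _ f g vd])
        then show ?thesis unfolding R using True
          by (simp add: qcomp_basis lin_zero[OF lin_F_d'[OF lin_ident]] lin_zero[OF b'.lin_act_left[OF lin_ident]])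
      next
        case False
        then show ?thesis unfolding R
          by (simp add: qcomp_basis b'_act_F_d'[OF fg v] no_clash_caps_match[OF False f g v] hat_comp_assoc[OF f g vd])
      qed
    qed
  qed
qed (intro lin_intros lin_F_d')+

lemma mBrauer_eq: "mBrauer \<delta> = \<lparr>Hom = B_hom, Comp = pairing_comp \<delta> pair_b', Ident = (\<lambda>p. tensor_comp \<delta> (d'_one p))\<rparr>"
  by (simp add: mBrauer_def)

lemma F_d'_iso: "linear_category_iso qBrauer (mBrauer \<delta>) (F_d' \<delta>)"
  unfolding qBrauer_def mBrauer_eq
proof (rule B_hom_category_iso[OF mBrauer_category[unfolded mBrauer_eq]])
  show "F_d' \<delta> p p (one p) = tensor_comp \<delta> (d'_one p)" for p
    unfolding F_d'_eq d'_one_eq by (rule F_functor_one) (rule mono_mem)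
qed (auto intro!: lin_intros lin_F_d' qcomp_closed F_d'_bij F_d'_qcomp)

section \<open>Consequences of the invertibility of \<open>K_plus\<close>\<close>

lemma K_plus_indep: "K_plus \<delta> p q = K_plus \<delta> p' q"
  by (simp add: fun_eq_iff K_plus_def)

text \<open>Stands for non-singularity of the parameter; the two are identified in
  \<open>nonsingular_iff\<close>.\<close>

locale invertible_K_plus =
  fixes \<delta> :: "'k::comm_ring_1"
  assumes K_plus_bij: "bij_betw (K_plus \<delta> s q) (Bplus s q) (Bplus s q)"
begin

lemma K_plus_inj: "x \<in> Bplus s q \<Longrightarrow> y \<in> Bplus s q \<Longrightarrow> K_plus \<delta> p q x = K_plus \<delta> p q y \<Longrightarrow> x = y"
  using K_plus_bij[of s q] K_plus_indep[of \<delta> s q p] by (auto simp: bij_betw_def inj_on_def)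

text \<open>Extended linearly from the basis so that it is linear also outside \<open>Bplus\<close>.\<close>

definition Kinv :: "nat \<Rightarrow> nat \<Rightarrow> 'k mor \<Rightarrow> 'k mor" where
  "Kinv s q = lin_ext (\<lambda>w. inv_into (Bplus s q) (K_plus \<delta> s q) (basis w))"

lemma lin_Kinv: "lin F \<Longrightarrow> lin (\<lambda>x. Kinv s q (F x))"
  unfolding Kinv_def by (rule lin_ext_of_lin)

lemma Kinv_closed: "w \<in> Bplus s q \<Longrightarrow> Kinv s q w \<in> Bplus s q"
  unfolding Bplus_def
proof (rule lin_closed[OF lin_Kinv[OF lin_ident]])
  fix u assume "u \<in> up_diagrams s q"
  then have "basis u \<in> K_plus \<delta> s q ` Bplus s q" using K_plus_bij[of s q] by (simp add: bij_betw_def)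
  then show "Kinv s q (basis u) \<in> free_on (up_diagrams s q)"
    unfolding Kinv_def Bplus_def[symmetric] by (simp add: inv_into_into)
qed

lemma K_plus_Kinv: "w \<in> Bplus s q \<Longrightarrow> K_plus \<delta> p q (Kinv s q w) = w"
  unfolding Bplus_def
proof (rule lin_eq_on[OF lin_K_plus[OF lin_Kinv[OF lin_ident]] lin_ident])
  fix u assume "u \<in> up_diagrams s q"
  then have "basis u \<in> K_plus \<delta> s q ` Bplus s q" using K_plus_bij[of s q] by (simp add: bij_betw_def)
  then show "K_plus \<delta> p q (Kinv s q (basis u)) = basis u"
    unfolding Kinv_def using K_plus_indep[of \<delta> p q s] by (simp add: f_inv_into_f)
qed

lemma Kinv_K_plus: "w \<in> Bplus s q \<Longrightarrow> Kinv s q (K_plus \<delta> p q w) = w"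
  using K_plus_inj[of "Kinv s q (K_plus \<delta> p q w)" s q w p] Kinv_closed K_plus_closed K_plus_Kinv by metis

lemma Kinv_right:
  assumes "w \<in> Bplus s q" "x \<in> S_hom s s" shows "Kinv s q (bcomp \<delta> w x) = bcomp \<delta> (Kinv s q w) x"
proof (rule K_plus_inj[where p = 0])
  have wx: "bcomp \<delta> w x \<in> Bplus s q" using assms(1) S_hom_Bplus[OF assms(2)] by blast
  show "Kinv s q (bcomp \<delta> w x) \<in> Bplus s q" by (rule Kinv_closed[OF wx])
  show "bcomp \<delta> (Kinv s q w) x \<in> Bplus s q" using Kinv_closed[OF assms(1)] S_hom_Bplus[OF assms(2)] by blast
  show "K_plus \<delta> 0 q (Kinv s q (bcomp \<delta> w x)) = K_plus \<delta> 0 q (bcomp \<delta> (Kinv s q w) x)"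
    by (simp add: K_plus_Kinv[OF wx] K_plus_right[OF Kinv_closed[OF assms(1)] assms(2)] K_plus_Kinv[OF assms(1)])
qed

lemma Kinv_left:
  assumes "w \<in> Bplus s q" "x \<in> S_hom q q" shows "Kinv s q (bcomp \<delta> x w) = bcomp \<delta> x (Kinv s q w)"
proof (rule K_plus_inj[where p = 0])
  have xw: "bcomp \<delta> x w \<in> Bplus s q" using assms(1) S_hom_Bplus[OF assms(2)] by blast
  show "Kinv s q (bcomp \<delta> x w) \<in> Bplus s q" by (rule Kinv_closed[OF xw])
  show "bcomp \<delta> x (Kinv s q w) \<in> Bplus s q" using Kinv_closed[OF assms(1)] S_hom_Bplus[OF assms(2)] by blast
  show "K_plus \<delta> 0 q (Kinv s q (bcomp \<delta> x w)) = K_plus \<delta> 0 q (bcomp \<delta> x (Kinv s q w))"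
    by (simp add: K_plus_Kinv[OF xw] K_plus_left[OF Kinv_closed[OF assms(1)] assms(2)] K_plus_Kinv[OF assms(1)])
qed

text \<open>The identity is the only monotone upward diagram from \<open>s\<close> to
  \<open>s\<close>, so \<open>K_plus\<close> fixes it. This supplies the unit diagonal for
  \<open>F_functor_bij\<close>.\<close>

lemma Kinv_one: "Kinv s s (one s) = one s"
proof -
  have "K_plus \<delta> 0 s (one s) = bcomp \<delta> (one s) (pair_b \<delta> (one s) (one s))"
    using K_plus_eq[of "one s" s s \<delta> 0] by (simp add: mono_up_diagrams_self one_def)
  also have "pair_b \<delta> (one s) (one s) = (one s :: 'k mor)"
    by (simp add: one_def pair_b_basis hat_comp_id_left[OF id_diagram_closed]
        loops_up[OF id_level_diagram(2) id_diagram_closed])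
  finally have "K_plus \<delta> 0 s (one s) = one s" by (simp add: bcomp_one_left[OF one_mem(2)])
  then show ?thesis using Kinv_K_plus[of "one s" s s 0] by simp
qed

lemma K_functor_bij: "bij_betw (K_functor \<delta> p q) (B_hom p q) (B_hom p q)"
proof -
  \<comment> \<open>The inverse is \<open>Kinv\<close> \<otimes> id; \<open>through f\<close>
    supplies the source of the upward factor, on which \<open>Kinv\<close> depends.\<close>
  define L where "L = lin_ext (\<lambda>f. bcomp \<delta> (Kinv (through f) q (basis (plus_part f))) (basis (rest_part f)))"
  have linL: "lin (\<lambda>x. L (F x))" if "lin F" for F :: "('b \<Rightarrow>\<^sub>0 'k) \<Rightarrow> _" unfolding L_def by (rule lin_ext_of_lin[OF that])
  have L: "L (bcomp \<delta> u c) = bcomp \<delta> (Kinv s q u) c" if u: "u \<in> Bplus s q" and c: "c \<in> Bminus p s" for s u c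
  proof -
    have "L (bcomp \<delta> u c) =
      lin_ext (\<lambda>f. bcomp \<delta> (Kinv s q (basis (plus_part f))) (basis (rest_part f))) (bcomp \<delta> u c)"
    proof (rule bilin_eq_on[where F = "\<lambda>u c. L (bcomp \<delta> u c)" and
          G = "\<lambda>u c. lin_ext (\<lambda>f. bcomp \<delta> (Kinv s q (basis (plus_part f))) (basis (rest_part f))) (bcomp \<delta> u c)",
          OF _ _ _ _ _ u[unfolded Bplus_def] c[unfolded Bminus_def]])
      fix a b assume a: "a \<in> up_diagrams s q" and b: "b \<in> down_diagrams p s"
      have "through (hat_comp a b) = s" using comp_parts[OF a b] by metis
      then show "L (bcomp \<delta> (basis a) (basis b)) =
        lin_ext (\<lambda>f. bcomp \<delta> (Kinv s q (basis (plus_part f))) (basis (rest_part f))) (bcomp \<delta> (basis a) (basis b))"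
        by (simp add: L_def bcomp_up_basis[OF a down_diagramsD[OF b]])
    qed (intro linL lin_intros)+
    also have "\<dots> = bcomp \<delta> (Kinv s q u) c"
    proof (rule balanced_ext[where \<Psi> = "\<lambda>u c. bcomp \<delta> (Kinv s q u) c", OF _ _ _ u c])
      fix u \<sigma> c assume h: "u \<in> up_diagrams s q" "\<sigma> \<in> level_diagrams s s" "c \<in> down_diagrams p s"
      then have m: "basis u \<in> Bplus s q" "basis \<sigma> \<in> S_hom s s" "basis c \<in> Bminus p s" by auto
      show "bcomp \<delta> (Kinv s q (bcomp \<delta> (basis u) (basis \<sigma>))) (basis c) =
        bcomp \<delta> (Kinv s q (basis u)) (bcomp \<delta> (basis \<sigma>) (basis c))"
        unfolding Kinv_right[OF m(1,2)]
        by (rule bcomp_assoc[OF Bplus_B_hom[OF Kinv_closed[OF m(1)]] S_hom_B_hom[OF m(2)] Bminus_B_hom[OF m(3)]])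
    qed (intro lin_intros lin_Kinv)+
    finally show ?thesis .
  qed
  have LK: "L (K_functor \<delta> p q x) = x" if "x \<in> B_hom p q" for x
  proof (rule B_hom_eqI[where F = "\<lambda>x. L (K_functor \<delta> p q x)", OF _ lin_ident that])
    fix s u c assume "u \<in> up_diagrams s q" "c \<in> down_diagrams p s"
    then have m: "basis u \<in> Bplus s q" "basis c \<in> Bminus p s" by auto
    show "L (K_functor \<delta> p q (bcomp \<delta> (basis u) (basis c))) = bcomp \<delta> (basis u) (basis c)"
      by (simp add: K_functor_comp[OF m, of \<delta> 0] L[OF K_plus_closed[OF m(1)] m(2)] Kinv_K_plus[OF m(1)])
  qed (intro linL lin_K_functor lin_intros)
  have KL: "K_functor \<delta> p q (L x) = x" if "x \<in> B_hom p q" for x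
  proof (rule B_hom_eqI[where F = "\<lambda>x. K_functor \<delta> p q (L x)", OF _ lin_ident that])
    fix s u c assume "u \<in> up_diagrams s q" "c \<in> down_diagrams p s"
    then have m: "basis u \<in> Bplus s q" "basis c \<in> Bminus p s" by auto
    show "K_functor \<delta> p q (L (bcomp \<delta> (basis u) (basis c))) = bcomp \<delta> (basis u) (basis c)"
      by (simp add: L[OF m] K_functor_comp[OF Kinv_closed[OF m(1)] m(2), of \<delta> 0] K_plus_Kinv[OF m(1)])
  qed (intro linL lin_K_functor lin_intros)
  have Lc: "L x \<in> B_hom p q" if "x \<in> B_hom p q" for x
    unfolding B_hom_def
  proof (rule B_hom_closedI[where F = L, OF linL[OF lin_ident] that])
    fix s u c assume "u \<in> up_diagrams s q" "c \<in> down_diagrams p s"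
    then have m: "basis u \<in> Bplus s q" "basis c \<in> Bminus p s" by auto
    show "L (bcomp \<delta> (basis u) (basis c)) \<in> free_on (diagrams p q)"
      unfolding L[OF m] B_hom_def[symmetric]
      by (rule bcomp_closed[OF Bplus_B_hom[OF Kinv_closed[OF m(1)]] Bminus_B_hom[OF m(2)]])
  qed
  show ?thesis
    by (rule bij_betw_byWitness[where f' = L]) (use LK KL Lc K_functor_closed in blast)+
qed

text \<open>Applying \<open>K_plus\<close> cancels every \<open>Kinv\<close> and leaves exactly the
  expansion of \<open>K_plus y\<close>.\<close>

lemma zigzag_plus_sum:
  assumes y: "y \<in> Bplus r s"
  shows "(\<Sum>h\<in>mono_up_diagrams r s. bcomp \<delta> (Kinv r s (basis h)) (pair_b \<delta> (basis (bar h)) y)) = y"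
proof (rule K_plus_inj[where p = 0, OF _ y])
  have b: "pair_b \<delta> (basis (bar h)) y \<in> S_hom r r" if "h \<in> mono_up_diagrams r s" for h
    by (rule b.closed[OF mono_mem(2)[OF that] y])
  have k: "Kinv r s (basis h) \<in> Bplus r s" if "h \<in> mono_up_diagrams r s" for h
    by (rule Kinv_closed[OF mono_mem(1)[OF that]])
  show "(\<Sum>h\<in>mono_up_diagrams r s. bcomp \<delta> (Kinv r s (basis h)) (pair_b \<delta> (basis (bar h)) y)) \<in> Bplus r s"
    by (intro Bplus_sum bcomp_Bplus[OF k S_hom_Bplus[OF b]])
  have "K_plus \<delta> 0 s (bcomp \<delta> (Kinv r s (basis h)) (pair_b \<delta> (basis (bar h)) y)) =
    bcomp \<delta> (basis h) (pair_b \<delta> (basis (bar h)) y)" if h: "h \<in> mono_up_diagrams r s" for h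
    by (simp add: K_plus_right[OF k[OF h] b[OF h]] K_plus_Kinv[OF mono_mem(1)[OF h]])
  then show "K_plus \<delta> 0 s (\<Sum>h\<in>mono_up_diagrams r s. bcomp \<delta> (Kinv r s (basis h)) (pair_b \<delta> (basis (bar h)) y)) = K_plus \<delta> 0 s y"
    by (simp add: lin_sum[OF lin_K_plus[OF lin_ident]] K_plus_eq[OF y])
qed

text \<open>Pairing with \<open>Kinv\<close> of \<open>h\<close> under \<open>b\<close> is pairing
  with \<open>h\<close> under \<open>b'\<close>, so the identity is inherited from
  \<open>d'\<close>.\<close>

lemma zigzag_minus_sum:
  assumes g: "g \<in> Bminus p q"
  shows "(\<Sum>h\<in>mono_up_diagrams q p. bcomp \<delta> (pair_b \<delta> g (Kinv q p (basis h))) (basis (bar h))) = g"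
proof -
  have "pair_b \<delta> g (Kinv q p (basis h)) = pair_b' g (basis h)" if h: "h \<in> mono_up_diagrams q p" for h
    using pair_b'_K_plus[OF g Kinv_closed[OF mono_mem(1)[OF h]], of \<delta> 0] by (simp add: K_plus_Kinv[OF mono_mem(1)[OF h]])
  then show ?thesis using b'_zigzag_minus[OF g, of \<delta>] by simp
qed

lemma K_functor_diag: "K_functor \<delta> p p (tensor_comp \<delta> (diag_tensor Kinv p)) = tensor_comp \<delta> (d'_one p)"
proof -
  have "K_functor \<delta> p p (bcomp \<delta> (Kinv s p (basis h)) (basis (bar h))) = bcomp \<delta> (basis h) (basis (bar h))"
    if h: "h \<in> mono_up_diagrams s p" for s h
    by (simp add: K_functor_comp[OF Kinv_closed[OF mono_mem(1)[OF h]] mono_mem(2)[OF h], of \<delta> 0]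
        K_plus_Kinv[OF mono_mem(1)[OF h]])
  then show ?thesis
    by (simp add: d'_one_eq tensor_comp_diag lin_sum[OF lin_K_functor[OF lin_ident]])
qed

text \<open>This will be \<open>pBrauer\<close> for the copairing \<open>cop\<close> constructed
  below, whose value at an identity is \<open>diag_tensor Kinv\<close>.\<close>

abbreviation pB :: "(nat, 'k mor) lin_cat" where
  "pB \<equiv> \<lparr>Hom = B_hom, Comp = pairing_comp \<delta> (pair_b \<delta>), Ident = (\<lambda>p. tensor_comp \<delta> (diag_tensor Kinv p))\<rparr>"

lemma diag_closed: "tensor_comp \<delta> (diag_tensor Kinv p) \<in> B_hom p p"
  by (rule tensor_comp_diag_closed) (rule Kinv_closed[OF mono_mem(1)])

lemma K_functor_iso: "linear_category_iso pB (mBrauer \<delta>) (K_functor \<delta>)"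
  unfolding mBrauer_eq
  by (rule B_hom_category_iso[OF mBrauer_category[unfolded mBrauer_eq]])
    (auto intro!: lin_intros lin_K_functor b.pairing_comp_closed K_functor_bij K_functor_pairing_comp K_functor_diag diag_closed)

lemma b'_act_K_functor:
  assumes x: "x \<in> B_hom p q" and w: "w \<in> Bplus t p"
  shows "b'.act \<delta> (K_functor \<delta> p q x) (K_plus \<delta> 0 p w) = K_plus \<delta> 0 q (b.act \<delta> x w)"
proof (rule B_hom_eqI[where F = "\<lambda>x. b'.act \<delta> (K_functor \<delta> p q x) (K_plus \<delta> 0 p w)" and
      G = "\<lambda>x. K_plus \<delta> 0 q (b.act \<delta> x w)", OF _ _ x])
  fix s u c assume "u \<in> up_diagrams s q" "c \<in> down_diagrams p s"
  then have m: "basis u \<in> Bplus s q" "basis c \<in> Bminus p s" by auto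
  show "b'.act \<delta> (K_functor \<delta> p q (bcomp \<delta> (basis u) (basis c))) (K_plus \<delta> 0 p w) =
    K_plus \<delta> 0 q (b.act \<delta> (bcomp \<delta> (basis u) (basis c)) w)"
  proof (cases "t = s")
    case True
    then have "pair_b \<delta> (basis c) w \<in> S_hom s s" using b.closed[OF m(2) w] by simp
    then show ?thesis
      by (simp add: K_functor_comp[OF m, of \<delta> 0] b'.act_comp[OF K_plus_closed[OF m(1)] m(2) K_plus_closed[OF w]]
          b.act_comp[OF m w] pair_b'_K_plus[OF m(2) w] K_plus_right[OF m(1)])
  next
    case False
    then have "pair_b \<delta> (basis c) w = 0" using S_hom_neq[OF b.closed[OF m(2) w]] by simp
    then show ?thesis
      by (simp add: K_functor_comp[OF m, of \<delta> 0] b'.act_comp[OF K_plus_closed[OF m(1)] m(2) K_plus_closed[OF w]]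
          b.act_comp[OF m w] pair_b'_K_plus[OF m(2) w] lin_zero[OF lin_bcomp] lin_zero[OF lin_K_plus[OF lin_ident]])
  qed
qed (intro b'.lin_act_left b.lin_act_left lin_K_functor lin_K_plus lin_intros)+

text \<open>\<open>K_functor\<close> and \<open>K_plus\<close> are bijective and intertwine the two
  actions, so faithfulness is inherited from \<open>b'\<close>.\<close>

lemma b_act_faithful:
  assumes x: "x \<in> B_hom p q" "y \<in> B_hom p q"
    and eq: "\<And>s w. w \<in> Bplus s p \<Longrightarrow> b.act \<delta> x w = b.act \<delta> y w"
  shows "x = y"
proof -
  have "K_functor \<delta> p q x = K_functor \<delta> p q y"
  proof (rule b'_act_faithful[OF K_functor_closed[OF x(1)] K_functor_closed[OF x(2)], where \<delta> = \<delta>])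
    fix s and w :: "'k mor" assume w: "w \<in> Bplus s p"
    note k = Kinv_closed[OF w]
    show "b'.act \<delta> (K_functor \<delta> p q x) w = b'.act \<delta> (K_functor \<delta> p q y) w"
      using b'_act_K_functor[OF x(1) k] b'_act_K_functor[OF x(2) k] eq[OF k] by (simp add: K_plus_Kinv[OF w])
  qed
  then show ?thesis using K_functor_bij[of p q] x by (auto simp: bij_betw_def inj_on_def)
qed

abbreviation Fd :: "nat \<Rightarrow> nat \<Rightarrow> 'k mor \<Rightarrow> 'k mor" where
  "Fd \<equiv> F_functor \<delta> (diag_tensor Kinv)"

text \<open>The copairing identity collapses the sum over \<open>h\<close>, leaving
  \<open>plus_part f\<close> applied to the upward part of \<open>rest_part f\<close> composed with
  \<open>w\<close>; composition with an upward diagram commutes with the projection.\<close>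

lemma b_act_Fd:
  assumes x: "x \<in> B_hom p q" and w: "w \<in> Bplus r p"
  shows "b.act \<delta> (Fd p q x) w = upart (bcomp \<delta> x w)"
proof (rule lin_eq_on[where F = "\<lambda>x. b.act \<delta> (Fd p q x) w" and G = "\<lambda>x. upart (bcomp \<delta> x w)", OF _ _ _ x[unfolded B_hom_def]])
  fix f assume f: "f \<in> diagrams p q"
  define s where "s = through f"
  note parts = diagram_parts[OF f, folded s_def]
  have P: "basis (plus_part f) \<in> Bplus s q" and R: "basis (rest_part f) \<in> Bminus p s"
    using parts by (auto intro: mono_up_up)
  note Rw = bcomp_closed[OF Bminus_B_hom[OF R] Bplus_B_hom[OF w], where \<delta> = \<delta>]
  let ?y = "upart (bcomp \<delta> (basis (rest_part f)) w)"
  have "b.act \<delta> (Fd p q (basis f)) w = bcomp \<delta> (basis (plus_part f))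
    (\<Sum>h\<in>mono_up_diagrams r s. bcomp \<delta> (Kinv r s (basis h)) (pair_b \<delta> (bcomp \<delta> (basis (bar h)) (basis (rest_part f))) w))"
    unfolding s_def by (rule b.act_F_functor[where \<kappa> = Kinv, OF Kinv_closed[OF mono_mem(1)] f w])
  also have "\<dots> = bcomp \<delta> (basis (plus_part f))
    (\<Sum>h\<in>mono_up_diagrams r s. bcomp \<delta> (Kinv r s (basis h)) (pair_b \<delta> (basis (bar h)) ?y))"
    by (simp add: pair_b_upart[OF mono_mem(2) R w])
  also have "\<dots> = bcomp \<delta> (basis (plus_part f)) ?y"
    by (simp add: zigzag_plus_sum[OF upart_closed[OF Rw]])
  also have "\<dots> = upart (bcomp \<delta> (basis (plus_part f)) (bcomp \<delta> (basis (rest_part f)) w))"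
    by (rule upart_bcomp_left[OF P Rw, symmetric])
  also have "bcomp \<delta> (basis (plus_part f)) (bcomp \<delta> (basis (rest_part f)) w) = bcomp \<delta> (basis f) w"
    using bcomp_assoc[OF Bplus_B_hom[OF P] Bminus_B_hom[OF R] Bplus_B_hom[OF w], where \<delta> = \<delta>]
      basis_parts[OF f, where \<delta> = \<delta>] by metis
  finally show "b.act \<delta> (Fd p q (basis f)) w = upart (bcomp \<delta> (basis f) w)" .
qed (intro b.lin_act_left lin_F_functor lin_upart lin_intros)+

lemma Fd_bij: "bij_betw (Fd p q) (B_hom p q) (B_hom p q)"
  by (rule F_functor_bij[OF Kinv_closed[OF mono_mem(1)] Kinv_one])

text \<open>Both sides of functoriality act on \<open>w\<close> as the upward part of
  \<open>f\<close>, \<open>g\<close>, \<open>w\<close> composed: by \<open>upart_bcomp_right\<close>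
  it makes no difference whether the inner composite is projected first.\<close>

lemma Fd_iso: "linear_category_iso (Brauer \<delta>) pB Fd"
  unfolding Brauer_def
proof (rule B_hom_category_iso)
  interpret K: linear_category_iso pB "mBrauer \<delta>" "K_functor \<delta>" by (rule K_functor_iso)
  show "linear_category pB" by (rule K.source.linear_category_axioms)
  show "Fd p p (one p) = tensor_comp \<delta> (diag_tensor Kinv p)" for p
    by (rule F_functor_one) (rule Kinv_closed[OF mono_mem(1)])
  fix p q r and f g :: "'k mor" assume f: "f \<in> B_hom q r" and g: "g \<in> B_hom p q"
  have m: "Fd p q x \<in> B_hom p q" if "x \<in> B_hom p q" for p q x
    using Fd_bij[of p q] that by (auto simp: bij_betw_def)
  note fg = bcomp_closed[OF f g, where \<delta> = \<delta>]
  show "Fd p r (bcomp \<delta> f g) = pairing_comp \<delta> (pair_b \<delta>) (Fd q r f) (Fd p q g)"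
  proof (rule b_act_faithful[OF m[OF fg] b.pairing_comp_closed[OF m[OF f] m[OF g]]])
    fix s and w :: "'k mor" assume w: "w \<in> Bplus s p"
    note gw = bcomp_closed[OF g Bplus_B_hom[OF w], where \<delta> = \<delta>]
    show "b.act \<delta> (Fd p r (bcomp \<delta> f g)) w = b.act \<delta> (pairing_comp \<delta> (pair_b \<delta>) (Fd q r f) (Fd p q g)) w"
      unfolding b_act_Fd[OF fg w] b.act_pairing_comp[OF m[OF f] m[OF g] w] b_act_Fd[OF g w]
        b_act_Fd[OF f upart_closed[OF gw]] upart_bcomp_right[OF f gw]
        bcomp_assoc[OF f g Bplus_B_hom[OF w]] ..
  qed
qed (auto intro!: lin_intros lin_F_functor Fd_bij)

end

section \<open>The copairing of \<open>b\<close>\<close>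

interpretation smul_module: Modules.module "smul :: 'k::comm_ring_1 \<Rightarrow> ('a \<Rightarrow>\<^sub>0 'k) \<Rightarrow> ('a \<Rightarrow>\<^sub>0 'k)"
  by (rule module_smul)

context
  fixes \<delta> :: "'k::comm_ring_1" and M N :: "nat \<Rightarrow> nat \<Rightarrow> 'k mor set" and p q :: nat
begin

private abbreviation te where "te \<equiv> tensor_eq \<delta> M N p q"

lemma tensor_eq_refl: "te t t"
  by (simp add: tensor_eq_def smul_module.span_zero)

lemma tensor_eq_sym: "te t t' \<Longrightarrow> te t' t"
  unfolding tensor_eq_def using smul_module.span_neg by fastforce

lemma tensor_eq_trans: "te t t' \<Longrightarrow> te t' t'' \<Longrightarrow> te t t''"
  unfolding tensor_eq_def using smul_module.span_add[of "t - t'" _ "t' - t''"] by simp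

lemma tensor_eq_add: "te a a' \<Longrightarrow> te b b' \<Longrightarrow> te (a + b) (a' + b')"
  unfolding tensor_eq_def using smul_module.span_add[of "a - a'" _ "b - b'"] by (simp add: algebra_simps)

lemma tensor_eq_smul: "te a a' \<Longrightarrow> te (smul c a) (smul c a')"
  unfolding tensor_eq_def
  using smul_module.span_scale[of "a - a'" _ c] smul_module.scale_right_diff_distrib[of c a a'] by simp

lemma tensor_eq_sum: "(\<And>i. i \<in> I \<Longrightarrow> te (a i) (b i)) \<Longrightarrow> te (\<Sum>i\<in>I. a i) (\<Sum>i\<in>I. b i)"
  by (induction I rule: infinite_finite_induct) (auto simp: tensor_eq_refl tensor_eq_add)

lemma tensor_eq_relation: "a - b \<in> tensor_relations \<delta> M N p q \<Longrightarrow> te a b"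
  unfolding tensor_eq_def by (rule smul_module.span_base)

lemma tensor_eq_add_left: "u \<in> M s q \<Longrightarrow> u' \<in> M s q \<Longrightarrow> v \<in> N p s \<Longrightarrow>
    te (basis (s, u + u', v)) (basis (s, u, v) + basis (s, u', v))"
  by (rule tensor_eq_relation) (auto simp: tensor_relations_def diff_diff_eq[symmetric])

lemma tensor_eq_add_right: "u \<in> M s q \<Longrightarrow> v \<in> N p s \<Longrightarrow> v' \<in> N p s \<Longrightarrow>
    te (basis (s, u, v + v')) (basis (s, u, v) + basis (s, u, v'))"
  by (rule tensor_eq_relation) (auto simp: tensor_relations_def diff_diff_eq[symmetric])

lemma tensor_eq_smul_left: "u \<in> M s q \<Longrightarrow> v \<in> N p s \<Longrightarrow> te (basis (s, smul c u, v)) (smul c (basis (s, u, v)))"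
  by (rule tensor_eq_relation) (auto simp: tensor_relations_def)

lemma tensor_eq_smul_right: "u \<in> M s q \<Longrightarrow> v \<in> N p s \<Longrightarrow> te (basis (s, u, smul c v)) (smul c (basis (s, u, v)))"
  by (rule tensor_eq_relation) (auto simp: tensor_relations_def)

lemma tensor_eq_balanced: "u \<in> M s q \<Longrightarrow> x \<in> S_hom s s \<Longrightarrow> v \<in> N p s \<Longrightarrow>
    te (basis (s, bcomp \<delta> u x, v)) (basis (s, u, bcomp \<delta> x v))"
  by (rule tensor_eq_relation) (auto simp: tensor_relations_def)

end

lemma act_left_diag:
  "act_left \<delta> x (diag_tensor \<kappa> p) = (\<Sum>s\<in>{s. prec s p}. \<Sum>h\<in>mono_up_diagrams s p.
    basis (s, bcomp \<delta> x (\<kappa> s p (basis h)), basis (bar h)))"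
  by (simp add: act_left_def lin_ext_diag_tensor)

lemma act_left_sum: "act_left \<delta> x (\<Sum>i\<in>I. t i) = (\<Sum>i\<in>I. act_left \<delta> x (t i))"
  unfolding act_left_def by (rule lin_sum[OF lin_lin_ext])

lemma act_right_sum: "act_right \<delta> (\<Sum>i\<in>I. t i) x = (\<Sum>i\<in>I. act_right \<delta> (t i) x)"
  unfolding act_right_def by (rule lin_sum[OF lin_lin_ext])

lemma act_basis:
  "act_left \<delta> x (basis (s, u, v)) = basis (s, bcomp \<delta> x u, v)"
  "act_right \<delta> (basis (s, u, v)) x = basis (s, u, bcomp \<delta> v x)"
  by (simp_all add: act_left_def act_right_def)

text \<open>For statements up to \<open>tensor_eq\<close>, whose two sides are additive and
  homogeneous only modulo the tensor relations, so that \<open>lin_eq_on\<close> does not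
  apply.\<close>

lemma free_on_induct:
  assumes "v \<in> free_on X" and "P 0"
    and step: "\<And>c a v. a \<in> X \<Longrightarrow> v \<in> free_on X \<Longrightarrow> P v \<Longrightarrow> P (smul c (basis a) + v)"
  shows "P v"
proof -
  have "P (\<Sum>a\<in>A. smul (Poly_Mapping.lookup v a) (basis a)) \<and>
    (\<Sum>a\<in>A. smul (Poly_Mapping.lookup v a) (basis a)) \<in> free_on X"
    if "finite A" "A \<subseteq> X" for A
    using that
  proof (induction A rule: finite_induct)
    case (insert a A)
    then show ?case using step[of a "\<Sum>a\<in>A. smul (Poly_Mapping.lookup v a) (basis a)"]
      by (auto intro!: free_on_add free_on_smul)
  qed (use assms in auto)
  from this[of "Poly_Mapping.keys v"] show ?thesis
    using assms(1) by (simp add: free_on_def flip: free_on_expand)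
qed

context invertible_K_plus
begin

text \<open>The copairing is generated from its value at the identity by left multiplication. Left
  linearity is thus built in, and right linearity is what has to be proved.\<close>

definition cop :: "nat \<Rightarrow> nat \<Rightarrow> 'k mor \<Rightarrow> 'k tens" where
  "cop p q x = act_left \<delta> x (diag_tensor Kinv p)"

lemma Kinv_mono: "h \<in> mono_up_diagrams s p \<Longrightarrow> Kinv s p (basis h) \<in> Bplus s p"
  by (rule Kinv_closed[OF mono_mem(1)])

lemma cop_eq: "cop p q x = (\<Sum>s\<in>{s. prec s p}. \<Sum>h\<in>mono_up_diagrams s p.
    basis (s, bcomp \<delta> x (Kinv s p (basis h)), basis (bar h)))"
  by (simp add: cop_def act_left_diag)

lemma cop_one: "cop p p (one p) = diag_tensor Kinv p"
  unfolding cop_eq diag_tensor_def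
  by (intro sum.cong refl) (simp add: bcomp_one_left[OF Bplus_B_hom[OF Kinv_mono]])

lemma S_bcomp_Bplus: "x \<in> S_hom p q \<Longrightarrow> u \<in> Bplus s p \<Longrightarrow> bcomp \<delta> x u \<in> Bplus s q"
  by (rule bcomp_Bplus[OF S_hom_Bplus])

text \<open>Write \<open>hat_comp \<tau> h\<close> as \<open>hat_comp k \<sigma>\<close>. Moving
  \<open>\<sigma>\<close> across the tensor sign turns the summand of \<open>h\<close> on the left
  into the summand of \<open>k\<close> on the right.\<close>

lemma cop_right_basis:
  assumes x: "x \<in> S_hom p q" and \<tau>: "\<tau> \<in> level_diagrams p p"
  shows "tensor_eq \<delta> Bplus Bminus p q (cop p q (bcomp \<delta> x (basis \<tau>))) (act_right \<delta> (cop p q x) (basis \<tau>))"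
proof -
  have \<tau>S: "basis \<tau> \<in> S_hom p p" using \<tau> by simp
  let ?\<pi> = "\<lambda>h. plus_part (hat_comp \<tau> h)"
  have *: "tensor_eq \<delta> Bplus Bminus p q
    (\<Sum>h\<in>mono_up_diagrams s p. basis (s, bcomp \<delta> (bcomp \<delta> x (basis \<tau>)) (Kinv s p (basis h)), basis (bar h)))
    (\<Sum>h\<in>mono_up_diagrams s p. basis (s, bcomp \<delta> x (Kinv s p (basis h)), bcomp \<delta> (basis (bar h)) (basis \<tau>)))" for s
  proof -
    have "tensor_eq \<delta> Bplus Bminus p q
      (basis (s, bcomp \<delta> (bcomp \<delta> x (basis \<tau>)) (Kinv s p (basis h)), basis (bar h)))
      (basis (s, bcomp \<delta> x (Kinv s p (basis (?\<pi> h))), bcomp \<delta> (basis (bar (?\<pi> h))) (basis \<tau>)))"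
      if h: "h \<in> mono_up_diagrams s p" for h
    proof -
      define k \<sigma> where "k = ?\<pi> h" and "\<sigma> = rest_part (hat_comp \<tau> h)"
      note L = level_times_mono[OF \<tau> h, folded k_def \<sigma>_def]
      have \<sigma>S: "basis \<sigma> \<in> S_hom s s" using L(2) by simp
      have th: "bcomp \<delta> (basis \<tau>) (basis h) = bcomp \<delta> (basis k) (basis \<sigma>)"
        by (simp add: bcomp_up_basis[OF level_up[OF \<tau>] mono_up_diagramsD[OF h]]
            bcomp_up_basis[OF mono_up_up[OF L(1)] level_diagramsD[OF L(2)]] L(3))
      have bb: "bcomp \<delta> (basis \<sigma>) (basis (bar h)) = bcomp \<delta> (basis (bar k)) (basis \<tau>)"
        by (simp add: bcomp_up_basis[OF level_up[OF L(2)] bar_closed[OF mono_up_diagramsD[OF h]]]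
            bcomp_down_basis[OF bar_closed[OF mono_up_diagramsD[OF L(1)]] level_down[OF \<tau>]] L(4))
      have "bcomp \<delta> (bcomp \<delta> x (basis \<tau>)) (Kinv s p (basis h)) = bcomp \<delta> x (bcomp \<delta> (basis \<tau>) (Kinv s p (basis h)))"
        by (rule bcomp_assoc[OF S_hom_B_hom[OF x] S_hom_B_hom[OF \<tau>S] Bplus_B_hom[OF Kinv_mono[OF h]]])
      also have "bcomp \<delta> (basis \<tau>) (Kinv s p (basis h)) = bcomp \<delta> (Kinv s p (basis k)) (basis \<sigma>)"
        using Kinv_left[OF mono_mem(1)[OF h] \<tau>S] Kinv_right[OF mono_mem(1)[OF L(1)] \<sigma>S] th by simp
      also have "bcomp \<delta> x (bcomp \<delta> (Kinv s p (basis k)) (basis \<sigma>)) = bcomp \<delta> (bcomp \<delta> x (Kinv s p (basis k))) (basis \<sigma>)"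
        by (rule bcomp_assoc[symmetric, OF S_hom_B_hom[OF x] Bplus_B_hom[OF Kinv_mono[OF L(1)]] S_hom_B_hom[OF \<sigma>S]])
      finally show ?thesis
        using tensor_eq_balanced[of "bcomp \<delta> x (Kinv s p (basis k))" Bplus s q "basis \<sigma>" "basis (bar h)" Bminus p \<delta>,
            OF S_bcomp_Bplus[OF x Kinv_mono[OF L(1)]] \<sigma>S mono_mem(2)[OF h]] bb
        by (simp add: k_def)
    qed
    then have "tensor_eq \<delta> Bplus Bminus p q
      (\<Sum>h\<in>mono_up_diagrams s p. basis (s, bcomp \<delta> (bcomp \<delta> x (basis \<tau>)) (Kinv s p (basis h)), basis (bar h)))
      (\<Sum>h\<in>mono_up_diagrams s p. basis (s, bcomp \<delta> x (Kinv s p (basis (?\<pi> h))), bcomp \<delta> (basis (bar (?\<pi> h))) (basis \<tau>)))"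
      by (rule tensor_eq_sum)
    \<comment> \<open>Passing from \<open>h\<close> to \<open>k\<close> permutes the monotone
      diagrams, so the sum may be reindexed.\<close>
    also have "(\<Sum>h\<in>mono_up_diagrams s p. basis (s, bcomp \<delta> x (Kinv s p (basis (?\<pi> h))), bcomp \<delta> (basis (bar (?\<pi> h))) (basis \<tau>))) =
      (\<Sum>h\<in>mono_up_diagrams s p. basis (s, bcomp \<delta> x (Kinv s p (basis h)), bcomp \<delta> (basis (bar h)) (basis \<tau>)) :: 'k tens)"
      by (rule sum.reindex_bij_betw[OF level_times_mono_bij[OF \<tau>]])
    finally show ?thesis .
  qed
  show ?thesis unfolding cop_eq act_right_sum act_basis by (rule tensor_eq_sum) (rule *)
qed

lemma cop_add:
  assumes x: "x \<in> S_hom p q" and y: "y \<in> S_hom p q"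
  shows "tensor_eq \<delta> Bplus Bminus p q (cop p q (x + y)) (cop p q x + cop p q y)"
  unfolding cop_eq sum.distrib[symmetric] lin_add[OF lin_bcomp_left[OF lin_ident]]
  by (intro tensor_eq_sum tensor_eq_add_left S_bcomp_Bplus[OF x] S_bcomp_Bplus[OF y] Kinv_mono mono_mem(2))

lemma cop_smul:
  assumes x: "x \<in> S_hom p q"
  shows "tensor_eq \<delta> Bplus Bminus p q (cop p q (smul c x)) (smul c (cop p q x))"
  unfolding cop_eq smul_sum lin_smul[OF lin_bcomp_left[OF lin_ident]]
  by (intro tensor_eq_sum tensor_eq_smul_left S_bcomp_Bplus[OF x] Kinv_mono mono_mem(2))

lemma act_right_cop_add:
  assumes x: "x \<in> S_hom p q" and y: "y \<in> S_hom r p" and z: "z \<in> S_hom r p"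
  shows "tensor_eq \<delta> Bplus Bminus r q (act_right \<delta> (cop p q x) (y + z)) (act_right \<delta> (cop p q x) y + act_right \<delta> (cop p q x) z)"
  unfolding cop_eq act_right_sum act_basis sum.distrib[symmetric] lin_add[OF lin_bcomp]
  by (intro tensor_eq_sum tensor_eq_add_right S_bcomp_Bplus[OF x] Kinv_mono
      bcomp_Bminus[OF mono_mem(2) S_hom_Bminus[OF y]] bcomp_Bminus[OF mono_mem(2) S_hom_Bminus[OF z]])

lemma act_right_cop_smul:
  assumes x: "x \<in> S_hom p q" and y: "y \<in> S_hom r p"
  shows "tensor_eq \<delta> Bplus Bminus r q (act_right \<delta> (cop p q x) (smul c y)) (smul c (act_right \<delta> (cop p q x) y))"
  unfolding cop_eq act_right_sum act_basis smul_sum lin_smul[OF lin_bcomp]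
  by (intro tensor_eq_sum tensor_eq_smul_right S_bcomp_Bplus[OF x] Kinv_mono
      bcomp_Bminus[OF mono_mem(2) S_hom_Bminus[OF y]])

lemma cop_right:
  assumes x: "x \<in> S_hom p q" and y: "y \<in> S_hom r p"
  shows "tensor_eq \<delta> Bplus Bminus r q (cop r q (bcomp \<delta> x y)) (act_right \<delta> (cop p q x) y)"
    (is "?P y")
  using y unfolding S_hom_def
proof (rule free_on_induct)
  have S0: "0 \<in> S_hom r q" "0 \<in> S_hom r p" by (simp_all add: S_hom_def)
  have "tensor_eq \<delta> Bplus Bminus r q (cop r q 0) 0"
    using cop_smul[OF S0(1), of 0] by simp
  moreover have "tensor_eq \<delta> Bplus Bminus r q (act_right \<delta> (cop p q x) 0) 0"
    using act_right_cop_smul[OF x S0(2), of 0] by simp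
  ultimately show "?P 0"
    using tensor_eq_trans tensor_eq_sym by (simp add: lin_zero[OF lin_bcomp]) blast
  fix c :: 'k and \<tau> and v :: "'k mor" assume \<tau>: "\<tau> \<in> level_diagrams r p" and v: "v \<in> free_on (level_diagrams r p)" and P: "?P v"
  have vS: "v \<in> S_hom r p" and \<tau>S: "basis \<tau> \<in> S_hom r p" using v \<tau> by (auto simp: S_hom_def)
  have rp: "r = p" using level_diagrams_eq[OF \<tau>] .
  have c\<tau>: "smul c (basis \<tau>) \<in> S_hom r p" using \<tau>S unfolding S_hom_def by (rule free_on_smul)
  let ?t = "tensor_eq \<delta> Bplus Bminus r q" and ?R = "act_right \<delta> (cop p q x)"
  have 1: "?t (cop r q (bcomp \<delta> x (smul c (basis \<tau>) + v)))
    (cop r q (smul c (bcomp \<delta> x (basis \<tau>))) + cop r q (bcomp \<delta> x v))"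
    unfolding lin_add[OF lin_bcomp] lin_smul[OF lin_bcomp, symmetric]
    by (rule cop_add[OF bcomp_S_hom[OF x c\<tau>] bcomp_S_hom[OF x vS]])
  have 2: "?t (cop r q (smul c (bcomp \<delta> x (basis \<tau>))) + cop r q (bcomp \<delta> x v))
    (smul c (cop r q (bcomp \<delta> x (basis \<tau>))) + ?R v)"
    by (rule tensor_eq_add[OF cop_smul[OF bcomp_S_hom[OF x \<tau>S]] P])
  have 3: "?t (smul c (cop r q (bcomp \<delta> x (basis \<tau>))) + ?R v) (smul c (?R (basis \<tau>)) + ?R v)"
    using cop_right_basis[of x p q \<tau>] x \<tau> rp by (intro tensor_eq_add tensor_eq_smul tensor_eq_refl) simp
  have 4: "?t (smul c (?R (basis \<tau>)) + ?R v) (?R (smul c (basis \<tau>)) + ?R v)"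
    by (intro tensor_eq_add tensor_eq_refl tensor_eq_sym[OF act_right_cop_smul[OF x \<tau>S]])
  have 5: "?t (?R (smul c (basis \<tau>)) + ?R v) (?R (smul c (basis \<tau>) + v))"
    by (rule tensor_eq_sym[OF act_right_cop_add[OF x c\<tau> vS]])
  show "?P (smul c (basis \<tau>) + v)"
    by (rule tensor_eq_trans[OF 1 tensor_eq_trans[OF 2 tensor_eq_trans[OF 3 tensor_eq_trans[OF 4 5]]]])
qed

lemma cop_copairing: "copairing \<delta> cop"
proof
  fix p q r and x y :: "'k mor" and c assume x: "x \<in> S_hom p q"
  show "cop p q x \<in> tensors Bplus Bminus p q"
    unfolding cop_eq tensors_def
    by (intro free_on_sum) (auto intro: S_bcomp_Bplus[OF x Kinv_mono] mono_mem(2) simp del: basis_mem)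
  show "tensor_eq \<delta> Bplus Bminus p q (cop p q (x + y)) (cop p q x + cop p q y)" if "y \<in> S_hom p q"
    by (rule cop_add[OF x that])
  show "tensor_eq \<delta> Bplus Bminus p q (cop p q (smul c x)) (smul c (cop p q x))"
    by (rule cop_smul[OF x])
  show "tensor_eq \<delta> Bplus Bminus p r (cop p r (bcomp \<delta> y x)) (act_left \<delta> y (cop p q x))" if y: "y \<in> S_hom q r"
  proof -
    have "cop p r (bcomp \<delta> y x) = act_left \<delta> y (cop p q x)"
      unfolding cop_eq act_left_sum act_basis
      by (intro sum.cong refl)
        (simp add: bcomp_assoc[OF S_hom_B_hom[OF y] S_hom_B_hom[OF x] Bplus_B_hom[OF Kinv_mono]])
    then show ?thesis by (simp add: tensor_eq_refl)
  qed
  show "tensor_eq \<delta> Bplus Bminus r q (cop r q (bcomp \<delta> x y)) (act_right \<delta> (cop p q x) y)" if "y \<in> S_hom r p"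
    by (rule cop_right[OF x that])
next
  fix p q and f :: "'k mor" assume f: "f \<in> Bplus p q"
  \<comment> \<open>The summands through \<open>s\<close> pair with \<open>f\<close> to a morphism
    of level diagrams from \<open>p\<close> to \<open>s\<close>, which is zero unless
    \<open>s = p\<close>.\<close>
  have "pair_b \<delta> (basis (bar h)) f = 0" if "h \<in> mono_up_diagrams s q" "s \<noteq> p" for s h
    using S_hom_neq[OF b.closed[OF mono_mem(2)[OF that(1)] f]] that by simp
  then show "lin_ext (\<lambda>(s, u, v). bcomp \<delta> u (pair_b \<delta> v f)) (cop q q (one q)) = f"
    unfolding cop_one lin_ext_diag_tensor prod.case
    by (subst diag_sum_single[where t = p]) (simp_all add: lin_zero[OF lin_bcomp] zigzag_plus_sum[OF f])
next
  fix p q and g :: "'k mor" assume g: "g \<in> Bminus p q"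
  have "pair_b \<delta> g (Kinv s p (basis h)) = 0" if "h \<in> mono_up_diagrams s p" "s \<noteq> q" for s h
    using S_hom_neq[OF b.closed[OF g Kinv_mono[OF that(1)]]] that by simp
  then show "lin_ext (\<lambda>(s, u, v). bcomp \<delta> (pair_b \<delta> g u) v) (cop p p (one p)) = g"
    unfolding cop_one lin_ext_diag_tensor prod.case
    by (subst diag_sum_single[where t = q])
      (simp_all add: lin_zero[OF lin_bcomp_left[OF lin_ident]] zigzag_minus_sum[OF g])
qed

lemma isomorphisms:
  "\<exists>d. copairing \<delta> d \<and> linear_category_iso (Brauer \<delta>) (pBrauer \<delta> d) (F_d \<delta> d) \<and>
    linear_category_iso (pBrauer \<delta> d) (mBrauer \<delta>) (K_functor \<delta>)"
proof (intro exI conjI)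
  have p: "pBrauer \<delta> cop = pB" by (simp add: pBrauer_def cop_one)
  have F: "F_d \<delta> cop = Fd" by (simp add: F_d_def cop_one)
  show "copairing \<delta> cop" by (rule cop_copairing)
  show "linear_category_iso (Brauer \<delta>) (pBrauer \<delta> cop) (F_d \<delta> cop)" unfolding p F by (rule Fd_iso)
  show "linear_category_iso (pBrauer \<delta> cop) (mBrauer \<delta>) (K_functor \<delta>)" unfolding p by (rule K_functor_iso)
qed

end

text \<open>On upward morphisms \<open>K_functor\<close> is \<open>K_plus\<close>, so injectivity
  restricts. For surjectivity, a preimage of an upward morphism is projected to upward diagrams,
  which \<open>K_functor\<close> respects.\<close>

lemma K_functor_bij_imp:
  fixes \<delta> :: "'k::comm_ring_1"
  assumes bij: "bij_betw (K_functor \<delta> p q) (B_hom p q) (B_hom p q)"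
  shows "bij_betw (K_plus \<delta> p q) (Bplus p q) (Bplus p q)"
proof -
  have eq: "K_functor \<delta> p q u = K_plus \<delta> p q u" if u: "u \<in> Bplus p q" for u
    using K_functor_comp[OF u one_mem(4), of \<delta> p] bcomp_one_right[OF Bplus_B_hom[OF u], of \<delta>]
      bcomp_one_right[OF Bplus_B_hom[OF K_plus_closed[OF u]], of \<delta> \<delta> p] by simp
  have up: "upart (K_functor \<delta> p q x) = K_functor \<delta> p q (upart x)" if "x \<in> B_hom p q" for x
  proof (rule B_hom_eqI[where F = "\<lambda>x. upart (K_functor \<delta> p q x)" and G = "\<lambda>x. K_functor \<delta> p q (upart x)", OF _ _ that])
    fix s u c assume u: "u \<in> up_diagrams s q" and c: "c \<in> down_diagrams p s"
    then have m: "basis u \<in> Bplus s q" "basis c \<in> Bminus p s" by auto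
    have uc: "upart (basis c) \<in> (Bminus p s :: 'k mor set)"
      using c by (simp add: upart_basis) (simp add: Bminus_def)
    show "upart (K_functor \<delta> p q (bcomp \<delta> (basis u) (basis c))) = K_functor \<delta> p q (upart (bcomp \<delta> (basis u) (basis c)))"
      by (simp add: upart_bcomp_left[OF m(1) Bminus_B_hom[OF m(2)]] K_functor_comp[OF m, of \<delta> 0]
          K_functor_comp[OF m(1) uc, of \<delta> 0] upart_bcomp_left[OF K_plus_closed[OF m(1)] Bminus_B_hom[OF m(2)]])
  qed (intro lin_upart lin_K_functor lin_intros)+
  have "K_plus \<delta> p q ` Bplus p q = Bplus p q"
  proof
    show "K_plus \<delta> p q ` Bplus p q \<subseteq> Bplus p q" using K_plus_closed by blast
    show "Bplus p q \<subseteq> K_plus \<delta> p q ` Bplus p q"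
    proof
      fix y :: "'k mor" assume y: "y \<in> Bplus p q"
      then have "y \<in> K_functor \<delta> p q ` B_hom p q" using bij Bplus_B_hom[OF y] by (simp add: bij_betw_def)
      then obtain x where x: "x \<in> B_hom p q" "y = K_functor \<delta> p q x" by blast
      note ux = upart_closed[OF x(1)]
      have "y = K_plus \<delta> p q (upart x)" using up[OF x(1)] upart_Bplus[OF y] eq[OF ux] x(2) by simp
      then show "y \<in> K_plus \<delta> p q ` Bplus p q" using ux by blast
    qed
  qed
  moreover have "inj_on (K_plus \<delta> p q) (Bplus p q)"
  proof (rule inj_onI)
    fix x y assume x: "x \<in> Bplus p q" and y: "y \<in> Bplus p q" and "K_plus \<delta> p q x = K_plus \<delta> p q y"
    then have "K_functor \<delta> p q x = K_functor \<delta> p q y" by (simp add: eq)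
    then show "x = y" using bij Bplus_B_hom[OF x] Bplus_B_hom[OF y] by (auto simp: bij_betw_def dest: inj_onD)
  qed
  ultimately show ?thesis by (simp add: bij_betw_def)
qed

section \<open>The Gram determinant\<close>

lemma free_on_enum:
  fixes N :: nat
  assumes e: "bij_betw e {..<N} U" and v: "v \<in> free_on U" and F: "lin F"
  shows "F v = (\<Sum>k<N. smul (Poly_Mapping.lookup v (e k)) (F (basis (e k))))"
proof -
  have fin: "finite U" using bij_betw_finite[OF e] by simp
  have "F v = lin_ext (\<lambda>a. F (basis a)) v" unfolding lin_ext_def by (rule lin_expand[OF F])
  also have "\<dots> = (\<Sum>a\<in>U. smul (Poly_Mapping.lookup v a) (F (basis a)))"
    by (rule lin_ext_superset[OF fin]) (use v in \<open>simp add: free_on_def\<close>)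
  also have "\<dots> = (\<Sum>k<N. smul (Poly_Mapping.lookup v (e k)) (F (basis (e k))))"
    by (rule sum.reindex_bij_betw[OF e, symmetric])
  finally show ?thesis .
qed

lemma lookup_basis: "Poly_Mapping.lookup (basis a) b = (if a = b then 1 else 0)"
  by (simp add: basis_def lookup_single when_def)

text \<open>Preimages of the basis vectors form a right inverse matrix, so the determinant is a
  unit. Conversely, the adjugate divided by the determinant is a two-sided inverse over any
  commutative ring.\<close>

lemma lin_bij_iff_det:
  fixes F :: "('a \<Rightarrow>\<^sub>0 'k::comm_ring_1) \<Rightarrow> ('a \<Rightarrow>\<^sub>0 'k)"
  assumes l: "lin F" and cl: "\<And>v. v \<in> free_on U \<Longrightarrow> F v \<in> free_on U" and e: "bij_betw e {..<N} U"
  defines "A \<equiv> mat N N (\<lambda>(i, j). Poly_Mapping.lookup (F (basis (e j))) (e i))"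
  shows "bij_betw F (free_on U) (free_on U) \<longleftrightarrow> Determinant.det A dvd 1"
proof
  have eU: "e k \<in> U" if "k < N" for k using e that by (auto simp: bij_betw_def)
  have e_eq: "e i = e j \<longleftrightarrow> i = j" if "i < N" "j < N" for i j
    using e that by (auto simp: bij_betw_def inj_on_def)
  have A: "A \<in> carrier_mat N N" by (simp add: A_def)
  {
    assume bij: "bij_betw F (free_on U) (free_on U)"
    have "\<exists>w. w \<in> free_on U \<and> F w = basis (e j)" if "j < N" for j
    proof -
      have "basis (e j) \<in> F ` free_on U" using bij eU[OF that] by (simp add: bij_betw_def)
      then show ?thesis by (metis imageE)
    qed
    then obtain g where g: "\<And>j. j < N \<Longrightarrow> g j \<in> free_on U" "\<And>j. j < N \<Longrightarrow> F (g j) = basis (e j)" by metis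
    define B where "B = mat N N (\<lambda>(i, j). Poly_Mapping.lookup (g j) (e i))"
    have B: "B \<in> carrier_mat N N" by (simp add: B_def)
    have "A * B = 1\<^sub>m N"
    proof (rule eq_matI)
      fix i j assume "i < dim_row (1\<^sub>m N)" "j < dim_col (1\<^sub>m N)"
      then have ij: "i < N" "j < N" by auto
      have "(A * B) $$ (i, j) = (\<Sum>k<N. Poly_Mapping.lookup (F (basis (e k))) (e i) * Poly_Mapping.lookup (g j) (e k))"
        using ij by (simp add: A_def B_def scalar_prod_def atLeast0LessThan)
      also have "\<dots> = Poly_Mapping.lookup (F (g j)) (e i)"
        by (subst free_on_enum[OF e g(1)[OF ij(2)] l]) (simp add: lookup_sum mult.commute)
      also have "\<dots> = 1\<^sub>m N $$ (i, j)" using ij by (auto simp: g(2) lookup_basis e_eq)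
      finally show "(A * B) $$ (i, j) = 1\<^sub>m N $$ (i, j)" .
    qed (use A B in auto)
    then have "Determinant.det A * Determinant.det B = 1" using det_mult[OF A B] by simp
    then show "Determinant.det A dvd 1" by (metis dvdI)
  }
  assume "Determinant.det A dvd 1"
  then obtain d where d: "Determinant.det A * d = 1" by (metis dvdE)
  define C where "C = d \<cdot>\<^sub>m adj_mat A"
  note adj = adj_mat[OF A]
  have C: "C \<in> carrier_mat N N" using adj(1) by (simp add: C_def)
  have AC: "A * C = 1\<^sub>m N" and CA: "C * A = 1\<^sub>m N"
  proof -
    have "d \<cdot>\<^sub>m (Determinant.det A \<cdot>\<^sub>m 1\<^sub>m N) = 1\<^sub>m N"
      by (rule eq_matI) (use d in \<open>auto simp: mult.commute\<close>)
    then show "A * C = 1\<^sub>m N" "C * A = 1\<^sub>m N"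
      using adj A by (simp_all add: C_def mult_smult_distrib mult_smult_assoc_mat)
  qed
  have sums: "(\<Sum>k<N. A $$ (i, k) * C $$ (k, j)) = (if i = j then 1 else 0)"
    "(\<Sum>k<N. C $$ (i, k) * A $$ (k, j)) = (if i = j then 1 else 0)" if ij: "i < N" "j < N" for i j
  proof -
    have "(A * C) $$ (i, j) = (if i = j then 1 else 0)" "(C * A) $$ (i, j) = (if i = j then 1 else 0)"
      using AC CA ij by auto
    then show "(\<Sum>k<N. A $$ (i, k) * C $$ (k, j)) = (if i = j then 1 else 0)"
      "(\<Sum>k<N. C $$ (i, k) * A $$ (k, j)) = (if i = j then 1 else 0)"
      using A C ij by (simp_all add: scalar_prod_def atLeast0LessThan)
  qed
  \<comment> \<open>The linear map with matrix \<open>C\<close>; \<open>inv_into\<close> recovers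
    the index of a basis element.\<close>
  define G where "G = lin_ext (\<lambda>u. \<Sum>k<N. smul (C $$ (k, inv_into {..<N} e u)) (basis (e k)))"
  have linG: "lin G" unfolding G_def by (rule lin_lin_ext)
  have G: "G (basis (e j)) = (\<Sum>k<N. smul (C $$ (k, j)) (basis (e k)))" if "j < N" for j
    using e that by (simp add: G_def bij_betw_def inv_into_f_f)
  have F: "F (basis (e j)) = (\<Sum>k<N. smul (A $$ (k, j)) (basis (e k)))" if "j < N" for j
    using free_on_enum[OF e cl[of "basis (e j)"] lin_ident] eU[OF that] that by (simp add: A_def)
  have swap: "(\<Sum>k<N. smul (a k) (\<Sum>l<N. smul (b l k) (v l))) = (\<Sum>l<N. smul (\<Sum>k<N. b l k * a k) (v l))"
    for a :: "nat \<Rightarrow> 'k" and b and v :: "nat \<Rightarrow> ('a \<Rightarrow>\<^sub>0 'k)"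
  proof -
    have "(\<Sum>k<N. smul (a k) (\<Sum>l<N. smul (b l k) (v l))) = (\<Sum>k<N. \<Sum>l<N. smul (b l k * a k) (v l))"
      by (simp add: smul_sum mult.commute)
    also have "\<dots> = (\<Sum>l<N. \<Sum>k<N. smul (b l k * a k) (v l))" by (rule sum.swap)
    also have "\<dots> = (\<Sum>l<N. smul (\<Sum>k<N. b l k * a k) (v l))"
      by (simp add: smul_module.scale_sum_left)
    finally show ?thesis .
  qed
  have delta: "(\<Sum>l<N. smul (if l = j then 1 else 0) (basis (e l))) = basis (e j)" if "j < N" for j
  proof -
    have "(\<Sum>l<N. smul (if l = j then 1 else 0) (basis (e l))) = (\<Sum>l<N. if l = j then basis (e l) else 0)"
      by (intro sum.cong) auto
    then show ?thesis using that by simp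
  qed
  have FG: "F (G (basis (e j))) = basis (e j)" if "j < N" for j
    using that by (simp add: G lin_sum[OF l] lin_smul[OF l] F swap sums delta)
  have GF: "G (F (basis (e j))) = basis (e j)" if "j < N" for j
    using that by (simp add: F lin_sum[OF linG] lin_smul[OF linG] G swap sums delta)
  have Ge: "\<exists>j<N. u = e j" if "u \<in> U" for u using e that by (auto simp: bij_betw_def)
  have linFG: "lin (\<lambda>v. F (G v))" "lin (\<lambda>v. G (F v))" using l linG by (simp_all add: lin_def)
  have 1: "F (G v) = v" if "v \<in> free_on U" for v
    by (rule lin_eq_on[where F = "\<lambda>v. F (G v)", OF linFG(1) lin_ident _ that]) (use FG Ge in blast)
  have 2: "G (F v) = v" if "v \<in> free_on U" for v
    by (rule lin_eq_on[where F = "\<lambda>v. G (F v)", OF linFG(2) lin_ident _ that]) (use GF Ge in blast)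
  have 3: "G v \<in> free_on U" if "v \<in> free_on U" for v
  proof (rule lin_closed[OF linG _ that])
    fix u assume "u \<in> U"
    then obtain j where "j < N" "u = e j" using Ge by blast
    then show "G (basis u) \<in> free_on U" using eU by (auto simp: G intro!: free_on_sum free_on_smul)
  qed
  show "bij_betw F (free_on U) (free_on U)"
    by (rule bij_betw_byWitness[where f' = G]) (use 1 2 3 cl in blast)+
qed

section \<open>The matrix of \<open>K_plus\<close>\<close>

lemma lookup_bcomp_mono:
  assumes h: "h \<in> mono_up_diagrams p q" and f: "f \<in> mono_up_diagrams p q" and \<sigma>: "\<sigma> \<in> level_diagrams p p"
    and X: "X \<in> S_hom p p"
  shows "Poly_Mapping.lookup (bcomp \<delta> (basis h) X) (hat_comp f \<sigma>) = (if h = f then Poly_Mapping.lookup X \<sigma> else 0)"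
proof -
  have lev: "a \<in> level_diagrams p p" if "a \<in> Poly_Mapping.keys X" for a
    using X that by (auto simp: S_hom_def free_on_def)
  have "bcomp \<delta> (basis h) X = (\<Sum>a\<in>Poly_Mapping.keys X. smul (Poly_Mapping.lookup X a) (bcomp \<delta> (basis h) (basis a)))"
    by (rule lin_expand[OF lin_bcomp])
  also have "\<dots> = (\<Sum>a\<in>Poly_Mapping.keys X. smul (Poly_Mapping.lookup X a) (basis (hat_comp h a)))"
    by (intro sum.cong refl) (simp add: bcomp_up_basis[OF mono_up_up[OF h] level_diagramsD[OF lev]])
  finally have "Poly_Mapping.lookup (bcomp \<delta> (basis h) X) (hat_comp f \<sigma>) =
    (\<Sum>a\<in>Poly_Mapping.keys X. Poly_Mapping.lookup X a * (if hat_comp h a = hat_comp f \<sigma> then 1 else 0))"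
    by (simp add: lookup_sum lookup_basis)
  also have "\<dots> = (\<Sum>a\<in>Poly_Mapping.keys X. if a = \<sigma> then (if h = f then Poly_Mapping.lookup X \<sigma> else 0) else 0)"
  proof (intro sum.cong refl)
    fix a assume a: "a \<in> Poly_Mapping.keys X"
    have "hat_comp h a = hat_comp f \<sigma> \<longleftrightarrow> h = f \<and> a = \<sigma>"
      using up_decomp_unique[OF h lev[OF a] f \<sigma>] by blast
    then show "Poly_Mapping.lookup X a * (if hat_comp h a = hat_comp f \<sigma> then 1 else 0) =
      (if a = \<sigma> then (if h = f then Poly_Mapping.lookup X \<sigma> else 0) else 0)" by auto
  qed
  also have "\<dots> = (if h = f then Poly_Mapping.lookup X \<sigma> else 0)"
    by (simp add: sum.delta in_keys_iff)
  finally show ?thesis .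
qed

text \<open>The same expression serves over the integer polynomials and over the given ring, so
  evaluation at the parameter can be compared entry by entry.\<close>

lemma lookup_pair_b:
  assumes "f \<in> mono_up_diagrams p q" "g \<in> mono_up_diagrams p q" "\<tau> \<in> level_diagrams p p"
  shows "Poly_Mapping.lookup (bcomp \<delta> (pair_b \<delta> (basis (bar f)) (basis g)) (basis \<tau>)) \<sigma> =
    (if level (hat_comp (bar f) g) \<and> hat_comp (hat_comp (bar f) g) \<tau> = \<sigma> then \<delta> ^ loops (bar f) g else 0)"
proof -
  have m: "hat_comp (bar f) g \<in> diagrams p p" using assms(1,2) by (blast dest: mono_up_diagramsD)
  show ?thesis
    by (simp add: pair_b_basis lin_smul[OF lin_bcomp_left[OF lin_ident]] lin_zero[OF lin_bcomp_left[OF lin_ident]]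
        bcomp_down_basis[OF m level_down[OF assms(3)]] lookup_basis)
qed

text \<open>By right linearity the coefficient at \<open>h\<close> of \<open>K_plus\<close> applied
  to \<open>hat_comp g \<tau>\<close> is \<open>b(bar h, g) \<tau>\<close>, and distinct
  \<open>h\<close> contribute to disjoint orbits of basis elements. Hence the entry is a Gram
  entry.\<close>

lemma lookup_K_plus:
  assumes f: "f \<in> mono_up_diagrams p q" and \<sigma>: "\<sigma> \<in> level_diagrams p p"
    and g: "g \<in> mono_up_diagrams p q" and \<tau>: "\<tau> \<in> level_diagrams p p"
  shows "Poly_Mapping.lookup (K_plus \<delta> p q (basis (hat_comp g \<tau>))) (hat_comp f \<sigma>) =
    Poly_Mapping.lookup (bcomp \<delta> (pair_b \<delta> (basis (bar f)) (basis g)) (basis \<tau>)) \<sigma>"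
proof -
  have \<tau>S: "basis \<tau> \<in> S_hom p p" using \<tau> by simp
  have u: "basis (hat_comp g \<tau>) = bcomp \<delta> (basis g) (basis \<tau>)"
    by (rule bcomp_up_basis[OF mono_up_up[OF g] level_diagramsD[OF \<tau>], symmetric])
  have uB: "bcomp \<delta> (basis g) (basis \<tau>) \<in> Bplus p q"
    by (rule bcomp_Bplus[OF mono_mem(1)[OF g] S_hom_Bplus[OF \<tau>S]])
  define X where "X = (\<lambda>h. bcomp \<delta> (pair_b \<delta> (basis (bar h)) (basis g)) (basis \<tau>))"
  have X: "X h \<in> S_hom p p" if "h \<in> mono_up_diagrams p q" for h
    unfolding X_def by (rule bcomp_S_hom[OF b.closed[OF mono_mem(2)[OF that] mono_mem(1)[OF g]] \<tau>S])
  have "K_plus \<delta> p q (basis (hat_comp g \<tau>)) = (\<Sum>h\<in>mono_up_diagrams p q. bcomp \<delta> (basis h) (X h))"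
    unfolding u K_plus_eq[OF uB]
    by (intro sum.cong refl) (simp add: b.right[OF mono_mem(2) mono_mem(1)[OF g] \<tau>S] X_def)
  then have "Poly_Mapping.lookup (K_plus \<delta> p q (basis (hat_comp g \<tau>))) (hat_comp f \<sigma>) =
    (\<Sum>h\<in>mono_up_diagrams p q. Poly_Mapping.lookup (bcomp \<delta> (basis h) (X h)) (hat_comp f \<sigma>))"
    by (simp add: lookup_sum)
  also have "\<dots> = (\<Sum>h\<in>mono_up_diagrams p q. if h = f then Poly_Mapping.lookup (X f) \<sigma> else 0)"
    by (intro sum.cong refl) (simp add: lookup_bcomp_mono[OF _ f \<sigma> X])
  also have "\<dots> = Poly_Mapping.lookup (X f) \<sigma>" using f by (simp add: sum.delta)
  finally show ?thesis by (simp add: X_def)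
qed

lemma eval_comm_ring_hom: "comm_ring_hom (\<lambda>P :: int poly. poly (map_poly of_int P) (\<delta> :: 'k::comm_ring_1))"
proof -
  interpret h: map_poly_comm_ring_hom "of_int :: int \<Rightarrow> 'k" ..
  show ?thesis by unfold_locales (simp_all add: hom_distribs)
qed

text \<open>Evaluation at the parameter is a ring homomorphism and commutes with determinants, so it
  sends \<open>gram_poly\<close> to the determinant of the matrix of \<open>K_plus\<close>.\<close>

lemma gram_poly_unit_iff:
  fixes \<delta> :: "'k::comm_ring_1"
  shows "poly (map_poly of_int (gram_poly p q)) \<delta> dvd 1 \<longleftrightarrow> bij_betw (K_plus \<delta> p q) (Bplus p q) (Bplus p q)"
proof -
  interpret ev: comm_ring_hom "\<lambda>P :: int poly. poly (map_poly of_int P) \<delta>" by (rule eval_comm_ring_hom)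
  let ?I = "gram_index p q"
  define N where "N = card ?I"
  define e where "e = from_nat_into ?I"
  define m where "m = (\<lambda>(h, \<sigma>). hat_comp h \<sigma>)"
  have fin: "finite ?I" by (simp add: gram_index_def)
  have e: "bij_betw e {..<N} ?I" unfolding e_def N_def by (rule bij_betw_from_nat_into_finite[OF fin])
  have "bij_betw m ?I (up_diagrams p q)"
    unfolding bij_betw_def
  proof
    show "inj_on m ?I"
      unfolding inj_on_def gram_index_def m_def using up_decomp_unique by fastforce
    show "m ` ?I = up_diagrams p q"
    proof
      show "m ` ?I \<subseteq> up_diagrams p q"
        unfolding gram_index_def m_def by (auto intro: up_comp mono_up_up level_up)
      show "up_diagrams p q \<subseteq> m ` ?I"
      proof
        fix u assume "u \<in> up_diagrams p q"
        then obtain h \<sigma> where "h \<in> mono_up_diagrams p q" "\<sigma> \<in> level_diagrams p p" "u = hat_comp h \<sigma>"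
          using up_decomp by metis
        then show "u \<in> m ` ?I" by (intro image_eqI[of _ _ "(h, \<sigma>)"]) (auto simp: gram_index_def m_def)
      qed
    qed
  qed
  \<comment> \<open>The index pairs of the Gram matrix thereby enumerate the basis of upward
    diagrams.\<close>
  then have me: "bij_betw (m \<circ> e) {..<N} (up_diagrams p q)" by (rule bij_betw_trans[OF e])
  let ?A = "mat N N (\<lambda>(i, j). gram_entry (e i) (e j))"
  let ?B = "mat N N (\<lambda>(i, j). Poly_Mapping.lookup (K_plus \<delta> p q (basis ((m \<circ> e) j))) ((m \<circ> e) i))"
  have "map_mat (\<lambda>P. poly (map_poly of_int P) \<delta>) ?A = ?B"
  proof (rule eq_matI)
    fix i j assume "i < dim_row ?B" "j < dim_col ?B"
    then have ij: "i < N" "j < N" by auto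
    obtain f \<sigma> where f: "e i = (f, \<sigma>)" by fastforce
    obtain g \<tau> where g: "e j = (g, \<tau>)" by fastforce
    have "e i \<in> ?I" "e j \<in> ?I" using e ij by (auto simp: bij_betw_def)
    then have "(f, \<sigma>) \<in> ?I" "(g, \<tau>) \<in> ?I" using f g by simp_all
    then have mem: "f \<in> mono_up_diagrams p q" "\<sigma> \<in> level_diagrams p p" "g \<in> mono_up_diagrams p q" "\<tau> \<in> level_diagrams p p"
      by (auto simp: gram_index_def)
    have x: "poly (map_poly of_int ([:0, 1:] ^ n)) \<delta> = \<delta> ^ n" for n
    proof -
      have "poly (map_poly of_int [:0, 1:]) \<delta> = \<delta>" by (simp add: map_poly_pCons)
      then show ?thesis using ev.hom_power[of "[:0, 1:]" n] by simp
    qed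
    have "poly (map_poly of_int (gram_entry (e i) (e j))) \<delta> =
      Poly_Mapping.lookup (K_plus \<delta> p q (basis (hat_comp g \<tau>))) (hat_comp f \<sigma>)"
      unfolding lookup_K_plus[OF mem] lookup_pair_b[OF mem(1,3,4)] f g gram_entry_def prod.case
      by (simp add: x)
    then show "map_mat (\<lambda>P. poly (map_poly of_int P) \<delta>) ?A $$ (i, j) = ?B $$ (i, j)"
      using ij by (simp add: f g m_def)
  qed auto
  then have "poly (map_poly of_int (gram_poly p q)) \<delta> = Determinant.det ?B"
    using ev.hom_det[of ?A] by (simp add: gram_poly_def Let_def N_def e_def)
  moreover have "bij_betw (K_plus \<delta> p q) (free_on (up_diagrams p q)) (free_on (up_diagrams p q)) \<longleftrightarrow> Determinant.det ?B dvd 1"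
    by (rule lin_bij_iff_det[OF lin_K_plus[OF lin_ident] _ me])
      (use K_plus_closed in \<open>auto simp: Bplus_def\<close>)
  ultimately show ?thesis by (simp add: Bplus_def)
qed

lemma nonsingular_iff:
  fixes \<delta> :: "'k::comm_ring_1"
  shows "nonsingular \<delta> \<longleftrightarrow> invertible_K_plus \<delta>"
proof
  assume n: "nonsingular \<delta>"
  show "invertible_K_plus \<delta>"
  proof
    fix p q
    show "bij_betw (K_plus \<delta> p q) (Bplus p q) (Bplus p q)"
    proof (cases "prec p q")
      case True
      then show ?thesis using n gram_poly_unit_iff[of p q \<delta>] by (simp add: nonsingular_def)
    next
      case False
      \<comment> \<open>Where \<open>prec\<close> fails there are no upward diagrams, and
        \<open>K_plus\<close> acts on the zero module.\<close>
      then have "up_diagrams p q = {}" using up_diagrams_prec by blast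
      then have "(Bplus p q :: 'k mor set) = {0}" by (auto simp: Bplus_def free_on_def)
      then show ?thesis by (simp add: bij_betw_def lin_zero[OF lin_K_plus[OF lin_ident]])
    qed
  qed
next
  assume "invertible_K_plus \<delta>"
  then interpret invertible_K_plus \<delta> .
  show "nonsingular \<delta>" using K_plus_bij by (simp add: nonsingular_def gram_poly_unit_iff)
qed

theorem theorem8p4:
  fixes \<delta> :: "'k::comm_ring_1"
  shows "(\<exists>d. copairing \<delta> d \<and>
            linear_category_iso (Brauer \<delta>) (pBrauer \<delta> d) (F_d \<delta> d) \<and>
            linear_category_iso (pBrauer \<delta> d) (mBrauer \<delta>) (K_functor \<delta>) \<and>
            linear_category_iso qBrauer (mBrauer \<delta>) (F_d' \<delta>) \<and>
            linear_category_iso (mBrauer \<delta>) qBrauer (inv_functor qBrauer (F_d' \<delta>)))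
         \<longleftrightarrow> nonsingular \<delta>"
proof
  assume "\<exists>d. copairing \<delta> d \<and>
            linear_category_iso (Brauer \<delta>) (pBrauer \<delta> d) (F_d \<delta> d) \<and>
            linear_category_iso (pBrauer \<delta> d) (mBrauer \<delta>) (K_functor \<delta>) \<and>
            linear_category_iso qBrauer (mBrauer \<delta>) (F_d' \<delta>) \<and>
            linear_category_iso (mBrauer \<delta>) qBrauer (inv_functor qBrauer (F_d' \<delta>))"
  then obtain d where "linear_category_iso (pBrauer \<delta> d) (mBrauer \<delta>) (K_functor \<delta>)" by blast
  then interpret K: linear_category_iso "pBrauer \<delta> d" "mBrauer \<delta>" "K_functor \<delta>" .
  have "bij_betw (K_functor \<delta> p q) (B_hom p q) (B_hom p q)" for p q
    using K.F_bij[of p q] by (simp add: pBrauer_def mBrauer_def)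
  \<comment> \<open>Bijectivity of \<open>K_functor\<close> on all hom-modules descends to
    \<open>K_plus\<close> by projection to upward diagrams.\<close>
  then have "invertible_K_plus \<delta>" by (intro invertible_K_plus.intro K_functor_bij_imp)
  then show "nonsingular \<delta>" by (simp add: nonsingular_iff)
next
  assume "nonsingular \<delta>"
  then interpret invertible_K_plus \<delta> by (simp add: nonsingular_iff)
  show "\<exists>d. copairing \<delta> d \<and>
            linear_category_iso (Brauer \<delta>) (pBrauer \<delta> d) (F_d \<delta> d) \<and>
            linear_category_iso (pBrauer \<delta> d) (mBrauer \<delta>) (K_functor \<delta>) \<and>
            linear_category_iso qBrauer (mBrauer \<delta>) (F_d' \<delta>) \<and>
            linear_category_iso (mBrauer \<delta>) qBrauer (inv_functor qBrauer (F_d' \<delta>))"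
    using isomorphisms F_d'_iso[of \<delta>] linear_category_iso_inverse[OF F_d'_iso[of \<delta>]] by blast
qed

end
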